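(* For a countable group to be irreducibly represented, any of the three following conditions is sufficient: (i) the group is torsionfree; (ii) the group is icc; (iii) the group has a faithful primitive action on an infinite set.
   Context: A group is irreducibly represented if it has a faithful irreducible unitary representation (possibly infinite dimensional). A group is icc if it is not reduced to one element and if all its conjugacy classes distinct from $\{e\}$ are infinite. *)

theory Defs
  imports Complex_Main "HOL-Library.Countable_Set" "HOL-Algebra.Module" "HOL-Algebra.Group_Action"
begin

section \<open>Complex Hilbert spaces with explicit carrier\<close>

text \<open>
  The existence of a representation is asserted below as an object-level statement, so Hilbert
  spaces are structures on a carrier set rather than types of some class.
\<close>

definition complex_ring :: "complex ring"
  where "complex_ring = \<lparr>carrier = UNIV, mult = (*), one = 1, zero = 0, add = (+)\<rparr>"

text \<open>
  The fields \<open>mult\<close> and \<open>one\<close> of the record of modules are unused.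
\<close>

record 'h hilbert = "(complex, 'h) module" +
  hinner :: "'h \<Rightarrow> 'h \<Rightarrow> complex"

definition hdist :: "('h, 'z) hilbert_scheme \<Rightarrow> 'h \<Rightarrow> 'h \<Rightarrow> real"
  where "hdist H x y = sqrt (Re (hinner H (x \<ominus>\<^bsub>H\<^esub> y) (x \<ominus>\<^bsub>H\<^esub> y)))"

locale hilbert_space = module complex_ring H for H (structure) +
  assumes inner_commute:
      "\<lbrakk>x \<in> carrier H; y \<in> carrier H\<rbrakk> \<Longrightarrow> hinner H y x = cnj (hinner H x y)"
    and inner_add_left:
      "\<lbrakk>x \<in> carrier H; y \<in> carrier H; z \<in> carrier H\<rbrakk>
        \<Longrightarrow> hinner H (x \<oplus> y) z = hinner H x z + hinner H y z"
    and inner_scale_left: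
      "\<lbrakk>x \<in> carrier H; y \<in> carrier H\<rbrakk> \<Longrightarrow> hinner H (c \<odot> x) y = c * hinner H x y"
    and inner_nonneg: "x \<in> carrier H \<Longrightarrow> 0 \<le> Re (hinner H x x)"
    and inner_eq_zeroD: "\<lbrakk>x \<in> carrier H; hinner H x x = 0\<rbrakk> \<Longrightarrow> x = \<zero>"
    and complete:
      "\<lbrakk>\<And>n. s n \<in> carrier H; \<And>e. 0 < e \<Longrightarrow> \<exists>N::nat. \<forall>m\<ge>N. \<forall>n\<ge>N. hdist H (s m) (s n) < e\<rbrakk>
        \<Longrightarrow> \<exists>x\<in>carrier H. (\<lambda>n. hdist H (s n) x) \<longlonglongrightarrow> 0"

definition closed_subspace :: "'h set \<Rightarrow> ('h, 'z) hilbert_scheme \<Rightarrow> bool"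
  where "closed_subspace W H \<longleftrightarrow>
    submodule W complex_ring H \<and>
    (\<forall>s. \<forall>x\<in>carrier H. (\<forall>n. s n \<in> W) \<and> (\<lambda>n. hdist H (s n) x) \<longlonglongrightarrow> 0 \<longrightarrow> x \<in> W)"


section \<open>Unitary representations\<close>

text \<open>
  By \<^locale>\<open>group_action\<close>, each \<open>\<pi> g\<close> is a bijection of the carrier and \<open>\<pi>\<close> is a
  homomorphism. Groups are discrete, so no continuity is required of \<open>\<pi>\<close>.
\<close>

locale unitary_representation =
  hilbert_space H + group_action G "carrier H" \<pi> for G and H (structure) and \<pi> +
  assumes rep_add:
      "\<lbrakk>g \<in> carrier G; x \<in> carrier H; y \<in> carrier H\<rbrakk> \<Longrightarrow> \<pi> g (x \<oplus> y) = \<pi> g x \<oplus> \<pi> g y"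
    and rep_scale:
      "\<lbrakk>g \<in> carrier G; x \<in> carrier H\<rbrakk> \<Longrightarrow> \<pi> g (c \<odot> x) = c \<odot> \<pi> g x"
    and rep_inner:
      "\<lbrakk>g \<in> carrier G; x \<in> carrier H; y \<in> carrier H\<rbrakk>
        \<Longrightarrow> hinner H (\<pi> g x) (\<pi> g y) = hinner H x y"

locale irreducible_unitary_representation = unitary_representation +
  assumes nonzero: "carrier H \<noteq> {\<zero>}"
    and irreducible:
      "\<lbrakk>closed_subspace W H; \<And>g x. \<lbrakk>g \<in> carrier G; x \<in> W\<rbrakk> \<Longrightarrow> \<pi> g x \<in> W\<rbrakk>
        \<Longrightarrow> W = {\<zero>} \<or> W = carrier H"

text \<open>
  The existential quantifier needs a fixed type for the vectors. The type \<^typ>\<open>'g \<Rightarrow> complex\<close> is no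
  restriction, see \<open>irreducibly_representedI\<close> below.
\<close>

definition irreducibly_represented :: "('g, 'z) monoid_scheme \<Rightarrow> bool"
  where "irreducibly_represented G \<longleftrightarrow>
    (\<exists>(H :: ('g \<Rightarrow> complex) hilbert) \<pi>.
      irreducible_unitary_representation G H \<pi> \<and> faithful_action G (carrier H) \<pi>)"


subsection \<open>Independence of the type of vectors\<close>

lemma cring_complex_ring: "cring complex_ring"
proof (rule cringI)
  show "abelian_group complex_ring"
  proof (rule abelian_groupI)
    fix x assume "x \<in> carrier complex_ring"
    show "\<exists>y\<in>carrier complex_ring. y \<oplus>\<^bsub>complex_ring\<^esub> x = \<zero>\<^bsub>complex_ring\<^esub>"
      by (rule bexI[of _ "- x"]) (auto simp: complex_ring_def)
  qed (auto simp: complex_ring_def)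
  show "comm_monoid complex_ring"
    by unfold_locales (auto simp: complex_ring_def)
qed (auto simp: complex_ring_def algebra_simps)

context hilbert_space
begin

lemma inner_add_right:
  "\<lbrakk>x \<in> carrier H; y \<in> carrier H; z \<in> carrier H\<rbrakk>
    \<Longrightarrow> hinner H x (y \<oplus> z) = hinner H x y + hinner H x z"
  by (metis M.a_closed complex_cnj_add inner_add_left inner_commute)

lemma scale_closed: "x \<in> carrier H \<Longrightarrow> c \<odot> x \<in> carrier H"
  by (rule smult_closed) (auto simp: complex_ring_def)

lemma inner_scale_right:
  "\<lbrakk>x \<in> carrier H; y \<in> carrier H\<rbrakk> \<Longrightarrow> hinner H x (c \<odot> y) = cnj c * hinner H x y"
  by (metis complex_cnj_mult inner_commute inner_scale_left scale_closed)

lemma inner_zero_left: "x \<in> carrier H \<Longrightarrow> hinner H \<zero> x = 0"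
  using inner_add_left[of \<zero> \<zero> x] by simp

lemma inner_uminus_left:
  "\<lbrakk>x \<in> carrier H; y \<in> carrier H\<rbrakk> \<Longrightarrow> hinner H (\<ominus> x) y = - hinner H x y"
  using inner_add_left[of "\<ominus> x" x y]
  by (simp add: inner_zero_left M.l_neg eq_neg_iff_add_eq_0)

lemma inner_minus_left:
  "\<lbrakk>x \<in> carrier H; y \<in> carrier H; z \<in> carrier H\<rbrakk>
    \<Longrightarrow> hinner H (x \<ominus> y) z = hinner H x z - hinner H y z"
  by (simp add: a_minus_def inner_add_left inner_uminus_left)

lemma inner_self: "x \<in> carrier H \<Longrightarrow> hinner H x x = of_real (Re (hinner H x x))"
  using inner_commute[of x x] by (simp add: complex_eq_iff)

lemma Cauchy_Schwarz:
  assumes x: "x \<in> carrier H" and y: "y \<in> carrier H"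
  shows "cmod (hinner H x y) \<le> sqrt (Re (hinner H x x)) * sqrt (Re (hinner H y y))"
proof (cases "hinner H y y = 0")
  case True
  then have "y = \<zero>" using y inner_eq_zeroD by blast
  then have "hinner H x y = 0"
    using x inner_commute[of \<zero> x] by (simp add: inner_zero_left)
  then show ?thesis using x y by (simp add: inner_nonneg)
next
  case False
  define a where "a = Re (hinner H y y)"
  define b where "b = hinner H x y"
  define c where "c = - b / of_real a"
  have yy: "hinner H y y = of_real a" using inner_self y a_def by simp
  have a: "a > 0" using False yy inner_nonneg[OF y] by (auto simp: less_le)
  have yx: "hinner H y x = cnj b" using inner_commute[OF x y] b_def by simp
  have "0 \<le> Re (hinner H (x \<oplus> c \<odot> y) (x \<oplus> c \<odot> y))"
    using x y by (intro inner_nonneg) (simp add: scale_closed)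
  also have "hinner H (x \<oplus> c \<odot> y) (x \<oplus> c \<odot> y)
      = hinner H x x + cnj c * b + c * cnj b + c * cnj c * of_real a"
    using x y by (simp add: inner_add_left inner_add_right inner_scale_left inner_scale_right
      scale_closed yy yx b_def[symmetric] algebra_simps)
  also have "\<dots> = hinner H x x - b * cnj b / of_real a"
    using a by (simp add: c_def field_simps)
  also have "Re \<dots> = Re (hinner H x x) - (cmod b)\<^sup>2 / a"
    by (simp flip: complex_norm_square of_real_divide of_real_power)
  finally have "(cmod b)\<^sup>2 \<le> Re (hinner H x x) * a" using a by (simp add: field_simps)
  then have "cmod b \<le> sqrt (Re (hinner H x x) * a)" by (rule real_le_rsqrt)
  then show ?thesis by (simp add: real_sqrt_mult a_def b_def)
qed

end

lemma a_minus_transport: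
  assumes H: "abelian_group H" and H': "abelian_group H'"
    and inj: "inj_on j (carrier H)" and car: "carrier H' = j ` carrier H"
    and z: "\<zero>\<^bsub>H'\<^esub> = j \<zero>\<^bsub>H\<^esub>"
    and add: "\<And>x y. \<lbrakk>x \<in> carrier H; y \<in> carrier H\<rbrakk> \<Longrightarrow> j x \<oplus>\<^bsub>H'\<^esub> j y = j (x \<oplus>\<^bsub>H\<^esub> y)"
    and x: "x \<in> carrier H" and y: "y \<in> carrier H"
  shows "j x \<ominus>\<^bsub>H'\<^esub> j y = j (x \<ominus>\<^bsub>H\<^esub> y)"
proof -
  interpret H: abelian_group H by fact
  interpret H': abelian_group H' by fact
  have "j (\<ominus>\<^bsub>H\<^esub> y) \<oplus>\<^bsub>H'\<^esub> j y = \<zero>\<^bsub>H'\<^esub>" using y by (simp add: add z H.l_neg)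
  then have "\<ominus>\<^bsub>H'\<^esub> j y = j (\<ominus>\<^bsub>H\<^esub> y)" using y by (intro H'.minus_equality) (auto simp: car)
  then show ?thesis using x y by (simp add: a_minus_def add)
qed

text \<open>
  A nonzero vector \<open>\<xi>\<close> of an irreducible representation gives a linear injection
  \<open>x \<mapsto> (g \<mapsto> \<langle>x, \<pi> g \<xi>\<rangle>)\<close> of the space into the functions on the group, along which the whole
  structure can be transported.
\<close>

lemma irreducibly_representedI:
  fixes G :: "('g, 'z) monoid_scheme" and H :: "('h, 'y) hilbert_scheme"
  assumes irr: "irreducible_unitary_representation G H \<pi>"
    and faithful: "faithful_action G (carrier H) \<pi>"
  shows "irreducibly_represented G"
proof -
  interpret irreducible_unitary_representation G H \<pi> by fact
  interpret F: faithful_action G "carrier H" \<pi> by fact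
  interpret G: group G using group_hom by (simp add: group_hom_def)
  have pc [simp]: "\<pi> g x \<in> carrier H" if "g \<in> carrier G" "x \<in> carrier H" for g x
    using that element_image by blast
  have pm: "\<pi> (g \<otimes>\<^bsub>G\<^esub> h) x = \<pi> g (\<pi> h x)"
    if "g \<in> carrier G" "h \<in> carrier G" "x \<in> carrier H" for g h x
    using that composition_rule by blast
  have p1: "\<pi> \<one>\<^bsub>G\<^esub> x = x" if "x \<in> carrier H" for x
    using that id_eq_one by (metis restrict_apply')
  obtain \<xi> where xi: "\<xi> \<in> carrier H" "\<xi> \<noteq> \<zero>\<^bsub>H\<^esub>"
    using nonzero by (metis M.zero_closed is_singletonI' is_singleton_the_elem empty_iff singletonD)
  define j where "j x = (\<lambda>g. if g \<in> carrier G then hinner H x (\<pi> g \<xi>) else 0)" for x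
  define K where "K = {x \<in> carrier H. \<forall>g\<in>carrier G. hinner H x (\<pi> g \<xi>) = 0}"
  have "submodule K complex_ring H"
    by (rule submoduleI) (auto simp: K_def inner_zero_left inner_uminus_left inner_add_left
      inner_scale_left xi scale_closed)
  moreover have "x \<in> K"
    if x: "x \<in> carrier H" and s: "\<And>n. s n \<in> K" and lim: "(\<lambda>n. hdist H (s n) x) \<longlonglongrightarrow> 0" for s x
  proof -
    have "hinner H x (\<pi> g \<xi>) = 0" if g: "g \<in> carrier G" for g
    proof -
      define C where "C = sqrt (Re (hinner H (\<pi> g \<xi>) (\<pi> g \<xi>)))"
      have "cmod (hinner H x (\<pi> g \<xi>)) \<le> hdist H (s n) x * C" for n
      proof -
        have sn: "s n \<in> carrier H" "hinner H (s n) (\<pi> g \<xi>) = 0" using s[of n] g by (auto simp: K_def)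
        have "cmod (hinner H x (\<pi> g \<xi>)) = cmod (hinner H (s n \<ominus>\<^bsub>H\<^esub> x) (\<pi> g \<xi>))"
          using sn x g xi by (simp add: inner_minus_left)
        also have "\<dots> \<le> hdist H (s n) x * C"
          unfolding hdist_def C_def using sn x g xi by (intro Cauchy_Schwarz) auto
        finally show ?thesis .
      qed
      moreover have "(\<lambda>n. hdist H (s n) x * C) \<longlonglongrightarrow> 0" using tendsto_mult_left_zero[OF lim] .
      ultimately have "cmod (hinner H x (\<pi> g \<xi>)) \<le> 0" by (intro LIMSEQ_le_const) auto
      then show ?thesis by simp
    qed
    then show ?thesis using x by (simp add: K_def)
  qed
  ultimately have "closed_subspace K H" by (auto simp: closed_subspace_def)
  moreover have "\<pi> h x \<in> K" if h: "h \<in> carrier G" and x: "x \<in> K" for h x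
  proof -
    have xc: "x \<in> carrier H" using x by (simp add: K_def)
    have "hinner H (\<pi> h x) (\<pi> g \<xi>) = 0" if g: "g \<in> carrier G" for g
    proof -
      have "\<pi> g \<xi> = \<pi> h (\<pi> (inv\<^bsub>G\<^esub> h \<otimes>\<^bsub>G\<^esub> g) \<xi>)"
        using g h xi by (simp add: pm[symmetric] G.m_assoc[symmetric])
      then show ?thesis using g h x xi xc by (simp add: rep_inner K_def)
    qed
    then show ?thesis using xc h by (simp add: K_def)
  qed
  ultimately have "K = {\<zero>\<^bsub>H\<^esub>} \<or> K = carrier H" by (rule irreducible)
  moreover have "\<xi> \<notin> K"
    using xi inner_eq_zeroD[of \<xi>] p1[of \<xi>] G.one_closed unfolding K_def by force
  ultimately have K0: "K = {\<zero>\<^bsub>H\<^esub>}" using xi by auto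
  have inj: "inj_on j (carrier H)"
  proof (rule inj_onI)
    fix x y assume x: "x \<in> carrier H" and y: "y \<in> carrier H" and eq: "j x = j y"
    have "hinner H x (\<pi> g \<xi>) = hinner H y (\<pi> g \<xi>)" if "g \<in> carrier G" for g
      using fun_cong[OF eq, of g] that by (simp add: j_def)
    then have "x \<ominus>\<^bsub>H\<^esub> y \<in> K" using x y xi by (simp add: K_def inner_minus_left)
    then show "x = y" using K0 x y M.minus_equality M.minus_minus
      by (metis M.add.inv_closed M.minus_eq M.r_neg singletonD M.add.inv_solve_right M.l_zero M.zero_closed)
  qed

  define k where "k = inv_into (carrier H) j"
  have kj [simp]: "k (j x) = x" if "x \<in> carrier H" for x using inj that by (simp add: k_def)
  define H' :: "('g \<Rightarrow> complex) hilbert" where "H' =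
    \<lparr>carrier = j ` carrier H, mult = undefined, one = undefined, zero = j \<zero>\<^bsub>H\<^esub>,
     add = (\<lambda>a b. j (k a \<oplus>\<^bsub>H\<^esub> k b)), smult = (\<lambda>c a. j (c \<odot>\<^bsub>H\<^esub> k a)),
     hinner = (\<lambda>a b. hinner H (k a) (k b))\<rparr>"
  define \<pi>' where "\<pi>' g = (\<lambda>a \<in> carrier H'. j (\<pi> g (k a)))" for g
  have car: "carrier H' = j ` carrier H" and z: "\<zero>\<^bsub>H'\<^esub> = j \<zero>\<^bsub>H\<^esub>"
    by (simp_all add: H'_def)
  have add: "j x \<oplus>\<^bsub>H'\<^esub> j y = j (x \<oplus>\<^bsub>H\<^esub> y)" if "x \<in> carrier H" "y \<in> carrier H" for x y
    using that by (simp add: H'_def)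
  have scl: "c \<odot>\<^bsub>H'\<^esub> j x = j (c \<odot>\<^bsub>H\<^esub> x)" if "x \<in> carrier H" for c x
    using that by (simp add: H'_def)
  have inn: "hinner H' (j x) (j y) = hinner H x y" if "x \<in> carrier H" "y \<in> carrier H" for x y
    using that by (simp add: H'_def)
  have pi': "\<pi>' g (j x) = j (\<pi> g x)" if "x \<in> carrier H" for g x
    using that by (simp add: \<pi>'_def car)
  have jc: "j x \<in> carrier H'" if "x \<in> carrier H" for x using that by (simp add: car)
  have ab': "abelian_group H'"
  proof (rule abelian_groupI)
    fix a assume "a \<in> carrier H'"
    then obtain x where x: "x \<in> carrier H" "a = j x" by (auto simp: car)
    then show "\<exists>b\<in>carrier H'. b \<oplus>\<^bsub>H'\<^esub> a = \<zero>\<^bsub>H'\<^esub>"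
      by (intro bexI[of _ "j (\<ominus>\<^bsub>H\<^esub> x)"]) (simp_all add: add z M.l_neg jc)
  qed (auto simp: car add z M.a_ac)
  have mod': "module complex_ring H'"
    using cring_complex_ring ab'
  proof (rule moduleI)
    fix c d a assume "c \<in> carrier complex_ring" "d \<in> carrier complex_ring" "a \<in> carrier H'"
    then show "(c \<oplus>\<^bsub>complex_ring\<^esub> d) \<odot>\<^bsub>H'\<^esub> a = c \<odot>\<^bsub>H'\<^esub> a \<oplus>\<^bsub>H'\<^esub> d \<odot>\<^bsub>H'\<^esub> a"
      and "(c \<otimes>\<^bsub>complex_ring\<^esub> d) \<odot>\<^bsub>H'\<^esub> a = c \<odot>\<^bsub>H'\<^esub> (d \<odot>\<^bsub>H'\<^esub> a)"
      by (auto simp: car scl add scale_closed smult_l_distr smult_assoc1)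
  qed (auto simp: car scl add scale_closed smult_r_distr)
  have minus: "j x \<ominus>\<^bsub>H'\<^esub> j y = j (x \<ominus>\<^bsub>H\<^esub> y)" if "x \<in> carrier H" "y \<in> carrier H" for x y
    using a_minus_transport[OF M.abelian_group_axioms ab' inj car z add that] .
  have dist: "hdist H' (j x) (j y) = hdist H x y" if "x \<in> carrier H" "y \<in> carrier H" for x y
    using that by (simp add: hdist_def minus inn)
  have hil': "hilbert_space H'"
  proof (rule hilbert_space.intro[OF mod'], unfold_locales)
    show "hinner H' b a = cnj (hinner H' a b)" if "a \<in> carrier H'" "b \<in> carrier H'" for a b
      using that by (auto simp: car inn intro: inner_commute)
    show "hinner H' (a \<oplus>\<^bsub>H'\<^esub> b) d = hinner H' a d + hinner H' b d"
      if "a \<in> carrier H'" "b \<in> carrier H'" "d \<in> carrier H'" for a b d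
      using that by (auto simp: car inn add inner_add_left)
    show "hinner H' (c \<odot>\<^bsub>H'\<^esub> a) b = c * hinner H' a b"
      if "a \<in> carrier H'" "b \<in> carrier H'" for a b c
      using that by (auto simp: car inn scl scale_closed inner_scale_left)
    show "0 \<le> Re (hinner H' a a)" if "a \<in> carrier H'" for a
      using that by (auto simp: car inn inner_nonneg)
    show "a = \<zero>\<^bsub>H'\<^esub>" if "a \<in> carrier H'" "hinner H' a a = 0" for a
      using that by (auto simp: car inn z dest: inner_eq_zeroD)
    fix s :: "nat \<Rightarrow> _"
    assume s: "\<And>n. s n \<in> carrier H'"
      and Cauchy: "\<And>e. 0 < e \<Longrightarrow> \<exists>N. \<forall>m\<ge>N. \<forall>n\<ge>N. hdist H' (s m) (s n) < e"
    have "\<exists>t. \<forall>n. t n \<in> carrier H \<and> s n = j (t n)" using s unfolding car by (intro choice) blast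
    then obtain t where t: "\<And>n. t n \<in> carrier H" "\<And>n. s n = j (t n)" by blast
    have "\<exists>x\<in>carrier H. (\<lambda>n. hdist H (t n) x) \<longlonglongrightarrow> 0"
      using Cauchy t by (intro complete) (auto simp: dist)
    then show "\<exists>a\<in>carrier H'. (\<lambda>n. hdist H' (s n) a) \<longlonglongrightarrow> 0" using t by (auto simp: car dist)
  qed
  have bij': "\<pi>' g \<in> Bij (carrier H')" if g: "g \<in> carrier G" for g
  proof -
    have "inj_on (\<pi>' g) (carrier H')"
    proof (rule inj_onI)
      fix a b assume "a \<in> carrier H'" "b \<in> carrier H'" and eq: "\<pi>' g a = \<pi>' g b"
      then obtain x y where xy: "x \<in> carrier H" "y \<in> carrier H" "a = j x" "b = j y"
        by (auto simp: car)
      then have "\<pi> g x = \<pi> g y" using eq inj_onD[OF inj, of "\<pi> g x" "\<pi> g y"] g by (simp add: pi')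
      then show "a = b" using inj_onD[OF inj_prop[OF g]] xy by blast
    qed
    moreover have "\<pi>' g ` carrier H' = carrier H'"
    proof -
      have "\<pi>' g ` carrier H' = j ` (\<pi> g ` carrier H)" by (auto simp: car pi' image_iff)
      then show ?thesis using surj_prop[OF g] by (simp add: car)
    qed
    ultimately show ?thesis by (simp add: Bij_def bij_betw_def \<pi>'_def)
  qed
  have act': "group_action G (carrier H') \<pi>'"
    unfolding group_action_def group_hom_def group_hom_axioms_def
  proof (intro conjI homI)
    show "Group.group G" by (rule G.group_axioms)
    show "Group.group (BijGroup (carrier H'))" by (rule group_BijGroup)
    show "\<pi>' g \<in> carrier (BijGroup (carrier H'))" if "g \<in> carrier G" for g
      using bij' that by (simp add: BijGroup_def)
    show "\<pi>' (g \<otimes>\<^bsub>G\<^esub> h) = \<pi>' g \<otimes>\<^bsub>BijGroup (carrier H')\<^esub> \<pi>' h"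
      if "g \<in> carrier G" "h \<in> carrier G" for g h
    proof -
      have "\<pi>' (g \<otimes>\<^bsub>G\<^esub> h) = compose (carrier H') (\<pi>' g) (\<pi>' h)"
      proof
        fix a show "\<pi>' (g \<otimes>\<^bsub>G\<^esub> h) a = compose (carrier H') (\<pi>' g) (\<pi>' h) a"
        proof (cases "a \<in> carrier H'")
          case True
          then show ?thesis using that by (auto simp: compose_def car pi' pm)
        qed (simp add: \<pi>'_def compose_def)
      qed
      then show ?thesis using that bij' by (simp add: BijGroup_def)
    qed
  qed
  have uni': "unitary_representation G H' \<pi>'"
    by (intro unitary_representation.intro hil' act', unfold_locales)
      (auto simp: car pi' add scl inn rep_add rep_scale rep_inner scale_closed)
  have irr': "irreducible_unitary_representation G H' \<pi>'"
  proof (rule irreducible_unitary_representation.intro[OF uni'], unfold_locales)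
    show "carrier H' \<noteq> {\<zero>\<^bsub>H'\<^esub>}"
    proof
      assume "carrier H' = {\<zero>\<^bsub>H'\<^esub>}"
      then have "j \<xi> = j \<zero>\<^bsub>H\<^esub>" using jc[OF xi(1)] z by simp
      then show False using inj_onD[OF inj] xi by blast
    qed
    fix W assume W: "closed_subspace W H'"
      and inv: "\<And>g x. \<lbrakk>g \<in> carrier G; x \<in> W\<rbrakk> \<Longrightarrow> \<pi>' g x \<in> W"
    have subW: "submodule W complex_ring H'" using W by (simp add: closed_subspace_def)
    note WE = module.submoduleE[OF mod' subW]
    define V where "V = {x \<in> carrier H. j x \<in> W}"
    have WV: "W = j ` V" using WE(1) by (auto simp: V_def car)
    have zW: "j \<zero>\<^bsub>H\<^esub> \<in> W"
      using subgroup.one_closed[OF submodule.axioms(1)[OF subW]] z by simp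
    have "j (\<ominus>\<^bsub>H\<^esub> x) \<in> W" if "x \<in> V" for x
    proof -
      have xc: "x \<in> carrier H" and "j x \<in> W" using that by (auto simp: V_def)
      then have "\<ominus>\<^bsub>H'\<^esub> j x \<in> W" using WE(3) by blast
      moreover have "\<ominus>\<^bsub>H'\<^esub> j x = j (\<ominus>\<^bsub>H\<^esub> x)"
        using xc by (intro abelian_group.minus_equality[OF ab']) (auto simp: add z M.l_neg jc)
      ultimately show ?thesis by simp
    qed
    then have "submodule V complex_ring H"
      using zW WE(4,5)
      by (intro submoduleI) (auto simp: V_def add[symmetric] scl[symmetric] scale_closed)
    moreover have "x \<in> V"
      if "x \<in> carrier H" "\<And>n. s n \<in> V" "(\<lambda>n. hdist H (s n) x) \<longlonglongrightarrow> 0" for s x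
    proof -
      have "(\<lambda>n. hdist H' (j (s n)) (j x)) \<longlonglongrightarrow> 0" using that by (simp add: V_def dist)
      moreover have "\<forall>n. j (s n) \<in> W" using that by (simp add: V_def)
      moreover have "j x \<in> carrier H'" using that jc by blast
      ultimately have "j x \<in> W"
        using W unfolding closed_subspace_def by (elim conjE allE[of _ "\<lambda>n. j (s n)"]) blast
      then show ?thesis using that by (simp add: V_def)
    qed
    ultimately have "closed_subspace V H" by (auto simp: closed_subspace_def)
    moreover have "\<pi> g x \<in> V" if "g \<in> carrier G" "x \<in> V" for g x
      using inv[of g "j x"] that by (simp add: V_def pi')
    ultimately have "V = {\<zero>\<^bsub>H\<^esub>} \<or> V = carrier H" by (rule irreducible)
    then show "W = {\<zero>\<^bsub>H'\<^esub>} \<or> W = carrier H'" by (auto simp: WV z car)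
  qed
  have "inj_on \<pi>' (carrier G)"
  proof (rule inj_onI)
    fix g h assume g: "g \<in> carrier G" and h: "h \<in> carrier G" and eq: "\<pi>' g = \<pi>' h"
    have "\<pi> g x = \<pi> h x" if x: "x \<in> carrier H" for x
      using fun_cong[OF eq, of "j x"] inj_onD[OF inj, of "\<pi> g x" "\<pi> h x"] x g h by (simp add: pi')
    moreover have "\<pi> g \<in> extensional (carrier H)" "\<pi> h \<in> extensional (carrier H)"
      using bij_prop0 g h by (auto simp: Bij_def)
    ultimately have "\<pi> g = \<pi> h" by (intro extensionalityI) auto
    then show "g = h" using F.faithful g h by (auto dest: inj_onD)
  qed
  then have "faithful_action G (carrier H') \<pi>'"
    by (intro faithful_action.intro act' faithful_action_axioms.intro)
  with irr' show ?thesis unfolding irreducibly_represented_def by blast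
qed


section \<open>Conditions on groups and actions\<close>

definition torsionfree :: "('g, 'z) monoid_scheme \<Rightarrow> bool"
  where "torsionfree G \<longleftrightarrow>
    (\<forall>x\<in>carrier G. \<forall>n::nat. 0 < n \<and> x [^]\<^bsub>G\<^esub> n = \<one>\<^bsub>G\<^esub> \<longrightarrow> x = \<one>\<^bsub>G\<^esub>)"

definition conjugacy_class :: "('g, 'z) monoid_scheme \<Rightarrow> 'g \<Rightarrow> 'g set"
  where "conjugacy_class G x = {g \<otimes>\<^bsub>G\<^esub> x \<otimes>\<^bsub>G\<^esub> inv\<^bsub>G\<^esub> g | g. g \<in> carrier G}"

definition icc :: "('g, 'z) monoid_scheme \<Rightarrow> bool"
  where "icc G \<longleftrightarrow>
    carrier G \<noteq> {\<one>\<^bsub>G\<^esub>} \<and>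
    (\<forall>x\<in>carrier G. conjugacy_class G x \<noteq> {\<one>\<^bsub>G\<^esub>} \<longrightarrow> infinite (conjugacy_class G x))"

locale primitive_action = transitive_action +
  assumes invariant_equiv_trivial:
    "\<lbrakk>equiv E r; \<And>g x y. \<lbrakk>g \<in> carrier G; (x, y) \<in> r\<rbrakk> \<Longrightarrow> (\<phi> g x, \<phi> g y) \<in> r\<rbrakk>
      \<Longrightarrow> r = Id_on E \<or> r = E \<times> E"

end

theory Submission
  imports "HOL-Analysis.Analysis" Defs
begin

text \<open>
  Each of the three conditions makes every nontrivial normal subgroup infinite. Let \<open>K\<close> be the compact
  convex set of the normalized positive definite functions that are pointwise limits of finitely
  supported ones. Those which are \<open>1\<close> on a normal subgroup \<open>N\<close> form a closed convex set \<open>F N\<close>. If \<open>N\<close> is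
  infinite, a finitely supported \<open>p\<close> is never \<open>t \<psi> + (1 - t) \<psi>'\<close> with \<open>t > 0\<close>, \<open>\<psi> \<in> F N\<close> and \<open>\<psi>' \<in> K\<close>:
  compare the sums over \<open>a, b \<in> A\<close> of the values at \<open>b\<^sup>-\<^sup>1 a\<close> for large finite \<open>A \<subseteq> N\<close>. So a slice of \<open>K\<close>
  contains a smaller slice that avoids \<open>F N\<close>. Avoiding in turn the sets \<open>F N\<close> for the normal closures \<open>N\<close>
  of the nontrivial elements, while the diameters of the slices tend to zero, one reaches an extreme
  point of \<open>K\<close> that is in none of them. Its GNS representation is irreducible by extremality, and
  faithful because its kernel is a normal subgroup on which the function is \<open>1\<close>.
\<close>


section \<open>Extreme points outside countably many convex sets\<close>

unbundle inner_syntax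

text \<open>The closure of the finitely supported functions is taken, rather than all positive
  definite ones, because the averaging argument needs a finitely supported \<open>p\<close> in every
  slice; for a non-amenable group the constant 1, for instance, is not a limit of such functions.
  The resulting \<open>K\<close> is the state space of the reduced group C*-algebra, restricted to
  group elements. The price is that an extreme point of \<open>K\<close> is only known to be extreme
  against members of \<open>K\<close>. Irreducibility therefore rests on \<open>coefficient\<close>:
  the diagonal coefficients of all vectors of the GNS space must lie in the closed cone again.
  Slices, and not single points, are refined because a finitely supported \<open>p\<close> need not
  be extreme; the part of \<open>K\<close> outside a slice is convex, and this finally yields
  extremality. Countability enters twice: only countably many coordinates have to be controlled, and
  countably many normal closures suffice, since every nontrivial normal subgroup contains the normal
  closure of one of its nontrivial elements.\<close>

definition mix :: "real \<Rightarrow> ('a \<Rightarrow> complex) \<Rightarrow> ('a \<Rightarrow> complex) \<Rightarrow> 'a \<Rightarrow> complex"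
  where "mix t x y = (\<lambda>a. of_real t * x a + of_real (1 - t) * y a)"

definition mix_closed :: "('a \<Rightarrow> complex) set \<Rightarrow> bool"
  where "mix_closed S \<longleftrightarrow> (\<forall>x\<in>S. \<forall>y\<in>S. \<forall>t\<in>{0..1}. mix t x y \<in> S)"

text \<open>The real dual for the topology of pointwise convergence. Real linearity suffices:
  separation and slices compare real numbers, and \<open>functionals_coordinate\<close> provides the
  real and imaginary parts of coordinates.\<close>

definition functionals :: "(('a \<Rightarrow> complex) \<Rightarrow> real) set"
  where "functionals = {f. continuous_on UNIV f \<and> (\<forall>x y. f (\<lambda>a. x a + y a) = f x + f y) \<and>
    (\<forall>r x. f (\<lambda>a. of_real r * x a) = r * f x)}"

lemma functionals_mix: "f \<in> functionals \<Longrightarrow> f (mix t x y) = t * f x + (1 - t) * f y"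
  by (simp add: functionals_def mix_def del: of_real_diff)

lemma functionals_continuous: "f \<in> functionals \<Longrightarrow> continuous_on S f"
  by (auto simp: functionals_def intro: continuous_on_subset)

lemma functionals_add_scale:
  "\<lbrakk>f \<in> functionals; u \<in> functionals\<rbrakk> \<Longrightarrow> (\<lambda>x. f x + d * u x) \<in> functionals"
  by (auto simp: functionals_def algebra_simps intro!: continuous_intros)

lemma functionals_zero: "(\<lambda>x. 0) \<in> functionals"
  by (simp add: functionals_def)

lemma functionals_inner: "(\<lambda>x. \<Sum>a\<in>J. y a \<bullet> x a) \<in> functionals"
proof -
  have "continuous_on UNIV (\<lambda>x. \<Sum>a\<in>J. y a \<bullet> x a)"
    by (intro continuous_on_sum continuous_on_inner continuous_on_const continuous_on_product_coordinates)
  moreover have "y a \<bullet> (of_real r * z) = r * (y a \<bullet> z)" for a r z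
    by (metis inner_scaleR_right scaleR_conv_of_real)
  ultimately show ?thesis
    by (simp add: functionals_def inner_add_right sum.distrib sum_distrib_left)
qed

lemma functionals_coordinate: "(\<lambda>x. w \<bullet> x a) \<in> functionals"
  using functionals_inner[of "\<lambda>_. w" "{a}"] by simp

lemma mix_closedD: "\<lbrakk>mix_closed S; x \<in> S; y \<in> S; 0 \<le> t; t \<le> 1\<rbrakk> \<Longrightarrow> mix t x y \<in> S"
  by (simp add: mix_closed_def)

lemma compact_fun_imp_closed:
  fixes S :: "('a \<Rightarrow> 'b::metric_space) set"
  assumes "compact S"
  shows "closed S"
proof -
  have "Hausdorff_space (euclidean :: ('a \<Rightarrow> 'b) topology)"
    unfolding euclidean_product_topology[symmetric] by (simp add: Hausdorff_space_product_topology)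
  then show ?thesis using compactin_imp_closedin[of euclidean S] assms by simp
qed

text \<open>A nearest-point argument: a basic neighbourhood of \<open>p\<close> missing
  \<open>L\<close> restricts finitely many coordinates, and in these \<open>p\<close> has positive
  distance to \<open>L\<close>. If \<open>q\<close> in \<open>L\<close> is nearest, every segment
  from \<open>q\<close> towards \<open>Z\<close> stays in \<open>L\<close>, so it makes no acute
  angle with \<open>p - q\<close>; the functional is the inner product with \<open>p - q\<close>.
  The star condition has the form that \<open>join_star\<close> delivers for a join.\<close>

lemma star_separation:
  assumes L: "compact L" and p: "p \<notin> L" and Z: "Z \<subseteq> L"
    and star: "\<And>q z s. \<lbrakk>q \<in> L; z \<in> Z; 0 < s; s \<le> 1\<rbrakk> \<Longrightarrow> mix s z q \<in> L"
  shows "\<exists>h\<in>functionals. \<exists>c. c < h p \<and> (\<forall>z\<in>Z. h z < c)"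
proof (cases "L = {}")
  case True
  then show ?thesis using Z by (intro bexI[OF _ functionals_zero] exI[of _ "-1"]) auto
next
  case False
  have "open (- L)" using compact_fun_imp_closed[OF L] by (simp add: closed_def)
  then obtain U where U: "p \<in> (\<Pi>\<^sub>E a\<in>UNIV. U a)" "\<And>a. open (U a)" "finite {a. U a \<noteq> UNIV}"
    "(\<Pi>\<^sub>E a\<in>UNIV. U a) \<subseteq> - L"
    using product_topology_open_contains_basis[of "\<lambda>_. euclidean" UNIV "- L" p] p
    by (auto simp: open_fun_def)
  define J where "J = {a. U a \<noteq> UNIV}"
  define D where "D x = (\<Sum>a\<in>J. (x a - p a) \<bullet> (x a - p a))" for x
  have J: "finite J" using U by (simp add: J_def)
  have Dpos: "0 < D x" if "x \<in> L" for x
  proof -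
    have "x \<notin> (\<Pi>\<^sub>E a\<in>UNIV. U a)" using that U by auto
    then obtain a where a: "x a \<notin> U a" by auto
    then have "a \<in> J" by (auto simp: J_def)
    moreover have "x a \<noteq> p a" using a U(1) by auto
    ultimately show ?thesis unfolding D_def using J by (intro sum_pos2[of _ a]) auto
  qed
  have "continuous_on L D" unfolding D_def
    by (intro continuous_intros continuous_on_subset[OF continuous_on_product_coordinates]) auto
  then obtain q where q: "q \<in> L" "\<And>x. x \<in> L \<Longrightarrow> D q \<le> D x"
    using continuous_attains_inf[OF L False] by blast
  define h where "h x = (\<Sum>a\<in>J. (p a - q a) \<bullet> x a)" for x
  have hf: "h \<in> functionals" unfolding h_def by (rule functionals_inner)
  have "h p - h q = D q"
    by (simp add: h_def D_def flip: sum_subtractf) (simp add: algebra_simps)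
  then have hpq: "h q < h p" using Dpos[OF q(1)] by simp
  have hz: "h z \<le> h q" if z: "z \<in> Z" for z
  proof -
    define A where "A = (\<Sum>a\<in>J. (q a - p a) \<bullet> (z a - q a))"
    define B where "B = (\<Sum>a\<in>J. (z a - q a) \<bullet> (z a - q a))"
    \<comment> \<open>\<open>D\<close> at \<open>q + s (z - q)\<close> exceeds \<open>D q\<close> by
      \<open>s (2 A + s B)\<close>; minimality makes this nonnegative, and letting \<open>s\<close>
      tend to 0 leaves \<open>0 \<le> A\<close>.\<close>
    have "0 \<le> 2 * A + s * B" if s: "0 < s" "s \<le> 1" for s
    proof -
      have "D (mix s z q) = (\<Sum>a\<in>J. ((q a - p a) + s *\<^sub>R (z a - q a)) \<bullet> ((q a - p a) + s *\<^sub>R (z a - q a)))"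
        unfolding D_def mix_def by (intro sum.cong refl) (simp add: scaleR_conv_of_real algebra_simps)
      also have "\<dots> = D q + 2 * s * A + s * s * B"
        unfolding A_def B_def D_def sum_distrib_left sum.distrib[symmetric]
        by (intro sum.cong refl) (simp add: inner_add_left inner_add_right inner_commute algebra_simps)
      finally have "0 \<le> 2 * s * A + s * s * B" using q(2)[OF star[OF q(1) z s]] by simp
      then have "0 \<le> s * (2 * A + s * B)" by (simp add: algebra_simps)
      then show ?thesis using s by (simp add: zero_le_mult_iff)
    qed
    then have ev: "\<forall>\<^sub>F s in at_right 0. 0 \<le> 2 * A + s * B"
      unfolding eventually_at_right[OF zero_less_one] by (intro exI[of _ 1]) auto
    have lim: "((\<lambda>s. 2 * A + s * B) \<longlongrightarrow> 2 * A + 0 * B) (at_right 0)"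
      by (intro tendsto_intros)
    have "0 \<le> 2 * A + 0 * B"
      by (rule tendsto_lowerbound[OF lim ev]) simp
    moreover have "h q - h z = A"
      by (simp add: h_def A_def flip: sum_subtractf) (simp add: algebra_simps)
    ultimately show ?thesis by simp
  qed
  show ?thesis
    using hf hpq by (intro bexI[of _ h] exI[of _ "(h p + h q) / 2"]) (auto dest!: hz)
qed

lemma join_compact:
  assumes A: "compact A" and B: "compact B"
  shows "compact {mix t x y | t x y. t \<in> {0..1} \<and> x \<in> A \<and> y \<in> B}"
proof -
  have "{mix t x y | t x y. t \<in> {0..1} \<and> x \<in> A \<and> y \<in> B}
      = (\<lambda>(t, x, y). mix t x y) ` ({0..1} \<times> A \<times> B)" by force
  moreover have "continuous_on ({0..1} \<times> A \<times> B) (\<lambda>(t, x, y). mix t x y)"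
    unfolding mix_def case_prod_beta
  proof (rule continuous_on_coordinatewise_then_product)
    fix a
    have "continuous_on ({0..1} \<times> A \<times> B) (\<lambda>u. fst (snd u) a)"
      "continuous_on ({0..1} \<times> A \<times> B) (\<lambda>u. snd (snd u) a)"
      by (rule continuous_on_product_then_coordinatewise, intro continuous_intros)+
    then show "continuous_on ({0..1} \<times> A \<times> B)
        (\<lambda>u. of_real (fst u) * fst (snd u) a + of_real (1 - fst u) * snd (snd u) a)"
      by (intro continuous_intros)
  qed
  ultimately show ?thesis using A B by (auto intro!: compact_continuous_image compact_Times)
qed

lemma mix_swap: "mix t x y = mix (1 - t) y x"
  by (auto simp: mix_def)

lemma mix_self: "mix t x x = x"
  by (auto simp: mix_def algebra_simps)

text \<open>The points \<open>z\<close>, \<open>x\<close>, \<open>y\<close> carry the weights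
  \<open>s\<close>, \<open>(1 - s) t\<close>, \<open>(1 - s) (1 - t)\<close>; the first two are
  merged.\<close>

lemma mix_mix:
  assumes "s + (1 - s) * t \<noteq> 0"
  shows "mix s z (mix t x y) = mix (s + (1 - s) * t) (mix (s / (s + (1 - s) * t)) z x) y"
proof
  fix a
  define r where "r = s + (1 - s) * t"
  have r: "complex_of_real r \<noteq> 0" using assms unfolding of_real_eq_0_iff r_def .
  have "of_real r * (of_real (s / r) * z a + of_real (1 - s / r) * x a)
      = of_real s * z a + of_real (r - s) * x a"
    using r by (simp add: field_simps)
  then show "mix s z (mix t x y) a = mix (s + (1 - s) * t) (mix (s / (s + (1 - s) * t)) z x) y a"
    unfolding r_def[symmetric] by (simp add: mix_def) (simp add: r_def algebra_simps)
qed

text \<open>Absorbing \<open>z\<close> into the endpoint \<open>x\<close> by \<open>mix_mix\<close>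
  leaves the other endpoint \<open>y\<close> untouched.\<close>

lemma join_star:
  assumes A: "mix_closed A" and q: "q = mix t x y" "0 \<le> t" "t \<le> 1" "x \<in> A" and z: "z \<in> A"
    and s: "0 < s" "s \<le> 1"
  shows "\<exists>r x'. 0 \<le> r \<and> r \<le> 1 \<and> x' \<in> A \<and> mix s z q = mix r x' y"
proof -
  define r where "r = s + (1 - s) * t"
  have "0 \<le> (1 - s) * t" using s q by simp
  then have r: "s \<le> r" "0 < r" using s by (auto simp: r_def)
  have "(1 - s) * t \<le> (1 - s) * 1" using s q by (intro mult_left_mono) auto
  then have r1: "r \<le> 1" by (simp add: r_def)
  have "mix s z q = mix r (mix (s / r) z x) y"
    unfolding q r_def by (rule mix_mix) (use r in \<open>simp add: r_def\<close>)
  moreover have "mix (s / r) z x \<in> A"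
    using A z q r s by (intro mix_closedD) auto
  ultimately show ?thesis using r r1 by (intro exI[of _ r] exI[of _ "mix (s / r) z x"]) auto
qed

text \<open>Let \<open>N\<close> be the part of \<open>K\<close> where \<open>f\<close> is at most
  \<open>c\<close>. A point of the join of \<open>F\<close> and \<open>N\<close> has a weight
  \<open>t\<close> on \<open>F\<close>: for \<open>p\<close>, \<open>t > 0\<close> is excluded by
  the last hypothesis and \<open>t = 0\<close> by \<open>c < f p\<close>. So \<open>p\<close> is off
  the compact join, and a functional larger at \<open>p\<close> than on \<open>F\<close> and
  \<open>N\<close> cuts out a slice inside the old one and away from \<open>F\<close>.\<close>

lemma slice_avoiding:
  assumes K: "compact K" "mix_closed K" and F: "closed F" "mix_closed F" "F \<subseteq> K"
    and f: "f \<in> functionals" and p: "p \<in> K" "c < f p"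
    and nodec: "\<And>t x y. \<lbrakk>0 < t; t \<le> 1; x \<in> F; y \<in> K\<rbrakk> \<Longrightarrow> p \<noteq> mix t x y"
  shows "\<exists>h\<in>functionals. \<exists>d. d < h p \<and> (\<forall>x\<in>K. d \<le> h x \<longrightarrow> c < f x \<and> x \<notin> F)"
proof -
  define N where "N = {x \<in> K. f x \<le> c}"
  have "closed {x. f x \<le> c}"
    using functionals_continuous[OF f] by (intro closed_Collect_le) auto
  then have "compact (K \<inter> {x. f x \<le> c})" using K by (intro compact_Int_closed)
  moreover have "K \<inter> {x. f x \<le> c} = N" by (auto simp: N_def)
  ultimately have N: "compact N" by simp
  have Nm: "mix_closed N"
    unfolding mix_closed_def
  proof (intro ballI)
    fix x y and t :: real assume *: "x \<in> N" "y \<in> N" "t \<in> {0..1}"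
    then have "t * f x + (1 - t) * f y \<le> t * c + (1 - t) * c"
      by (intro add_mono mult_left_mono) (auto simp: N_def)
    then show "mix t x y \<in> N"
      using * mix_closedD[OF K(2), of x y t] by (simp add: N_def functionals_mix[OF f] algebra_simps)
  qed
  have Fc: "compact F" using F K by (metis compact_Int_closed inf.absorb_iff2)
  define J where "J = {mix t x y | t x y. t \<in> {0..1} \<and> x \<in> F \<and> y \<in> N}"
  \<comment> \<open>With an empty factor the join \<open>J\<close> would be empty and lose the other
    set.\<close>
  define L where "L = (if F = {} then N else if N = {} then F else J)"
  have "compact L" using N Fc join_compact[OF Fc N] by (simp add: L_def J_def)
  moreover have "p \<notin> L"
  proof
    assume "p \<in> L"
    moreover have "p \<notin> N" using p by (simp add: N_def)
    \<comment> \<open>For \<open>t = 1\<close> the second point has weight zero, so \<open>p\<close>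
      itself can serve as it.\<close>
    moreover have "p \<notin> F" using nodec[of 1 p p] p by (auto simp: mix_self)
    moreover have "p \<noteq> mix t x y" if "0 \<le> t" "t \<le> 1" "x \<in> F" "y \<in> N" for t x y
    proof (cases "t = 0")
      case True
      then show ?thesis using that \<open>p \<notin> N\<close> by (auto simp: mix_def)
    next
      case False
      then show ?thesis using that nodec[of t x y] by (auto simp: N_def)
    qed
    ultimately show False by (auto simp: L_def J_def split: if_splits)
  qed
  moreover have "F \<union> N \<subseteq> L"
  proof -
    have "x \<in> J" if x: "x \<in> F" "N \<noteq> {}" for x
    proof -
      obtain y where "y \<in> N" using x by auto
      then show ?thesis using x unfolding J_def
        by (intro CollectI exI[of _ 1] exI[of _ x] exI[of _ y]) (auto simp: mix_def)
    qed
    moreover have "y \<in> J" if y: "y \<in> N" "F \<noteq> {}" for y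
    proof -
      obtain x where "x \<in> F" using y by auto
      then show ?thesis using y unfolding J_def
        by (intro CollectI exI[of _ 0] exI[of _ x] exI[of _ y]) (auto simp: mix_def)
    qed
    ultimately show ?thesis by (auto simp: L_def)
  qed
  moreover have "mix s z q \<in> L" if q: "q \<in> L" and z: "z \<in> F \<union> N" and s: "0 < s" "s \<le> 1" for q z s
  proof (cases "F = {} \<or> N = {}")
    case True
    then show ?thesis using q z s F(2) Nm by (auto simp: L_def intro: mix_closedD split: if_splits)
  next
    case False
    then obtain t x y where t: "0 \<le> t" "t \<le> 1" "x \<in> F" "y \<in> N" "q = mix t x y"
      using q by (auto simp: L_def J_def)
    have "mix s z q \<in> J"
    proof (cases "z \<in> F")
      case True
      then obtain r x' where "0 \<le> r" "r \<le> 1" "x' \<in> F" "mix s z q = mix r x' y"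
        using join_star[OF F(2) t(5,1,2,3) True s] by blast
      then show ?thesis using t unfolding J_def by auto
    next
      case False
      then have zN: "z \<in> N" using z by auto
      \<comment> \<open>The two ends are exchanged, so that \<open>N\<close> is the set absorbing
        \<open>z\<close>.\<close>
      have q': "q = mix (1 - t) y x" using t mix_swap by metis
      obtain r y' where "0 \<le> r" "r \<le> 1" "y' \<in> N" "mix s z q = mix r y' x"
        using join_star[OF Nm q' _ _ t(4) zN s] t by auto
      then show ?thesis using t unfolding J_def
        by (intro CollectI exI[of _ "1 - r"] exI[of _ x] exI[of _ y']) (auto simp: mix_swap[of r])
    qed
    then show ?thesis using False by (auto simp: L_def)
  qed
  ultimately obtain h d where "h \<in> functionals" "d < h p" "\<forall>z\<in>F \<union> N. h z < d"
    using star_separation[of L p "F \<union> N"] by blast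
  then show ?thesis by (intro bexI[of _ h] exI[of _ d]) (force simp: N_def not_le[symmetric])+
qed

text \<open>
  Tilting \<open>f\<close> slightly towards \<open>u\<close> moves the slice close to the points where \<open>u\<close> is maximal among the
  maximal points of \<open>f\<close>.
\<close>

lemma slice_small_oscillation:
  assumes K: "compact K" and f: "f \<in> functionals" and u: "u \<in> functionals"
    and p: "p \<in> K" "c < f p" and e: "0 < (e::real)"
  shows "\<exists>h\<in>functionals. \<exists>d. (\<exists>x\<in>K. d < h x) \<and>
    (\<forall>x\<in>K. d \<le> h x \<longrightarrow> c < f x) \<and> (\<forall>x\<in>K. \<forall>y\<in>K. d \<le> h x \<and> d \<le> h y \<longrightarrow> \<bar>u x - u y\<bar> \<le> e)"
proof -
  have ne: "K \<noteq> {}" using p by auto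
  note cf = functionals_continuous[OF f] and cu = functionals_continuous[OF u]
  obtain x0 where x0: "x0 \<in> K" "\<And>x. x \<in> K \<Longrightarrow> f x \<le> f x0"
    using continuous_attains_sup[OF K ne cf] by blast
  define m where "m = f x0"
  have mc: "c < m" using x0(2)[OF p(1)] p by (simp add: m_def)
  have "closed {x. m \<le> f x}" by (intro closed_Collect_le cf) auto
  then have "compact (K \<inter> {x. m \<le> f x})" using K by (intro compact_Int_closed)
  moreover have "x0 \<in> K \<inter> {x. m \<le> f x}" using x0 m_def by auto
  ultimately obtain x1 where x1: "x1 \<in> K" "m \<le> f x1" "\<And>x. x \<in> K \<Longrightarrow> m \<le> f x \<Longrightarrow> u x \<le> u x1"
    using continuous_attains_sup[of "K \<inter> {x. m \<le> f x}" u] cu by auto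
  define M where "M = u x1"
  obtain xb where xb: "xb \<in> K" "\<And>x. x \<in> K \<Longrightarrow> u x \<le> u xb"
    using continuous_attains_sup[OF K ne cu] by blast
  \<comment> \<open>Where \<open>f\<close> is maximal, \<open>u\<close> is at most \<open>M\<close>;
    so on the compact set where \<open>u\<close> is at least \<open>M + e / 2\<close>,
    \<open>f\<close> stays below \<open>m\<close> by a positive gap.\<close>
  have "\<exists>w>0. \<forall>x\<in>K. m - w < f x \<longrightarrow> u x < M + e / 2"
  proof (cases "K \<inter> {x. M + e / 2 \<le> u x} = {}")
    case True
    then show ?thesis by (intro exI[of _ 1]) (auto simp: not_le)
  next
    case False
    have "closed {x. M + e / 2 \<le> u x}" by (intro closed_Collect_le cu) auto
    then have "compact (K \<inter> {x. M + e / 2 \<le> u x})" using K by (intro compact_Int_closed)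
    then obtain y where y: "y \<in> K" "M + e / 2 \<le> u y"
        "\<And>x. \<lbrakk>x \<in> K; M + e / 2 \<le> u x\<rbrakk> \<Longrightarrow> f x \<le> f y"
      using continuous_attains_sup[OF _ False cf] by auto
    have "f y < m" using x1(3)[OF y(1)] y e by (auto simp: M_def not_le[symmetric])
    then show ?thesis using y(3) by (intro exI[of _ "m - f y"]) (auto simp: not_le[symmetric])
  qed
  then obtain w where w: "0 < w" "\<And>x. \<lbrakk>x \<in> K; m - w < f x\<rbrakk> \<Longrightarrow> u x < M + e / 2" by blast
  \<comment> \<open>\<open>R\<close> exceeds every value of \<open>u - (M - e / 2)\<close> on
    \<open>K\<close>. With \<open>\<delta> * R = v\<close> the tilt can therefore only make up for a
    loss of less than \<open>v\<close> in \<open>f\<close>, which keeps both \<open>c < f x\<close>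
    and \<open>u x < M + e / 2\<close>. Since \<open>f \<le> m\<close>, reaching the level
    \<open>d'\<close> also forces \<open>M - e / 2 \<le> u x\<close>.\<close>
  define v where "v = min w (m - c)"
  define R where "R = u xb - M + e"
  define \<delta> where "\<delta> = v / R"
  have R: "0 < R" using xb(2)[OF x1(1)] e by (simp add: R_def M_def)
  have v: "0 < v" "v \<le> w" "v \<le> m - c" using w mc by (auto simp: v_def)
  have d: "0 < \<delta>" "\<delta> * R = v" using v R by (auto simp: \<delta>_def)
  define h where "h x = f x + \<delta> * u x" for x
  define d' where "d' = m + \<delta> * (M - e / 2)"
  have hf: "h \<in> functionals" unfolding h_def by (rule functionals_add_scale[OF f u])
  have "0 < \<delta> * (e / 2)" using d e by simp
  then have "d' < h x1" (is ?ne) using x1(2) unfolding d'_def h_def M_def right_diff_distrib by linarith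
  have main: "m - v < f x \<and> M - e / 2 \<le> u x" if x: "x \<in> K" "d' \<le> h x" for x
  proof -
    have "f x \<le> m" using x0(2)[OF x(1)] by (simp add: m_def)
    moreover have "\<delta> * (u x - (M - e / 2)) \<ge> m - f x"
      using x(2) by (simp add: d'_def h_def algebra_simps)
    ultimately have a: "0 \<le> \<delta> * (u x - (M - e / 2))" by simp
    have "u x - (M - e / 2) < R" using xb(2)[OF x(1)] e by (simp add: R_def)
    then have "\<delta> * (u x - (M - e / 2)) < v" using d mult_strict_left_mono by metis
    then show ?thesis using a d \<open>\<delta> * (u x - (M - e / 2)) \<ge> m - f x\<close>
      by (auto simp: zero_le_mult_iff)
  qed
  have gt: "c < f x" if "x \<in> K" "d' \<le> h x" for x
    using main[OF that] v by linarith
  have osc: "\<bar>u x - u y\<bar> \<le> e" if "x \<in> K" "y \<in> K" "d' \<le> h x" "d' \<le> h y" for x y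
  proof -
    have "u x < M + e / 2" "u y < M + e / 2"
      using w(2)[of x] w(2)[of y] main[of x] main[of y] that v by auto
    then show ?thesis using main[of x] main[of y] that by (auto simp: abs_le_iff)
  qed
  show ?thesis
    by (rule bexI[OF _ hf], rule exI[of _ d']) (use \<open>?ne\<close> x1(1) gt osc in \<open>intro conjI ballI impI; blast\<close>)
qed

text \<open>
  Nested slices of oscillation tending to zero in every coordinate meet in an extreme point: one of
  the endpoints of a segment through the limit lies in infinitely many of the slices.
\<close>

theorem extreme_point_avoiding:
  fixes K :: "('a \<Rightarrow> complex) set"
  assumes K: "compact K" "mix_closed K" "K \<noteq> {}"
    and I: "countable I" "\<And>x a. \<lbrakk>x \<in> K; a \<notin> I\<rbrakk> \<Longrightarrow> x a = 0"
    and \<F>: "countable \<F>" "\<And>F. F \<in> \<F> \<Longrightarrow> closed F \<and> mix_closed F \<and> F \<subseteq> K"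
    and dense: "\<And>f c x F. \<lbrakk>f \<in> functionals; x \<in> K; c < f x; F \<in> \<F>\<rbrakk> \<Longrightarrow>
      \<exists>p\<in>K. c < f p \<and> (\<forall>t x y. 0 < t \<and> t \<le> 1 \<and> x \<in> F \<and> y \<in> K \<longrightarrow> p \<noteq> mix t x y)"
  obtains e where "e \<in> K" "e \<notin> \<Union>\<F>"
    "\<And>x y t. \<lbrakk>x \<in> K; y \<in> K; 0 < t; t < 1; e = mix t x y\<rbrakk> \<Longrightarrow> x = e"
proof -
  define C where "C f c = {x \<in> K. c \<le> f x}" for f :: "('a \<Rightarrow> complex) \<Rightarrow> real" and c :: real
  define small where "small w a r S \<longleftrightarrow> (\<forall>x\<in>S. \<forall>y\<in>S. \<bar>w \<bullet> x a - w \<bullet> y a\<bar> \<le> (r :: real))"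
    for w :: complex and a :: 'a and r S
  \<comment> \<open>The tasks are properties to be achieved by slices: missing some
    \<open>F\<close>, or oscillating by at most \<open>1 / (n + 1)\<close> in the real part
    (\<open>w = 1\<close>) or the imaginary part (\<open>w = \<i>\<close>) of a coordinate. The
    trivial task keeps \<open>\<T>\<close> nonempty, so that \<open>from_nat_into\<close> enumerates
    it.\<close>
  define \<T> where "\<T> = insert (\<lambda>_. True) ((\<lambda>F S. S \<inter> F = {}) ` \<F> \<union>
    (\<lambda>(w, a, n :: nat). small w a (inverse (Suc n))) ` ({1, \<i>} \<times> I \<times> UNIV))"
  have \<T>: "countable \<T>" "\<T> \<noteq> {}"
    unfolding \<T>_def using I(1) \<F>(1) by simp_all
  define T where "T = from_nat_into \<T>"
  have step: "\<exists>h d. h \<in> functionals \<and> (\<exists>x\<in>K. d < h x) \<and> (\<forall>x\<in>C h d. c < f x) \<and> P (C h d)"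
    if f: "f \<in> functionals" and x: "x \<in> K" "c < f x" and P: "P \<in> \<T>" for f c x P
  proof -
    consider "P = (\<lambda>_. True)" | F where "F \<in> \<F>" "P = (\<lambda>S. S \<inter> F = {})"
      | w a r where "P = small w a r" "0 < r"
      using P unfolding \<T>_def by fastforce
    then show ?thesis
    proof cases
      case 1
      then show ?thesis using f x
        by (intro exI[of _ f] exI[of _ "(c + f x) / 2"]) (auto simp: C_def field_simps intro!: bexI[of _ x])
    next
      case 2
      obtain p where p: "p \<in> K" "c < f p"
        "\<And>t x y. \<lbrakk>0 < t; t \<le> 1; x \<in> F; y \<in> K\<rbrakk> \<Longrightarrow> p \<noteq> mix t x y"
        using dense[OF f x 2(1)] by blast
      obtain h d where "h \<in> functionals" "d < h p" "\<forall>x\<in>K. d \<le> h x \<longrightarrow> c < f x \<and> x \<notin> F"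
        using slice_avoiding[OF K(1,2) _ _ _ f p] \<F>(2)[OF 2(1)] by blast
      then show ?thesis using p(1) 2
        by (intro exI[of _ h] exI[of _ d]) (auto simp: C_def)
    next
      case 3
      obtain h d where "h \<in> functionals" "\<exists>x\<in>K. d < h x" "\<forall>x\<in>K. d \<le> h x \<longrightarrow> c < f x"
        "\<forall>x\<in>K. \<forall>y\<in>K. d \<le> h x \<and> d \<le> h y \<longrightarrow> \<bar>w \<bullet> x a - w \<bullet> y a\<bar> \<le> r"
        using slice_small_oscillation[OF K(1) f functionals_coordinate[of w a] x 3(2)] by blast
      then show ?thesis using 3
        by (intro exI[of _ h] exI[of _ d]) (auto simp: C_def small_def)
    qed
  qed
  define good where "good s \<longleftrightarrow> fst s \<in> functionals \<and> (\<exists>x\<in>K. snd s < fst s x)"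
    for s :: "(('a \<Rightarrow> complex) \<Rightarrow> real) \<times> real"
  define next_slice where "next_slice n s s' \<longleftrightarrow>
    (\<forall>x\<in>C (fst s') (snd s'). snd s < fst s x) \<and> T n (C (fst s') (snd s'))"
    for n and s s' :: "(('a \<Rightarrow> complex) \<Rightarrow> real) \<times> real"
  have "\<exists>s. \<forall>n. good (s n) \<and> next_slice n (s n) (s (Suc n))"
  proof (rule dependent_nat_choice)
    obtain x where "x \<in> K" using K by auto
    \<comment> \<open>The zero functional at level -1 gives all of \<open>K\<close> as the first
      slice.\<close>
    then have "good (\<lambda>_. 0, -1)" by (auto simp: good_def functionals_zero)
    then show "\<exists>s. good s" ..
  next
    fix s n assume "good s"
    then obtain x where x: "fst s \<in> functionals" "x \<in> K" "snd s < fst s x" by (auto simp: good_def)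
    have "T n \<in> \<T>" unfolding T_def using from_nat_into[OF \<T>(2)] .
    from step[OF x this] obtain h d where "h \<in> functionals" "\<exists>x\<in>K. d < h x"
      "\<forall>x\<in>C h d. snd s < fst s x" "T n (C h d)" by blast
    then have "good (h, d) \<and> next_slice n s (h, d)" by (auto simp: good_def next_slice_def)
    then show "\<exists>s'. good s' \<and> next_slice n s s'" ..
  qed
  then obtain s where s: "\<And>n. good (s n)" "\<And>n. next_slice n (s n) (s (Suc n))" by blast
  define D where "D n = C (fst (s n)) (snd (s n))" for n
  have sf: "fst (s n) \<in> functionals" for n using s(1) by (simp add: good_def)
  have D: "compact (D n)" "D n \<noteq> {}" "D n \<subseteq> K" for n
  proof -
    have "closed {x. snd (s n) \<le> fst (s n) x}"
      using functionals_continuous[OF sf] by (intro closed_Collect_le) auto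
    then have "compact (K \<inter> {x. snd (s n) \<le> fst (s n) x})" using K by (intro compact_Int_closed)
    moreover have "K \<inter> {x. snd (s n) \<le> fst (s n) x} = D n" by (auto simp: D_def C_def)
    ultimately show "compact (D n)" by simp
    show "D n \<noteq> {}" using s(1)[of n] by (force simp: D_def C_def good_def)
    show "D n \<subseteq> K" by (auto simp: D_def C_def)
  qed
  have "D (Suc n) \<subseteq> D n" for n
    using s(2)[of n] unfolding next_slice_def by (force simp: D_def C_def)
  then have dec: "D m \<subseteq> D n" if "n \<le> m" for m n
    using that by (rule lift_Suc_antimono_le)
  have "D 0 \<inter> (\<Inter>n\<in>UNIV. D n) \<noteq> {}"
  proof (rule compact_imp_fip_image)
    fix M :: "nat set" assume M: "finite M"
    obtain k where "\<And>n. n \<in> M \<Longrightarrow> n \<le> k" using finite_nat_set_iff_bounded_le M by auto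
    then have "D k \<subseteq> D 0 \<inter> (\<Inter>n\<in>M. D n)" using dec by blast
    then show "D 0 \<inter> (\<Inter>n\<in>M. D n) \<noteq> {}" using D(2)[of k] by blast
  qed (auto intro: D(1) compact_fun_imp_closed[OF D(1)])
  then obtain e where e: "\<And>n. e \<in> D n" by auto
  have task: "\<exists>n. P (D n)" if P: "P \<in> \<T>" for P
  proof -
    obtain n where "T n = P" using from_nat_into_surj[OF \<T>(1) P] by (auto simp: T_def)
    \<comment> \<open>\<open>next_slice n\<close> imposes task \<open>n\<close> on the slice with
      index \<open>Suc n\<close>.\<close>
    then show ?thesis using s(2)[of n] by (auto simp: next_slice_def D_def intro!: exI[of _ "Suc n"])
  qed
  show thesis
  proof
    show eK: "e \<in> K" using e D(3) by blast
    show "e \<notin> \<Union>\<F>"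
    proof
      assume "e \<in> \<Union>\<F>"
      then obtain F where F: "F \<in> \<F>" "e \<in> F" by auto
      then have "(\<lambda>S. S \<inter> F = {}) \<in> \<T>" by (auto simp: \<T>_def)
      then show False using task e F by blast
    qed
    have xK: "x \<in> K" if "\<And>n. x \<in> D n" for x using that D(3) by blast
    \<comment> \<open>The oscillation tasks shrink the slices to one point: real and imaginary parts
      agree on the coordinates in \<open>I\<close>, and all other coordinates vanish on
      \<open>K\<close>.\<close>
    have uniq: "x = e" if x: "\<And>n. x \<in> D n" for x
    proof
      fix a
      have "w \<bullet> x a = w \<bullet> e a" if w: "w \<in> {1, \<i>}" and a: "a \<in> I" for w
      proof -
        have "\<bar>w \<bullet> x a - w \<bullet> e a\<bar> \<le> inverse (Suc n)" for n
        proof -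
          have "small w a (inverse (Suc n)) \<in> \<T>"
            unfolding \<T>_def using w a by (intro insertI2 UnI2 image_eqI[of _ _ "(w, a, n)"]) auto
          then obtain m where "small w a (inverse (Suc n)) (D m)" using task by blast
          then show ?thesis using x[of m] e[of m] by (simp add: small_def)
        qed
        then have "\<bar>w \<bullet> x a - w \<bullet> e a\<bar> \<le> 0"
          by (intro LIMSEQ_le_const[OF LIMSEQ_inverse_real_of_nat]) auto
        then show ?thesis by simp
      qed
      from this[of 1] this[of \<i>] show "x a = e a"
        using I(2)[of x a] I(2)[of e a] eK xK[OF x] by (cases "a \<in> I") (auto simp: complex_eq_iff inner_complex_def)
    qed
    fix x y t assume x: "x \<in> K" and y: "y \<in> K" and t: "0 < t" "t < 1" and exy: "e = mix t x y"
    \<comment> \<open>The complement of a slice in \<open>K\<close> is convex, so it cannot contain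
      both ends of a segment through \<open>e\<close>.\<close>
    have split: "x \<in> D n \<or> y \<in> D n" for n
    proof (rule ccontr)
      assume "\<not> ?thesis"
      then have "fst (s n) x < snd (s n)" "fst (s n) y < snd (s n)" using x y by (auto simp: D_def C_def)
      then have "t * fst (s n) x + (1 - t) * fst (s n) y < t * snd (s n) + (1 - t) * snd (s n)"
        using t by (intro add_strict_mono mult_strict_left_mono) auto
      then have "fst (s n) e < snd (s n)"
        by (simp add: exy functionals_mix[OF sf] algebra_simps)
      then show False using e[of n] by (simp add: D_def C_def)
    qed
    show "x = e"
    proof (cases "\<forall>n. x \<in> D n")
      case True
      then show ?thesis using uniq by blast
    next
      case False
      then obtain n where n: "x \<notin> D n" by auto
      have "y \<in> D m" for m
        using split[of "max m n"] dec[of n "max m n"] dec[of m "max m n"] n by auto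
      then have "y = e" by (rule uniq)
      then have "of_real t * e a = of_real t * x a" for a
        using fun_cong[OF exy, of a] by (simp add: mix_def algebra_simps)
      then show ?thesis using t by auto
    qed
  qed
qed


section \<open>Reproducing kernel Hilbert spaces\<close>

locale positive_kernel =
  fixes X :: "'a set" and k :: "'a \<Rightarrow> 'a \<Rightarrow> complex"
  assumes hermitian: "\<lbrakk>a \<in> X; b \<in> X\<rbrakk> \<Longrightarrow> k b a = cnj (k a b)"
    and positive: "\<lbrakk>finite A; A \<subseteq> X\<rbrakk> \<Longrightarrow> 0 \<le> Re (\<Sum>a\<in>A. \<Sum>b\<in>A. c a * cnj (c b) * k a b)"
begin

section \<open>Finitely supported coefficients and the semi-inner product of the kernel\<close>

definition finsupp :: "('a \<Rightarrow> complex) set"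
  where "finsupp = {c. finite {a. c a \<noteq> 0} \<and> {a. c a \<noteq> 0} \<subseteq> X}"

definition form :: "('a \<Rightarrow> complex) \<Rightarrow> ('a \<Rightarrow> complex) \<Rightarrow> complex"
  where "form c d = (\<Sum>a | c a \<noteq> 0. \<Sum>b | d b \<noteq> 0. c a * cnj (d b) * k a b)"

definition snorm :: "('a \<Rightarrow> complex) \<Rightarrow> real"
  where "snorm c = sqrt (Re (form c c))"

text \<open>The formal combination of kernel functions with coefficients \<open>c\<close>, made into
  a function; its value at \<open>b\<close> in \<open>X\<close> is the pairing of \<open>c\<close>
  with \<open>point b\<close>. The value 0 outside \<open>X\<close> makes such functions comparable
  by their values on \<open>X\<close>.\<close>

definition kernel_sum :: "('a \<Rightarrow> complex) \<Rightarrow> 'a \<Rightarrow> complex"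
  where "kernel_sum c b = (if b \<in> X then \<Sum>a | c a \<noteq> 0. c a * k a b else 0)"

definition point :: "'a \<Rightarrow> 'a \<Rightarrow> complex"
  where "point b = (\<lambda>a. if a = b then 1 else 0)"

text \<open>Supports change under sums, since terms can cancel; with common finite index sets,
  additivity is just distributing sums.\<close>

lemma form_eq:
  assumes "finite S" "{a. c a \<noteq> 0} \<subseteq> S" "finite T" "{a. d a \<noteq> 0} \<subseteq> T"
  shows "form c d = (\<Sum>a\<in>S. \<Sum>b\<in>T. c a * cnj (d b) * k a b)"
proof -
  have "form c d = (\<Sum>a | c a \<noteq> 0. \<Sum>b\<in>T. c a * cnj (d b) * k a b)"
    unfolding form_def using assms by (intro sum.cong refl sum.mono_neutral_left) auto
  also have "\<dots> = (\<Sum>a\<in>S. \<Sum>b\<in>T. c a * cnj (d b) * k a b)"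
    using assms by (intro sum.mono_neutral_left) auto
  finally show ?thesis .
qed

lemma kernel_sum_eq:
  assumes "finite S" "{a. c a \<noteq> 0} \<subseteq> S" "b \<in> X"
  shows "kernel_sum c b = (\<Sum>a\<in>S. c a * k a b)"
  unfolding kernel_sum_def using assms by (auto intro!: sum.mono_neutral_left)

lemma finsuppI: "\<lbrakk>finite S; S \<subseteq> X; \<And>a. a \<notin> S \<Longrightarrow> c a = 0\<rbrakk> \<Longrightarrow> c \<in> finsupp"
  unfolding finsupp_def by (auto intro: finite_subset[of _ S])

lemma finsuppE:
  assumes "c \<in> finsupp"
  obtains S where "finite S" "S \<subseteq> X" "\<And>a. a \<notin> S \<Longrightarrow> c a = 0"
  using assms by (auto simp: finsupp_def)

lemma finsupp_add:
  assumes "c \<in> finsupp" "d \<in> finsupp"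
  shows "(\<lambda>a. c a + d a) \<in> finsupp"
proof -
  obtain S T where "finite S" "S \<subseteq> X" "\<And>a. a \<notin> S \<Longrightarrow> c a = 0"
    "finite T" "T \<subseteq> X" "\<And>a. a \<notin> T \<Longrightarrow> d a = 0"
    using assms finsuppE by metis
  then show ?thesis by (intro finsuppI[of "S \<union> T"]) auto
qed

lemma finsupp_diff:
  assumes "c \<in> finsupp" "d \<in> finsupp"
  shows "(\<lambda>a. c a - d a) \<in> finsupp"
proof -
  obtain S T where "finite S" "S \<subseteq> X" "\<And>a. a \<notin> S \<Longrightarrow> c a = 0"
    "finite T" "T \<subseteq> X" "\<And>a. a \<notin> T \<Longrightarrow> d a = 0"
    using assms finsuppE by metis
  then show ?thesis by (intro finsuppI[of "S \<union> T"]) auto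
qed

lemma finsupp_scale: "c \<in> finsupp \<Longrightarrow> (\<lambda>a. r * c a) \<in> finsupp"
  unfolding finsupp_def by (auto intro: finite_subset[of _ "{a. c a \<noteq> 0}"])

lemma finsupp_point: "b \<in> X \<Longrightarrow> point b \<in> finsupp"
  by (auto simp: finsupp_def point_def)

lemma finsupp_zero: "(\<lambda>a. 0) \<in> finsupp"
  by (simp add: finsupp_def)

lemma form_add_left:
  assumes "c \<in> finsupp" "c' \<in> finsupp" "d \<in> finsupp"
  shows "form (\<lambda>a. c a + c' a) d = form c d + form c' d"
proof -
  let ?S = "{a. c a \<noteq> 0} \<union> {a. c' a \<noteq> 0}" and ?T = "{a. d a \<noteq> 0}"
  have fin: "finite ?S" "finite ?T" using assms by (auto simp: finsupp_def)
  have "form (\<lambda>a. c a + c' a) d = (\<Sum>a\<in>?S. \<Sum>b\<in>?T. (c a + c' a) * cnj (d b) * k a b)"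
    using fin by (intro form_eq) auto
  moreover have "form c d = (\<Sum>a\<in>?S. \<Sum>b\<in>?T. c a * cnj (d b) * k a b)"
    using fin by (intro form_eq) auto
  moreover have "form c' d = (\<Sum>a\<in>?S. \<Sum>b\<in>?T. c' a * cnj (d b) * k a b)"
    using fin by (intro form_eq) auto
  ultimately show ?thesis by (simp add: distrib_right sum.distrib)
qed

lemma form_scale_left:
  assumes "c \<in> finsupp" "d \<in> finsupp"
  shows "form (\<lambda>a. r * c a) d = r * form c d"
proof -
  let ?S = "{a. c a \<noteq> 0}" and ?T = "{a. d a \<noteq> 0}"
  have "form (\<lambda>a. r * c a) d = (\<Sum>a\<in>?S. \<Sum>b\<in>?T. (r * c a) * cnj (d b) * k a b)"
    using assms by (intro form_eq) (auto simp: finsupp_def)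
  then show ?thesis by (simp add: form_def sum_distrib_left mult.assoc)
qed

lemma form_commute:
  assumes "c \<in> finsupp" "d \<in> finsupp"
  shows "form d c = cnj (form c d)"
proof -
  have "form d c = (\<Sum>a | d a \<noteq> 0. \<Sum>b | c b \<noteq> 0. cnj (c b * cnj (d a) * k b a))"
    unfolding form_def
  proof (intro sum.cong refl)
    fix a b assume "a \<in> {a. d a \<noteq> 0}" "b \<in> {b. c b \<noteq> 0}"
    then have "a \<in> X" "b \<in> X" using assms by (auto simp: finsupp_def)
    then show "d a * cnj (c b) * k a b = cnj (c b * cnj (d a) * k b a)"
      using hermitian[of b a] by simp
  qed
  also have "\<dots> = cnj (form c d)" unfolding form_def cnj_sum by (rule sum.swap)
  finally show ?thesis .
qed

lemma form_add_right:
  assumes "c \<in> finsupp" "d \<in> finsupp" "d' \<in> finsupp"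
  shows "form c (\<lambda>a. d a + d' a) = form c d + form c d'"
  using assms form_add_left[of d d' c] form_commute[of "\<lambda>a. d a + d' a" c] form_commute[of d c]
    form_commute[of d' c] finsupp_add[of d d'] by simp

lemma form_scale_right:
  assumes "c \<in> finsupp" "d \<in> finsupp"
  shows "form c (\<lambda>a. r * d a) = cnj r * form c d"
  using assms form_scale_left[of d c r] form_commute[of "\<lambda>a. r * d a" c] form_commute[of d c]
    finsupp_scale[of d] by simp

lemma form_diff_left:
  assumes "c \<in> finsupp" "c' \<in> finsupp" "d \<in> finsupp"
  shows "form (\<lambda>a. c a - c' a) d = form c d - form c' d"
  using form_add_left[OF assms(1) finsupp_scale[OF assms(2), of "-1"] assms(3)]
    form_scale_left[OF assms(2,3), of "-1"] by simp

lemma form_diff_right: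
  assumes "c \<in> finsupp" "d \<in> finsupp" "d' \<in> finsupp"
  shows "form c (\<lambda>a. d a - d' a) = form c d - form c d'"
  using form_add_right[OF assms(1,2) finsupp_scale[OF assms(3), of "-1"]]
    form_scale_right[OF assms(1,3), of "-1"] by simp

lemma form_nonneg: "c \<in> finsupp \<Longrightarrow> 0 \<le> Re (form c c)"
  unfolding form_def by (rule positive) (auto simp: finsupp_def)

lemma form_self: "c \<in> finsupp \<Longrightarrow> form c c = of_real (Re (form c c))"
  using form_commute[of c c] by (simp add: complex_eq_iff)

lemma snorm_nonneg: "c \<in> finsupp \<Longrightarrow> 0 \<le> snorm c"
  by (simp add: snorm_def form_nonneg)

lemma snorm_square: "c \<in> finsupp \<Longrightarrow> (snorm c)\<^sup>2 = Re (form c c)"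
  by (simp add: snorm_def form_nonneg)

text \<open>
  The form may be degenerate, so the usual coefficient \<open>- form c d / form d d\<close> is perturbed by \<open>e\<close>.
\<close>

lemma form_Cauchy_Schwarz:
  assumes c: "c \<in> finsupp" and d: "d \<in> finsupp"
  shows "cmod (form c d) \<le> snorm c * snorm d"
proof -
  define b where "b = form c d"
  have dc: "form d c = cnj b" using form_commute[OF c d] by (simp add: b_def)
  have "(cmod b)\<^sup>2 \<le> Re (form c c) * (Re (form d d) + e)" if e: "0 < e" for e
  proof -
    define a where "a = Re (form d d) + e"
    define r where "r = - b / of_real a"
    have a: "0 < a" "Re (form d d) \<le> a" using form_nonneg[OF d] e by (auto simp: a_def)
    have "0 \<le> Re (form (\<lambda>x. c x + r * d x) (\<lambda>x. c x + r * d x))"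
      using c d by (intro form_nonneg finsupp_add finsupp_scale)
    also have "form (\<lambda>x. c x + r * d x) (\<lambda>x. c x + r * d x)
        = form c c + cnj r * b + r * cnj b + r * cnj r * form d d"
      using c d by (simp add: form_add_left form_add_right form_scale_left form_scale_right
        finsupp_add finsupp_scale dc b_def[symmetric] algebra_simps)
    also have "cnj r * b = of_real (- (cmod b)\<^sup>2 / a)"
      using complex_norm_square[of b] by (simp add: r_def mult.commute)
    also have "r * cnj b = of_real (- (cmod b)\<^sup>2 / a)"
      using complex_norm_square[of b] by (simp add: r_def)
    also have "r * cnj r * form d d = of_real ((cmod b)\<^sup>2 / a * (Re (form d d) / a))"
      using complex_norm_square[of b] form_self[OF d]
      by (simp add: r_def)
    finally have "0 \<le> Re (form c c) - 2 * ((cmod b)\<^sup>2 / a) + (cmod b)\<^sup>2 / a * (Re (form d d) / a)"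
      by simp
    moreover have "(cmod b)\<^sup>2 / a * (Re (form d d) / a) \<le> (cmod b)\<^sup>2 / a * 1"
      using a by (intro mult_left_mono) auto
    ultimately have "(cmod b)\<^sup>2 / a \<le> Re (form c c)" by linarith
    then show ?thesis using a unfolding a_def[symmetric] by (simp add: field_simps)
  qed
  then have "\<forall>\<^sub>F e in at_right 0. (cmod b)\<^sup>2 \<le> Re (form c c) * (Re (form d d) + e)"
    unfolding eventually_at_right[OF zero_less_one] by (intro exI[of _ 1]) auto
  moreover have lim: "((\<lambda>e. Re (form c c) * (Re (form d d) + e)) \<longlongrightarrow> Re (form c c) * (Re (form d d) + 0))
      (at_right 0)"
    by (intro tendsto_intros)
  ultimately have "(cmod b)\<^sup>2 \<le> Re (form c c) * (Re (form d d) + 0)"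
    by (intro tendsto_lowerbound[OF lim]) auto
  then show ?thesis unfolding b_def[symmetric] snorm_def real_sqrt_mult[symmetric]
    by (intro real_le_rsqrt) simp
qed

lemma snorm_triangle:
  assumes c: "c \<in> finsupp" and d: "d \<in> finsupp"
  shows "snorm (\<lambda>a. c a + d a) \<le> snorm c + snorm d"
proof -
  have "Re (form (\<lambda>a. c a + d a) (\<lambda>a. c a + d a)) = (snorm c)\<^sup>2 + 2 * Re (form c d) + (snorm d)\<^sup>2"
    using c d form_commute[OF c d]
    by (simp add: form_add_left form_add_right finsupp_add snorm_square)
  also have "\<dots> \<le> (snorm c)\<^sup>2 + 2 * (snorm c * snorm d) + (snorm d)\<^sup>2"
    using form_Cauchy_Schwarz[OF c d] complex_Re_le_cmod[of "form c d"] by simp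
  also have "\<dots> = (snorm c + snorm d)\<^sup>2" by (simp add: power2_sum)
  finally show ?thesis
    unfolding snorm_def[of "\<lambda>a. c a + d a"] using snorm_nonneg c d by (intro real_le_lsqrt) auto
qed

lemma snorm_scale: "c \<in> finsupp \<Longrightarrow> snorm (\<lambda>a. r * c a) = cmod r * snorm c"
proof -
  assume c: "c \<in> finsupp"
  have "form (\<lambda>a. r * c a) (\<lambda>a. r * c a) = of_real ((cmod r)\<^sup>2) * form c c"
    using c complex_norm_square[of r] by (simp add: form_scale_left form_scale_right finsupp_scale)
  then show ?thesis by (simp add: snorm_def real_sqrt_mult)
qed

lemma snorm_diff_commute:
  assumes "c \<in> finsupp" "d \<in> finsupp"
  shows "snorm (\<lambda>a. c a - d a) = snorm (\<lambda>a. d a - c a)"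
  using snorm_scale[OF finsupp_diff[OF assms], of "-1"] by simp

lemma snorm_diff_triangle:
  assumes "c \<in> finsupp" "d \<in> finsupp" "e \<in> finsupp"
  shows "snorm (\<lambda>a. c a - e a) \<le> snorm (\<lambda>a. c a - d a) + snorm (\<lambda>a. d a - e a)"
  using snorm_triangle[OF finsupp_diff[OF assms(1,2)] finsupp_diff[OF assms(2,3)]] by simp

lemma snorm_diff_le:
  assumes "c \<in> finsupp" "d \<in> finsupp"
  shows "\<bar>snorm c - snorm d\<bar> \<le> snorm (\<lambda>a. c a - d a)"
  using snorm_triangle[OF finsupp_diff[OF assms] assms(2)]
    snorm_triangle[OF finsupp_diff[OF assms(2,1)] assms(1)] snorm_diff_commute[OF assms] by simp

text \<open>Pairing with a fixed finitely supported \<open>d\<close> involves only finitely many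
  values of \<open>kernel_sum c\<close>, so pointwise convergence controls such pairings.\<close>

lemma form_kernel_sum:
  assumes "c \<in> finsupp" "d \<in> finsupp"
  shows "form c d = (\<Sum>b | d b \<noteq> 0. cnj (d b) * kernel_sum c b)"
proof -
  have "form c d = (\<Sum>b | d b \<noteq> 0. \<Sum>a | c a \<noteq> 0. c a * cnj (d b) * k a b)"
    unfolding form_def by (rule sum.swap)
  also have "\<dots> = (\<Sum>b | d b \<noteq> 0. cnj (d b) * kernel_sum c b)"
    using assms by (intro sum.cong refl) (auto simp: kernel_sum_def finsupp_def sum_distrib_left ac_simps)
  finally show ?thesis .
qed

lemma form_point: "\<lbrakk>c \<in> finsupp; b \<in> X\<rbrakk> \<Longrightarrow> form c (point b) = kernel_sum c b"
  by (simp add: form_kernel_sum finsupp_point) (simp add: point_def)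

lemma kernel_sum_add:
  assumes "c \<in> finsupp" "d \<in> finsupp"
  shows "kernel_sum (\<lambda>a. c a + d a) b = kernel_sum c b + kernel_sum d b"
proof (cases "b \<in> X")
  case True
  then show ?thesis using assms
    by (simp add: form_point[symmetric] finsupp_add form_add_left finsupp_point)
qed (simp add: kernel_sum_def)

lemma kernel_sum_scale:
  assumes "c \<in> finsupp"
  shows "kernel_sum (\<lambda>a. r * c a) b = r * kernel_sum c b"
proof (cases "b \<in> X")
  case True
  then show ?thesis using assms
    by (simp add: form_point[symmetric] finsupp_scale form_scale_left finsupp_point)
qed (simp add: kernel_sum_def)

lemma kernel_sum_diff:
  assumes "c \<in> finsupp" "d \<in> finsupp"
  shows "kernel_sum (\<lambda>a. c a - d a) b = kernel_sum c b - kernel_sum d b"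
  using kernel_sum_add[OF assms(1) finsupp_scale[OF assms(2), of "-1"], of b] kernel_sum_scale[OF assms(2), of "-1" b]
  by simp

text \<open>Evaluation at a point is bounded for the seminorm, so Cauchy sequences converge
  pointwise.\<close>

lemma kernel_sum_bound:
  assumes "c \<in> finsupp" "b \<in> X"
  shows "cmod (kernel_sum c b) \<le> snorm c * snorm (point b)"
  using form_Cauchy_Schwarz[OF assms(1) finsupp_point[OF assms(2)]] by (simp add: form_point assms)

text \<open>
  The completion needs no quotient: a Cauchy sequence \<open>s\<close> for the seminorm is represented by the pointwise
  limit of the functions \<open>kernel_sum (s n)\<close>, which determines it up to null sequences, see
  \<open>represents_zero_tendsto\<close>.
\<close>

definition cauchy :: "(nat \<Rightarrow> 'a \<Rightarrow> complex) \<Rightarrow> bool"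
  where "cauchy s \<longleftrightarrow> (\<forall>n. s n \<in> finsupp) \<and>
    (\<forall>e>0. \<exists>N. \<forall>m\<ge>N. \<forall>n\<ge>N. snorm (\<lambda>a. s m a - s n a) < e)"

definition represents :: "(nat \<Rightarrow> 'a \<Rightarrow> complex) \<Rightarrow> ('a \<Rightarrow> complex) \<Rightarrow> bool"
  where "represents s f \<longleftrightarrow> cauchy s \<and> (\<forall>b. (\<lambda>n. kernel_sum (s n) b) \<longlonglongrightarrow> f b)"

lemma cauchy_finsupp: "cauchy s \<Longrightarrow> s n \<in> finsupp"
  by (simp add: cauchy_def)

lemma cauchy_bounded:
  assumes s: "cauchy s"
  obtains M where "0 < M" "\<And>n. snorm (s n) \<le> M"
proof -
  have "Cauchy (\<lambda>n. snorm (s n))"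
    unfolding Cauchy_def dist_real_def
  proof (intro allI impI)
    fix e :: real assume "0 < e"
    then obtain N where "\<forall>m\<ge>N. \<forall>n\<ge>N. snorm (\<lambda>a. s m a - s n a) < e"
      using s unfolding cauchy_def by blast
    then show "\<exists>N. \<forall>m\<ge>N. \<forall>n\<ge>N. \<bar>snorm (s m) - snorm (s n)\<bar> < e"
      using snorm_diff_le[OF cauchy_finsupp cauchy_finsupp, OF s s] by (meson le_less_trans)
  qed
  then have "Bseq (\<lambda>n. snorm (s n))" by (rule Cauchy_Bseq)
  then obtain M where "0 < M" "\<And>n. norm (snorm (s n)) \<le> M" by (auto elim: BseqE)
  then show thesis using that[of M] by (auto simp: abs_le_iff)
qed

lemma cauchy_form_convergent:
  assumes s: "cauchy s" and t: "cauchy t"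
  shows "convergent (\<lambda>n. form (s n) (t n))"
proof -
  obtain M where M: "0 < M" "\<And>n. snorm (s n) \<le> M" using cauchy_bounded[OF s] by blast
  obtain M' where M': "0 < M'" "\<And>n. snorm (t n) \<le> M'" using cauchy_bounded[OF t] by blast
  note V = cauchy_finsupp[OF s] cauchy_finsupp[OF t]
  have "Cauchy (\<lambda>n. form (s n) (t n))"
    unfolding Cauchy_def dist_norm
  proof (intro allI impI)
    fix e :: real assume e: "0 < e"
    obtain N where N: "\<And>m n. \<lbrakk>m \<ge> N; n \<ge> N\<rbrakk> \<Longrightarrow> snorm (\<lambda>a. s m a - s n a) < e / (2 * M')"
      using s e M' unfolding cauchy_def by (metis divide_pos_pos mult_pos_pos zero_less_numeral)
    obtain N' where N': "\<And>m n. \<lbrakk>m \<ge> N'; n \<ge> N'\<rbrakk> \<Longrightarrow> snorm (\<lambda>a. t m a - t n a) < e / (2 * M)"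
      using t e M unfolding cauchy_def by (metis divide_pos_pos mult_pos_pos zero_less_numeral)
    have "norm (form (s m) (t m) - form (s n) (t n)) < e" if "m \<ge> max N N'" "n \<ge> max N N'" for m n
    proof -
      have "form (s m) (t m) - form (s n) (t n)
          = form (\<lambda>a. s m a - s n a) (t m) + form (s n) (\<lambda>a. t m a - t n a)"
        by (simp add: form_diff_left form_diff_right V)
      also have "norm \<dots> \<le> snorm (\<lambda>a. s m a - s n a) * snorm (t m) + snorm (s n) * snorm (\<lambda>a. t m a - t n a)"
        by (intro order_trans[OF norm_triangle_ineq] add_mono form_Cauchy_Schwarz finsupp_diff V)
      also have "\<dots> \<le> snorm (\<lambda>a. s m a - s n a) * M' + M * snorm (\<lambda>a. t m a - t n a)"
        by (intro add_mono mult_left_mono mult_right_mono M M' snorm_nonneg finsupp_diff V)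
      also have "\<dots> < e / (2 * M') * M' + M * (e / (2 * M))"
        using that by (intro add_strict_mono mult_strict_left_mono mult_strict_right_mono N N' M M') auto
      also have "\<dots> = e" using M M' by simp
      finally show ?thesis .
    qed
    then show "\<exists>N. \<forall>m\<ge>N. \<forall>n\<ge>N. norm (form (s m) (t m) - form (s n) (t n)) < e" by blast
  qed
  then show ?thesis by (rule Cauchy_convergent)
qed

lemma cauchy_add:
  assumes s: "cauchy s" and t: "cauchy t"
  shows "cauchy (\<lambda>n a. s n a + t n a)"
  unfolding cauchy_def
proof (intro conjI allI impI)
  note V = cauchy_finsupp[OF s] cauchy_finsupp[OF t]
  show "(\<lambda>a. s n a + t n a) \<in> finsupp" for n by (intro finsupp_add V)
  fix e :: real assume "0 < e"
  then have "0 < e / 2" by simp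
  then obtain N N' where N: "\<And>m n. \<lbrakk>m \<ge> N; n \<ge> N\<rbrakk> \<Longrightarrow> snorm (\<lambda>a. s m a - s n a) < e / 2"
    and N': "\<And>m n. \<lbrakk>m \<ge> N'; n \<ge> N'\<rbrakk> \<Longrightarrow> snorm (\<lambda>a. t m a - t n a) < e / 2"
    using s t unfolding cauchy_def by meson
  have "snorm (\<lambda>a. s m a + t m a - (s n a + t n a)) < e" if "m \<ge> max N N'" "n \<ge> max N N'" for m n
  proof -
    have "snorm (\<lambda>a. (s m a - s n a) + (t m a - t n a))
        \<le> snorm (\<lambda>a. s m a - s n a) + snorm (\<lambda>a. t m a - t n a)"
      by (intro snorm_triangle finsupp_diff V)
    also have "\<dots> < e / 2 + e / 2" using that by (intro add_strict_mono N N') auto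
    finally show ?thesis by (simp add: algebra_simps)
  qed
  then show "\<exists>N. \<forall>m\<ge>N. \<forall>n\<ge>N. snorm (\<lambda>a. s m a + t m a - (s n a + t n a)) < e" by blast
qed

lemma cauchy_scale:
  assumes s: "cauchy s"
  shows "cauchy (\<lambda>n a. r * s n a)"
  unfolding cauchy_def
proof (intro conjI allI impI)
  note V = cauchy_finsupp[OF s]
  show "(\<lambda>a. r * s n a) \<in> finsupp" for n by (intro finsupp_scale V)
  fix e :: real assume "0 < e"
  then have e: "0 < e / (cmod r + 1)" by (intro divide_pos_pos) (auto intro: add_nonneg_pos)
  then obtain N where N: "\<And>m n. \<lbrakk>m \<ge> N; n \<ge> N\<rbrakk> \<Longrightarrow> snorm (\<lambda>a. s m a - s n a) < e / (cmod r + 1)"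
    using s unfolding cauchy_def by meson
  have "snorm (\<lambda>a. r * s m a - r * s n a) < e" if "m \<ge> N" "n \<ge> N" for m n
  proof -
    have "snorm (\<lambda>a. r * (s m a - s n a)) = cmod r * snorm (\<lambda>a. s m a - s n a)"
      by (intro snorm_scale finsupp_diff V)
    also have "\<dots> \<le> (cmod r + 1) * snorm (\<lambda>a. s m a - s n a)"
      by (intro mult_right_mono snorm_nonneg finsupp_diff V) simp
    also have "\<dots> < (cmod r + 1) * (e / (cmod r + 1))"
      using N[OF that] by (intro mult_strict_left_mono) (auto intro: add_nonneg_pos)
    also have "\<dots> = e" by (simp add: add_nonneg_eq_0_iff)
    finally show ?thesis by (simp add: algebra_simps)
  qed
  then show "\<exists>N. \<forall>m\<ge>N. \<forall>n\<ge>N. snorm (\<lambda>a. r * s m a - r * s n a) < e" by blast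
qed

lemma represents_cauchy: "represents s f \<Longrightarrow> cauchy s"
  by (simp add: represents_def)

lemma represents_finsupp: "represents s f \<Longrightarrow> s n \<in> finsupp"
  by (simp add: represents_def cauchy_def)

lemma represents_add:
  assumes "represents s f" "represents t g"
  shows "represents (\<lambda>n a. s n a + t n a) (\<lambda>b. f b + g b)"
  using assms represents_finsupp[OF assms(1)] represents_finsupp[OF assms(2)]
  by (auto simp: represents_def kernel_sum_add cauchy_add intro!: tendsto_add)

lemma represents_scale:
  assumes "represents s f"
  shows "represents (\<lambda>n a. r * s n a) (\<lambda>b. r * f b)"
  using assms represents_finsupp[OF assms(1)]
  by (auto simp: represents_def kernel_sum_scale cauchy_scale intro!: tendsto_mult_left)

lemma represents_diff:
  assumes "represents s f" "represents t g"
  shows "represents (\<lambda>n a. s n a - t n a) (\<lambda>b. f b - g b)"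
  using represents_add[OF assms(1) represents_scale[OF assms(2), of "-1"]] by simp

lemma represents_const: "c \<in> finsupp \<Longrightarrow> represents (\<lambda>_. c) (kernel_sum c)"
  by (auto simp: represents_def cauchy_def snorm_def form_def)

text \<open>Compare \<open>s n\<close> with a fixed late \<open>s N\<close>. The pairing
  \<open>form (s n) (s N)\<close> is a finite combination of values of
  \<open>kernel_sum (s n)\<close>, which tend to 0; the pairing of \<open>s n\<close> with the
  difference of \<open>s n\<close> and \<open>s N\<close> is small by boundedness and the Cauchy
  property.\<close>

lemma represents_zero_tendsto:
  assumes s: "represents s (\<lambda>_. 0)"
  shows "(\<lambda>n. snorm (s n)) \<longlonglongrightarrow> 0"
proof -
  note V = represents_finsupp[OF s] and sc = represents_cauchy[OF s]
  obtain M where M: "0 < M" "\<And>n. snorm (s n) \<le> M" using cauchy_bounded[OF sc] by blast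
  have "(\<lambda>n. form (s n) (s n)) \<longlonglongrightarrow> 0"
  proof (rule tendstoI)
    fix e :: real assume e: "0 < e"
    then have "0 < e / (2 * M)" using M by simp
    then obtain N where N: "\<And>m n. \<lbrakk>m \<ge> N; n \<ge> N\<rbrakk> \<Longrightarrow> snorm (\<lambda>a. s m a - s n a) < e / (2 * M)"
      using sc unfolding cauchy_def by meson
    have "(\<lambda>n. \<Sum>b | s N b \<noteq> 0. cnj (s N b) * kernel_sum (s n) b) \<longlonglongrightarrow> (\<Sum>b | s N b \<noteq> 0. cnj (s N b) * 0)"
      using s by (intro tendsto_sum tendsto_mult_left) (auto simp: represents_def)
    then have "(\<lambda>n. form (s n) (s N)) \<longlonglongrightarrow> 0" by (simp add: form_kernel_sum V)
    then have "\<forall>\<^sub>F n in sequentially. norm (form (s n) (s N)) < e / 2"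
      using e by (intro order_tendstoD(2)[OF tendsto_norm_zero]) auto
    then show "\<forall>\<^sub>F n in sequentially. dist (form (s n) (s n)) 0 < e"
      using eventually_ge_at_top[of N]
    proof eventually_elim
      case (elim n)
      have "form (s n) (s n) = form (s n) (s N) + form (s n) (\<lambda>a. s n a - s N a)"
        by (simp add: form_diff_right V)
      then have "norm (form (s n) (s n)) \<le> norm (form (s n) (s N)) + snorm (s n) * snorm (\<lambda>a. s n a - s N a)"
        by (metis V finsupp_diff form_Cauchy_Schwarz add_left_mono norm_triangle_ineq order_trans)
      also have "snorm (s n) * snorm (\<lambda>a. s n a - s N a) \<le> M * snorm (\<lambda>a. s n a - s N a)"
        by (intro mult_right_mono M snorm_nonneg finsupp_diff V)
      also have "\<dots> < M * (e / (2 * M))" using elim by (intro mult_strict_left_mono N M) auto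
      also have "\<dots> = e / 2" using M by simp
      finally show ?case using elim by simp
    qed
  qed
  then have "(\<lambda>n. sqrt (Re (form (s n) (s n)))) \<longlonglongrightarrow> sqrt (Re 0)"
    by (intro tendsto_intros)
  then show ?thesis by (simp add: snorm_def)
qed

section \<open>The Hilbert space of functions represented by Cauchy sequences\<close>

definition rkhs_carrier :: "('a \<Rightarrow> complex) set"
  where "rkhs_carrier = {f. \<exists>s. represents s f}"

definition rkhs_inner :: "('a \<Rightarrow> complex) \<Rightarrow> ('a \<Rightarrow> complex) \<Rightarrow> complex"
  where "rkhs_inner f g = lim (\<lambda>n. form ((SOME s. represents s f) n) ((SOME s. represents s g) n))"

text \<open>Two sequences representing the same function differ by one that represents 0, hence by a
  seminorm-null one; so the sequences picked by \<open>SOME\<close> can be exchanged for any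
  others.\<close>

lemma represents_inner:
  assumes s: "represents s f" and t: "represents t g"
  shows "(\<lambda>n. form (s n) (t n)) \<longlonglongrightarrow> rkhs_inner f g"
proof -
  define s' t' where "s' = (SOME s. represents s f)" and "t' = (SOME t. represents t g)"
  have s': "represents s' f" and t': "represents t' g"
    unfolding s'_def t'_def using someI[of "\<lambda>s. represents s f", OF s]
      someI[of "\<lambda>t. represents t g", OF t] by auto
  note V = represents_finsupp[OF s] represents_finsupp[OF t]
    represents_finsupp[OF s'] represents_finsupp[OF t']
  have lim': "(\<lambda>n. form (s' n) (t' n)) \<longlonglongrightarrow> rkhs_inner f g"
    unfolding rkhs_inner_def s'_def[symmetric] t'_def[symmetric]
    using cauchy_form_convergent[OF represents_cauchy[OF s'] represents_cauchy[OF t']]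
    by (simp add: convergent_LIMSEQ_iff)
  obtain M where M: "0 < M" "\<And>n. snorm (t n) \<le> M"
    using cauchy_bounded[OF represents_cauchy[OF t]] by blast
  obtain M' where M': "0 < M'" "\<And>n. snorm (s' n) \<le> M'"
    using cauchy_bounded[OF represents_cauchy[OF s']] by blast
  have z: "(\<lambda>n. snorm (\<lambda>a. s n a - s' n a)) \<longlonglongrightarrow> 0" "(\<lambda>n. snorm (\<lambda>a. t n a - t' n a)) \<longlonglongrightarrow> 0"
    using represents_zero_tendsto represents_diff[OF s s'] represents_diff[OF t t'] by auto
  have bound: "norm (form (s n) (t n) - form (s' n) (t' n))
      \<le> snorm (\<lambda>a. s n a - s' n a) * M + M' * snorm (\<lambda>a. t n a - t' n a)" for n
  proof -
    have "form (s n) (t n) - form (s' n) (t' n)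
        = form (\<lambda>a. s n a - s' n a) (t n) + form (s' n) (\<lambda>a. t n a - t' n a)"
      by (simp add: form_diff_left form_diff_right V)
    also have "norm \<dots> \<le> snorm (\<lambda>a. s n a - s' n a) * snorm (t n) + snorm (s' n) * snorm (\<lambda>a. t n a - t' n a)"
      by (intro order_trans[OF norm_triangle_ineq] add_mono form_Cauchy_Schwarz finsupp_diff V)
    also have "\<dots> \<le> snorm (\<lambda>a. s n a - s' n a) * M + M' * snorm (\<lambda>a. t n a - t' n a)"
      by (intro add_mono mult_left_mono mult_right_mono M M' snorm_nonneg finsupp_diff V)
    finally show ?thesis .
  qed
  have "(\<lambda>n. snorm (\<lambda>a. s n a - s' n a) * M + M' * snorm (\<lambda>a. t n a - t' n a)) \<longlonglongrightarrow> 0 * M + M' * 0"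
    by (intro tendsto_intros z)
  then have "(\<lambda>n. snorm (\<lambda>a. s n a - s' n a) * M + M' * snorm (\<lambda>a. t n a - t' n a)) \<longlonglongrightarrow> 0" by simp
  then have "(\<lambda>n. form (s n) (t n) - form (s' n) (t' n)) \<longlonglongrightarrow> 0"
    by (rule Lim_null_comparison[rotated]) (simp add: bound)
  then show ?thesis using Lim_transform2 lim' by (metis Lim_transform)
qed

definition rkhs :: "('a \<Rightarrow> complex) hilbert"
  where "rkhs = \<lparr>carrier = rkhs_carrier, mult = undefined, one = undefined, zero = (\<lambda>_. 0),
    add = (\<lambda>f g b. f b + g b), smult = (\<lambda>r f b. r * f b), hinner = rkhs_inner\<rparr>"

lemma rkhs_simps [simp]:
  "carrier rkhs = rkhs_carrier" "\<zero>\<^bsub>rkhs\<^esub> = (\<lambda>_. 0)" "f \<oplus>\<^bsub>rkhs\<^esub> g = (\<lambda>b. f b + g b)"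
  "r \<odot>\<^bsub>rkhs\<^esub> f = (\<lambda>b. r * f b)" "hinner rkhs = rkhs_inner"
  by (simp_all add: rkhs_def)

lemma rkhs_carrier_zero: "(\<lambda>_. 0) \<in> rkhs_carrier"
proof -
  have "kernel_sum (\<lambda>a. 0) = (\<lambda>_. 0)" by (auto simp: kernel_sum_def)
  then show ?thesis using represents_const[OF finsupp_zero] by (auto simp: rkhs_carrier_def)
qed

lemma rkhs_carrier_add: "\<lbrakk>f \<in> rkhs_carrier; g \<in> rkhs_carrier\<rbrakk> \<Longrightarrow> (\<lambda>b. f b + g b) \<in> rkhs_carrier"
  by (auto simp: rkhs_carrier_def intro: represents_add)

lemma rkhs_carrier_scale: "f \<in> rkhs_carrier \<Longrightarrow> (\<lambda>b. r * f b) \<in> rkhs_carrier"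
  using represents_scale by (auto simp: rkhs_carrier_def)

lemma kernel_sum_rkhs_carrier: "c \<in> finsupp \<Longrightarrow> kernel_sum c \<in> rkhs_carrier"
  using represents_const by (auto simp: rkhs_carrier_def)

lemma abelian_group_rkhs: "abelian_group rkhs"
proof (rule abelian_groupI)
  fix f assume "f \<in> carrier rkhs"
  then show "\<exists>g\<in>carrier rkhs. g \<oplus>\<^bsub>rkhs\<^esub> f = \<zero>\<^bsub>rkhs\<^esub>"
    using rkhs_carrier_scale[of f "-1"] by (intro bexI[of _ "\<lambda>b. -1 * f b"]) auto
qed (auto simp: rkhs_carrier_zero rkhs_carrier_add algebra_simps)

lemma module_rkhs: "module complex_ring rkhs"
  by (rule moduleI[OF cring_complex_ring abelian_group_rkhs])
    (auto simp: rkhs_carrier_scale complex_ring_def algebra_simps)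

lemma rkhs_minus:
  assumes "f \<in> rkhs_carrier" "g \<in> rkhs_carrier"
  shows "f \<ominus>\<^bsub>rkhs\<^esub> g = (\<lambda>b. f b - g b)"
proof -
  interpret abelian_group rkhs by (rule abelian_group_rkhs)
  have "\<ominus>\<^bsub>rkhs\<^esub> g = (\<lambda>b. - g b)"
    using assms rkhs_carrier_scale[of g "-1"] by (intro minus_equality) auto
  then show ?thesis by (simp add: a_minus_def)
qed

lemma rkhs_reproducing:
  assumes f: "f \<in> rkhs_carrier" and b: "b \<in> X"
  shows "rkhs_inner f (kernel_sum (point b)) = f b"
proof -
  obtain s where s: "represents s f" using f by (auto simp: rkhs_carrier_def)
  have "(\<lambda>n. form (s n) (point b)) \<longlonglongrightarrow> rkhs_inner f (kernel_sum (point b))"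
    by (rule represents_inner[OF s represents_const[OF finsupp_point[OF b]]])
  then have "(\<lambda>n. kernel_sum (s n) b) \<longlonglongrightarrow> rkhs_inner f (kernel_sum (point b))"
    using b by (simp add: form_point represents_finsupp[OF s])
  then show ?thesis using s LIMSEQ_unique unfolding represents_def by blast
qed

lemma rkhs_vanish:
  assumes "f \<in> rkhs_carrier" "b \<notin> X"
  shows "f b = 0"
proof -
  obtain s where "represents s f" using assms by (auto simp: rkhs_carrier_def)
  then have "(\<lambda>n. kernel_sum (s n) b) \<longlonglongrightarrow> f b" by (simp add: represents_def)
  then show ?thesis using assms(2) LIMSEQ_unique[of "\<lambda>_. 0" 0 "f b"] by (simp add: kernel_sum_def)
qed

text \<open>Symmetry and the triangle inequality of the seminorm pass to this limit, so completeness
  can be proved before the Hilbert space axioms are assembled.\<close>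

lemma represents_hdist:
  assumes s: "represents s f" and t: "represents t g"
  shows "(\<lambda>n. snorm (\<lambda>a. s n a - t n a)) \<longlonglongrightarrow> hdist rkhs f g"
proof -
  have "f \<in> rkhs_carrier" "g \<in> rkhs_carrier" using s t by (auto simp: rkhs_carrier_def)
  then have "hdist rkhs f g = sqrt (Re (rkhs_inner (\<lambda>b. f b - g b) (\<lambda>b. f b - g b)))"
    by (simp add: hdist_def rkhs_minus)
  then show ?thesis
    unfolding snorm_def using represents_inner[OF represents_diff[OF s t] represents_diff[OF s t]]
    by (auto intro!: tendsto_intros)
qed

lemma hdist_triangle:
  assumes "f \<in> rkhs_carrier" "g \<in> rkhs_carrier" "h \<in> rkhs_carrier"
  shows "hdist rkhs f h \<le> hdist rkhs f g + hdist rkhs g h"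
proof -
  obtain s t u where r: "represents s f" "represents t g" "represents u h"
    using assms by (auto simp: rkhs_carrier_def)
  show ?thesis
    by (rule LIMSEQ_le[OF represents_hdist[OF r(1,3)]
          tendsto_add[OF represents_hdist[OF r(1,2)] represents_hdist[OF r(2,3)]]])
      (auto intro: snorm_diff_triangle represents_finsupp[OF r(1)] represents_finsupp[OF r(2)]
        represents_finsupp[OF r(3)])
qed

lemma hdist_commute:
  assumes "f \<in> rkhs_carrier" "g \<in> rkhs_carrier"
  shows "hdist rkhs f g = hdist rkhs g f"
proof -
  obtain s t where r: "represents s f" "represents t g"
    using assms by (auto simp: rkhs_carrier_def)
  have "(\<lambda>n. snorm (\<lambda>a. s n a - t n a)) = (\<lambda>n. snorm (\<lambda>a. t n a - s n a))"
    using snorm_diff_commute[OF represents_finsupp[OF r(1)] represents_finsupp[OF r(2)]] by blast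
  then show ?thesis
    using LIMSEQ_unique[OF represents_hdist[OF r]] represents_hdist[OF r(2,1)] by metis
qed

lemma hdist_kernel_sum:
  assumes "c \<in> finsupp" "d \<in> finsupp"
  shows "hdist rkhs (kernel_sum c) (kernel_sum d) = snorm (\<lambda>a. c a - d a)"
  using LIMSEQ_unique[OF represents_hdist[OF represents_const represents_const, OF assms] tendsto_const]
  by simp

lemma represents_tendsto:
  assumes s: "represents s f"
  shows "(\<lambda>n. hdist rkhs (kernel_sum (s n)) f) \<longlonglongrightarrow> 0"
proof (rule LIMSEQ_I)
  note V = represents_finsupp[OF s]
  fix e :: real assume e: "0 < e"
  then have "0 < e / 2" by simp
  then obtain N where N: "\<And>m n. \<lbrakk>m \<ge> N; n \<ge> N\<rbrakk> \<Longrightarrow> snorm (\<lambda>a. s m a - s n a) < e / 2"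
    using represents_cauchy[OF s] unfolding cauchy_def by meson
  have "norm (hdist rkhs (kernel_sum (s n)) f - 0) < e" if n: "N \<le> n" for n
  proof -
    note lim = represents_hdist[OF represents_const[OF V] s, of n]
    have "hdist rkhs (kernel_sum (s n)) f \<le> e / 2"
      using N n by (intro LIMSEQ_le_const2[OF lim]) (auto intro!: exI[of _ N] less_imp_le)
    moreover have "0 \<le> hdist rkhs (kernel_sum (s n)) f"
      by (intro LIMSEQ_le_const[OF lim]) (auto intro!: snorm_nonneg finsupp_diff V)
    ultimately show ?thesis using e by simp
  qed
  then show "\<exists>N. \<forall>n\<ge>N. norm (hdist rkhs (kernel_sum (s n)) f - 0) < e" by blast
qed

text \<open>Each \<open>F n\<close> is replaced by the image of a finitely supported
  \<open>c n\<close> at distance below \<open>1 / (n + 1)\<close>. The sequence \<open>c\<close> is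
  then Cauchy for the seminorm, and its pointwise limit lies in the space by the definition of
  \<open>represents\<close>.\<close>

lemma rkhs_complete:
  assumes F: "\<And>n. F n \<in> rkhs_carrier"
    and cau: "\<And>e. 0 < e \<Longrightarrow> \<exists>N::nat. \<forall>m\<ge>N. \<forall>n\<ge>N. hdist rkhs (F m) (F n) < e"
  shows "\<exists>f\<in>rkhs_carrier. (\<lambda>n. hdist rkhs (F n) f) \<longlonglongrightarrow> 0"
proof -
  have "\<exists>c. c \<in> finsupp \<and> hdist rkhs (kernel_sum c) (F n) < inverse (Suc n)" for n
  proof -
    obtain s where s: "represents s (F n)" using F[of n] by (auto simp: rkhs_carrier_def)
    have "\<forall>\<^sub>F m in sequentially. hdist rkhs (kernel_sum (s m)) (F n) < inverse (Suc n)"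
      using represents_tendsto[OF s] by (intro order_tendstoD(2)[where y=0]) auto
    then show ?thesis using represents_finsupp[OF s] by (auto simp: eventually_sequentially)
  qed
  then obtain c where c: "\<And>n. c n \<in> finsupp" "\<And>n. hdist rkhs (kernel_sum (c n)) (F n) < inverse (Suc n)"
    by metis
  have cc: "cauchy c"
    unfolding cauchy_def
  proof (intro conjI allI impI)
    show "c n \<in> finsupp" for n by (rule c)
    fix e :: real assume "0 < e"
    then have e: "0 < e / 3" by simp
    obtain N where N: "\<And>m n. \<lbrakk>m \<ge> N; n \<ge> N\<rbrakk> \<Longrightarrow> hdist rkhs (F m) (F n) < e / 3"
      using cau[OF e] by blast
    obtain N' where N': "inverse (Suc N') < e / 3" using reals_Archimedean[OF e] by blast
    have "snorm (\<lambda>a. c m a - c n a) < e" if "m \<ge> max N N'" "n \<ge> max N N'" for m n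
    proof -
      have "inverse (real (Suc i)) < e / 3" if "i \<ge> N'" for i
        using N' that by (meson inverse_Suc le_imp_inverse_le le_less_trans of_nat_0_less_iff of_nat_mono
            Suc_le_mono zero_less_Suc)
      then have small: "hdist rkhs (kernel_sum (c m)) (F m) < e / 3" "hdist rkhs (F n) (kernel_sum (c n)) < e / 3"
        using that c(2)[of m] c(2)[of n] hdist_commute[OF F kernel_sum_rkhs_carrier[OF c(1)], of n n]
        by (force intro: less_trans)+
      have "snorm (\<lambda>a. c m a - c n a) = hdist rkhs (kernel_sum (c m)) (kernel_sum (c n))"
        by (simp add: hdist_kernel_sum c)
      also have "\<dots> \<le> hdist rkhs (kernel_sum (c m)) (F m) + hdist rkhs (F m) (kernel_sum (c n))"
        by (intro hdist_triangle kernel_sum_rkhs_carrier c F)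
      also have "hdist rkhs (F m) (kernel_sum (c n)) \<le> hdist rkhs (F m) (F n) + hdist rkhs (F n) (kernel_sum (c n))"
        by (intro hdist_triangle kernel_sum_rkhs_carrier c F)
      finally show ?thesis using small N[of m n] that by simp
    qed
    then show "\<exists>N. \<forall>m\<ge>N. \<forall>n\<ge>N. snorm (\<lambda>a. c m a - c n a) < e" by blast
  qed
  have "convergent (\<lambda>n. kernel_sum (c n) b)" for b
  proof (cases "b \<in> X")
    case True
    have "Cauchy (\<lambda>n. kernel_sum (c n) b)"
      unfolding Cauchy_def dist_norm
    proof (intro allI impI)
      fix e :: real assume "0 < e"
      then have "0 < e / (snorm (point b) + 1)"
        using snorm_nonneg[OF finsupp_point[OF True]] by simp
      then obtain N where N: "\<And>m n. \<lbrakk>m \<ge> N; n \<ge> N\<rbrakk> \<Longrightarrow> snorm (\<lambda>a. c m a - c n a) < e / (snorm (point b) + 1)"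
        using cc unfolding cauchy_def by meson
      have "norm (kernel_sum (c m) b - kernel_sum (c n) b) < e" if "m \<ge> N" "n \<ge> N" for m n
      proof -
        have p: "0 < snorm (point b) + 1" using snorm_nonneg[OF finsupp_point[OF True]] by simp
        have "norm (kernel_sum (c m) b - kernel_sum (c n) b) \<le> snorm (\<lambda>a. c m a - c n a) * snorm (point b)"
          using kernel_sum_bound[OF finsupp_diff[OF c(1) c(1)] True] by (simp add: kernel_sum_diff c)
        also have "\<dots> \<le> snorm (\<lambda>a. c m a - c n a) * (snorm (point b) + 1)"
          by (intro mult_left_mono snorm_nonneg finsupp_diff c) simp
        also have "\<dots> < e / (snorm (point b) + 1) * (snorm (point b) + 1)"
          by (intro mult_strict_right_mono N that p)
        also have "\<dots> = e" using p by simp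
        finally show ?thesis .
      qed
      then show "\<exists>N. \<forall>m\<ge>N. \<forall>n\<ge>N. norm (kernel_sum (c m) b - kernel_sum (c n) b) < e" by blast
    qed
    then show ?thesis by (rule Cauchy_convergent)
  qed (simp add: kernel_sum_def convergent_const)
  then have rep: "represents c (\<lambda>b. lim (\<lambda>n. kernel_sum (c n) b))"
    using cc by (simp add: represents_def convergent_LIMSEQ_iff)
  define f where "f = (\<lambda>b. lim (\<lambda>n. kernel_sum (c n) b))"
  have f: "f \<in> rkhs_carrier" using rep by (auto simp: rkhs_carrier_def f_def)
  have lim: "(\<lambda>n. inverse (Suc n) + hdist rkhs (kernel_sum (c n)) f) \<longlonglongrightarrow> 0"
    using tendsto_add[OF LIMSEQ_inverse_real_of_nat represents_tendsto[OF rep]] by (simp add: f_def)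
  have le: "hdist rkhs (F n) f \<le> inverse (Suc n) + hdist rkhs (kernel_sum (c n)) f" for n
    using hdist_triangle[OF F[of n] kernel_sum_rkhs_carrier[OF c(1)[of n]] f] c(2)[of n]
      hdist_commute[OF F[of n] kernel_sum_rkhs_carrier[OF c(1)[of n]]] by simp
  have nonneg: "0 \<le> hdist rkhs (F n) f" for n
  proof -
    obtain s where s: "represents s (F n)" using F[of n] by (auto simp: rkhs_carrier_def)
    have "0 \<le> hdist rkhs (F n) (F n)"
      by (rule LIMSEQ_le_const[OF represents_hdist[OF s s]])
        (auto intro: snorm_nonneg finsupp_zero)
    then show ?thesis
      using hdist_triangle[OF F[of n] f F[of n]] hdist_commute[OF F[of n] f] by simp
  qed
  have "(\<lambda>n. hdist rkhs (F n) f) \<longlonglongrightarrow> 0"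
    by (rule tendsto_sandwich[OF _ _ tendsto_const lim]) (use le nonneg in auto)
  then show ?thesis using f by blast
qed

lemma hilbert_space_rkhs: "hilbert_space rkhs"
proof (rule hilbert_space.intro[OF module_rkhs], unfold_locales)
  fix f g h :: "'a \<Rightarrow> complex" and r
  assume f: "f \<in> carrier rkhs"
  then obtain s where s: "represents s f" by (auto simp: rkhs_carrier_def)
  note V = represents_finsupp[OF s]
  have self: "rkhs_inner f f = of_real (Re (rkhs_inner f f)) \<and> 0 \<le> Re (rkhs_inner f f)"
  proof -
    note lim = represents_inner[OF s s]
    have "(\<lambda>n. Im (form (s n) (s n))) \<longlonglongrightarrow> Im (rkhs_inner f f)" by (intro tendsto_intros lim)
    moreover have "Im (form (s n) (s n)) = 0" for n using form_self[OF V, of n] by (simp add: complex_eq_iff)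
    ultimately have "Im (rkhs_inner f f) = 0" using LIMSEQ_unique[OF _ tendsto_const] by simp
    moreover have "0 \<le> Re (rkhs_inner f f)"
      by (rule LIMSEQ_le_const[OF tendsto_Re[OF lim]]) (auto intro: form_nonneg V)
    ultimately show ?thesis by (simp add: complex_eq_iff)
  qed
  then show "0 \<le> Re (hinner rkhs f f)" by simp
  show "f = \<zero>\<^bsub>rkhs\<^esub>" if z: "hinner rkhs f f = 0"
  proof
    fix b
    have "(\<lambda>n. sqrt (Re (form (s n) (s n)))) \<longlonglongrightarrow> sqrt (Re (rkhs_inner f f))"
      by (intro tendsto_intros represents_inner s)
    then have "(\<lambda>n. snorm (s n)) \<longlonglongrightarrow> 0" using z by (simp add: snorm_def)
    then have lim: "(\<lambda>n. snorm (s n) * snorm (point b)) \<longlonglongrightarrow> 0" by (rule tendsto_mult_left_zero)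
    have "(\<lambda>n. kernel_sum (s n) b) \<longlonglongrightarrow> 0"
    proof (cases "b \<in> X")
      case True
      then show ?thesis using kernel_sum_bound[OF V True]
        by (intro Lim_null_comparison[OF _ lim]) auto
    qed (simp add: kernel_sum_def)
    then have "f b = 0" using s LIMSEQ_unique unfolding represents_def by blast
    then show "f b = \<zero>\<^bsub>rkhs\<^esub> b" by simp
  qed
  assume g: "g \<in> carrier rkhs"
  then obtain t where t: "represents t g" by (auto simp: rkhs_carrier_def)
  show "hinner rkhs g f = cnj (hinner rkhs f g)"
  proof -
    have "(\<lambda>n. cnj (form (s n) (t n))) \<longlonglongrightarrow> cnj (rkhs_inner f g)"
      by (intro tendsto_cnj represents_inner s t)
    then have "(\<lambda>n. form (t n) (s n)) \<longlonglongrightarrow> cnj (rkhs_inner f g)"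
      using form_commute[OF V represents_finsupp[OF t]] by simp
    then show ?thesis using LIMSEQ_unique[OF represents_inner[OF t s]] by simp
  qed
  show "hinner rkhs (r \<odot>\<^bsub>rkhs\<^esub> f) g = r * hinner rkhs f g"
  proof -
    have "(\<lambda>n. r * form (s n) (t n)) \<longlonglongrightarrow> r * rkhs_inner f g"
      by (intro tendsto_intros represents_inner s t)
    then show ?thesis using LIMSEQ_unique[OF represents_inner[OF represents_scale[OF s] t]]
      by (simp add: form_scale_left V represents_finsupp[OF t])
  qed
  assume h: "h \<in> carrier rkhs"
  then obtain u where u: "represents u h" by (auto simp: rkhs_carrier_def)
  show "hinner rkhs (f \<oplus>\<^bsub>rkhs\<^esub> g) h = hinner rkhs f h + hinner rkhs g h"
  proof -
    have "(\<lambda>n. form (s n) (u n) + form (t n) (u n)) \<longlonglongrightarrow> rkhs_inner f h + rkhs_inner g h"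
      by (intro tendsto_intros represents_inner s t u)
    then show ?thesis using LIMSEQ_unique[OF represents_inner[OF represents_add[OF s t] u]]
      by (simp add: form_add_left V represents_finsupp[OF t] represents_finsupp[OF u])
  qed
qed (use rkhs_complete in auto)

end


section \<open>Orthogonal projection\<close>

context hilbert_space
begin

lemma inner_minus_right:
  "\<lbrakk>x \<in> carrier H; y \<in> carrier H; z \<in> carrier H\<rbrakk>
    \<Longrightarrow> hinner H x (y \<ominus> z) = hinner H x y - hinner H x z"
  by (metis M.minus_closed complex_cnj_diff inner_commute inner_minus_left)

text \<open>
  The limit of a minimizing sequence inherits orthogonality from an estimate for almost minimal
  vectors, so no triangle inequality is needed.
\<close>

lemma orthogonal_projection:
  assumes W: "closed_subspace W H" and x: "x \<in> carrier H"
  shows "\<exists>w\<in>W. \<forall>v\<in>W. hinner H x v = hinner H w v"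
proof -
  have sub: "submodule W complex_ring H" using W by (simp add: closed_subspace_def)
  note WE = submoduleE[OF sub]
  have Wc: "w \<in> carrier H" if "w \<in> W" for w using that WE(1) by blast
  have Wadd: "w \<oplus> v \<in> W" if "w \<in> W" "v \<in> W" for w v using that WE(5) by blast
  have Wscale: "c \<odot> w \<in> W" if "w \<in> W" for c w using that WE(4) by (simp add: complex_ring_def)
  note simps = inner_add_left inner_add_right inner_scale_left inner_scale_right inner_minus_left
    inner_minus_right scale_closed Wc x
  define N where "N y = Re (hinner H y y)" for y
  define d where "d = (INF w\<in>W. N (x \<ominus> w))"
  have ne: "W \<noteq> {}" using WE(2) .
  have d: "d \<le> N (x \<ominus> w)" if "w \<in> W" for w
    unfolding d_def using that
    by (intro cINF_lower bdd_belowI[of _ 0]) (auto simp: N_def x Wc intro!: inner_nonneg)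
  have "\<exists>w. w \<in> W \<and> N (x \<ominus> w) < d + inverse (Suc n)" for n
  proof -
    have "(INF w\<in>W. N (x \<ominus> w)) < d + inverse (Suc n)" by (simp add: d_def)
    then show ?thesis
      by (subst (asm) cINF_less_iff[OF ne])
        (auto simp: N_def x Wc intro!: bdd_belowI[of _ 0] inner_nonneg)
  qed
  then obtain w where w: "\<And>n. w n \<in> W" "\<And>n. N (x \<ominus> w n) < d + inverse (Suc n)" by metis
  note wc = Wc[OF w(1)]
  have "\<exists>K. \<forall>m\<ge>K. \<forall>n\<ge>K. hdist H (w m) (w n) < e" if e: "0 < e" for e
  proof -
    \<comment> \<open>Let both squared distances be below \<open>d + \<epsilon>\<close>. The
      midpoint of \<open>w m\<close> and \<open>w n\<close> lies in \<open>W\<close>, so the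
      parallelogram law bounds the squared distance of \<open>w m\<close> and \<open>w n\<close> by
      \<open>4 (d + \<epsilon>) - 4 d\<close>; hence the choice \<open>e\<^sup>2 / 4\<close> for
      \<open>\<epsilon>\<close>.\<close>
    have "0 < e\<^sup>2 / 4" using e by simp
    then obtain K where K: "inverse (real (Suc K)) < e\<^sup>2 / 4" using reals_Archimedean by blast
    have "hdist H (w m) (w n) < e" if "K \<le> m" "K \<le> n" for m n
    proof -
      have small: "inverse (real (Suc i)) < e\<^sup>2 / 4" if "K \<le> i" for i
        by (rule le_less_trans[OF le_imp_inverse_le K]) (use that in auto)
      have "N (w m \<ominus> w n) = 2 * N (x \<ominus> w m) + 2 * N (x \<ominus> w n) - 4 * N (x \<ominus> (1/2) \<odot> (w m \<oplus> w n))"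
        unfolding N_def by (simp add: simps w(1) algebra_simps)
      moreover have "d \<le> N (x \<ominus> (1/2) \<odot> (w m \<oplus> w n))" by (intro d Wscale Wadd w)
      ultimately have "N (w m \<ominus> w n) < e\<^sup>2"
        using w(2)[of m] w(2)[of n] small[OF that(1)] small[OF that(2)] by linarith
      then have "sqrt (N (w m \<ominus> w n)) < sqrt (e\<^sup>2)" by (rule real_sqrt_less_mono)
      then show ?thesis using e by (simp add: hdist_def N_def)
    qed
    then show ?thesis by blast
  qed
  then obtain l where l: "l \<in> carrier H" "(\<lambda>n. hdist H (w n) l) \<longlonglongrightarrow> 0"
    using complete[of w] wc by blast
  then have lW: "l \<in> W" using W w(1) unfolding closed_subspace_def by blast
  have "hinner H x v = hinner H l v" if v: "v \<in> W" for v
  proof (cases "v = \<zero>")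
    case True
    then show ?thesis using x l inner_commute[of \<zero>] by (simp add: inner_zero_left)
  next
    case False
    define a where "a = N v"
    have vv: "hinner H v v = of_real a" using inner_self[OF Wc[OF v]] by (simp add: a_def N_def)
    then have a: "0 < a"
      using inner_nonneg[OF Wc[OF v]] inner_eq_zeroD[OF Wc[OF v]] False
      by (auto simp: less_le a_def N_def)
    define b where "b n = hinner H x v - hinner H (w n) v" for n
    have b: "(cmod (b n))\<^sup>2 \<le> a * inverse (Suc n)" for n
    proof -
      \<comment> \<open>The optimal multiple of \<open>v\<close>: moving \<open>w n\<close> by it
        lowers the squared distance to \<open>x\<close> by \<open>(cmod (b n))\<^sup>2 / a\<close>,
        while less than \<open>inverse (Suc n)\<close> is left above the infimum
        \<open>d\<close>.\<close>
      define c where "c = b n / of_real a"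
      have comm: "hinner H v x - hinner H v (w n) = cnj (b n)"
        using inner_commute[OF x Wc[OF v]] inner_commute[OF wc Wc[OF v]] by (simp add: b_def)
      have "hinner H (x \<ominus> (w n \<oplus> c \<odot> v)) (x \<ominus> (w n \<oplus> c \<odot> v))
          = hinner H (x \<ominus> w n) (x \<ominus> w n) - cnj c * b n - c * (hinner H v x - hinner H v (w n))
            + c * cnj c * hinner H v v"
        by (simp add: simps w(1) v b_def algebra_simps)
      also have "\<dots> = hinner H (x \<ominus> w n) (x \<ominus> w n) - b n * cnj (b n) / of_real a"
        unfolding comm vv using a by (simp add: c_def field_simps)
      also have "Re \<dots> = N (x \<ominus> w n) - (cmod (b n))\<^sup>2 / a"
        by (simp add: N_def flip: complex_norm_square of_real_divide of_real_power)
      finally have "d \<le> N (x \<ominus> w n) - (cmod (b n))\<^sup>2 / a"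
        using d[OF Wadd[OF w(1) Wscale[OF v]], of n c] by (simp add: N_def)
      then have "(cmod (b n))\<^sup>2 / a \<le> inverse (Suc n)" using w(2)[of n] by linarith
      then show ?thesis using a by (simp add: field_simps)
    qed
    have "(\<lambda>n. a * inverse (Suc n)) \<longlonglongrightarrow> 0"
      using tendsto_mult_right_zero[OF LIMSEQ_inverse_real_of_nat] .
    then have "(\<lambda>n. (cmod (b n))\<^sup>2) \<longlonglongrightarrow> 0"
      by (rule Lim_null_comparison[rotated]) (use b in auto)
    then have b0: "b \<longlonglongrightarrow> 0" by (simp add: tendsto_norm_zero_iff)
    have "(\<lambda>n. hinner H (w n) v - hinner H l v) \<longlonglongrightarrow> 0"
    proof (rule Lim_null_comparison)
      show "(\<lambda>n. hdist H (w n) l * sqrt a) \<longlonglongrightarrow> 0" using tendsto_mult_left_zero[OF l(2)] .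
      have "norm (hinner H (w n) v - hinner H l v) \<le> hdist H (w n) l * sqrt a" for n
        using Cauchy_Schwarz[OF M.minus_closed[OF wc l(1)] Wc[OF v], of n] wc[of n] l(1) Wc[OF v]
        by (simp add: inner_minus_left hdist_def a_def N_def)
      then show "\<forall>\<^sub>F n in sequentially. norm (hinner H (w n) v - hinner H l v) \<le> hdist H (w n) l * sqrt a"
        by simp
    qed
    from tendsto_add[OF b0 this] have "(\<lambda>n. hinner H x v - hinner H l v) \<longlonglongrightarrow> 0"
      by (simp add: b_def)
    then show ?thesis by (simp add: tendsto_const_iff)
  qed
  then show ?thesis using lW by blast
qed

end


section \<open>Positive definite functions\<close>

text \<open>Positivity is postulated for distinct points; here points may repeat, and the weights of
  equal points are added up first. Products of group elements will produce such repetitions.\<close>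

lemma (in positive_kernel) positive_family:
  assumes I: "finite I" and p: "p ` I \<subseteq> X"
  shows "0 \<le> Re (\<Sum>i\<in>I. \<Sum>j\<in>I. w i * cnj (w j) * k (p i) (p j))"
proof -
  define c where "c z = (\<Sum>i | i \<in> I \<and> p i = z. w i)" for z
  have group1: "(\<Sum>i\<in>I. w i * h (p i)) = (\<Sum>z\<in>p ` I. c z * h z)" for h :: "'a \<Rightarrow> complex"
    unfolding c_def sum_distrib_right
    by (subst sum.image_gen[OF I, of _ p]) (auto intro!: sum.cong)
  have group2: "(\<Sum>j\<in>I. cnj (w j) * h (p j)) = (\<Sum>z\<in>p ` I. cnj (c z) * h z)" for h :: "'a \<Rightarrow> complex"
    unfolding c_def cnj_sum sum_distrib_right
    by (subst sum.image_gen[OF I, of _ p]) (auto intro!: sum.cong)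
  have "(\<Sum>i\<in>I. \<Sum>j\<in>I. w i * cnj (w j) * k (p i) (p j))
      = (\<Sum>i\<in>I. w i * (\<Sum>j\<in>I. cnj (w j) * k (p i) (p j)))"
    by (simp add: sum_distrib_left mult.assoc)
  also have "\<dots> = (\<Sum>i\<in>I. w i * (\<Sum>y\<in>p ` I. cnj (c y) * k (p i) y))"
    by (simp add: group2)
  also have "\<dots> = (\<Sum>x\<in>p ` I. \<Sum>y\<in>p ` I. c x * cnj (c y) * k x y)"
    by (subst group1) (simp add: sum_distrib_left mult.assoc)
  finally show ?thesis using positive[of "p ` I" c] I p by simp
qed

lemma tendsto_fun:
  fixes s :: "nat \<Rightarrow> 'a \<Rightarrow> 'b::topological_space"
  assumes "\<And>a. (\<lambda>n. s n a) \<longlonglongrightarrow> l a"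
  shows "s \<longlonglongrightarrow> l"
proof -
  have "limitin (product_topology (\<lambda>_. euclidean) UNIV) s l sequentially"
    using assms by (simp add: limitin_componentwise)
  then show ?thesis by (simp add: euclidean_product_topology)
qed

context group
begin

text \<open>The positivity condition restricts only real parts, so Hermitian symmetry is a condition
  of its own. Vanishing outside the carrier confines the relevant coordinates to the group.\<close>

definition positive_definite :: "('a \<Rightarrow> complex) \<Rightarrow> bool"
  where "positive_definite \<phi> \<longleftrightarrow> (\<forall>g. g \<notin> carrier G \<longrightarrow> \<phi> g = 0) \<and>
    (\<forall>g\<in>carrier G. \<phi> (inv g) = cnj (\<phi> g)) \<and>
    (\<forall>A c. finite A \<and> A \<subseteq> carrier G \<longrightarrow>
      0 \<le> Re (\<Sum>a\<in>A. \<Sum>b\<in>A. c a * cnj (c b) * \<phi> (inv b \<otimes> a)))"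

definition pd_cone :: "('a \<Rightarrow> complex) set"
  where "pd_cone = {\<phi>. positive_definite \<phi> \<and> finite {g. \<phi> g \<noteq> 0}}"

text \<open>Normalization comes after the closure: the closed cone is stable under sums, rescaling
  and diagonal coefficients, which need not preserve the value at \<open>\<one>\<close>.\<close>

definition states :: "('a \<Rightarrow> complex) set"
  where "states = {\<phi> \<in> closure pd_cone. \<phi> \<one> = 1}"

lemma positive_kernel_group:
  assumes "positive_definite \<phi>"
  shows "positive_kernel (carrier G) (\<lambda>a b. \<phi> (inv b \<otimes> a))"
proof
  fix a b assume "a \<in> carrier G" "b \<in> carrier G"
  then have "inv a \<otimes> b = inv (inv b \<otimes> a)" "inv b \<otimes> a \<in> carrier G" by (simp_all add: inv_mult_group)
  then show "\<phi> (inv a \<otimes> b) = cnj (\<phi> (inv b \<otimes> a))"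
    using assms unfolding positive_definite_def by metis
next
  fix A c assume "finite A" "A \<subseteq> carrier G"
  then show "0 \<le> Re (\<Sum>a\<in>A. \<Sum>b\<in>A. c a * cnj (c b) * \<phi> (inv b \<otimes> a))"
    using assms unfolding positive_definite_def by blast
qed

text \<open>Cauchy-Schwarz for the point masses at \<open>g\<close> and \<open>\<one>\<close>: their
  pairing is \<open>\<phi> g\<close>, and both have squared seminorm
  \<open>Re (\<phi> \<one>)\<close>.\<close>

lemma positive_definite_cmod_le:
  assumes "positive_definite \<phi>"
  shows "cmod (\<phi> g) \<le> Re (\<phi> \<one>)"
proof (cases "g \<in> carrier G")
  case True
  interpret positive_kernel "carrier G" "\<lambda>a b. \<phi> (inv b \<otimes> a)"
    by (rule positive_kernel_group) fact
  have kernel_sum: "kernel_sum (point g) b = \<phi> (inv b \<otimes> g)" if "g \<in> carrier G" "b \<in> carrier G" for g b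
    using that by (simp add: kernel_sum_eq[of "{g}"] point_def)
  have "cmod (form (point g) (point \<one>)) \<le> snorm (point g) * snorm (point \<one>)"
    using True by (intro form_Cauchy_Schwarz finsupp_point) auto
  moreover have "form (point g) (point \<one>) = \<phi> g"
    using True by (simp add: form_point finsupp_point kernel_sum)
  moreover have "snorm (point h) = sqrt (Re (\<phi> \<one>))" if "h \<in> carrier G" for h
    using that by (simp add: snorm_def form_point finsupp_point kernel_sum)
  moreover have "0 \<le> Re (\<phi> \<one>)"
    using form_nonneg[OF finsupp_point[OF one_closed]] by (simp add: form_point finsupp_point kernel_sum)
  ultimately show ?thesis using True by simp
next
  case False
  have "(\<Sum>a\<in>{\<one>}. \<Sum>b\<in>{\<one>}. 1 * cnj 1 * \<phi> (inv b \<otimes> a)) = \<phi> \<one>" by simp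
  moreover have "0 \<le> Re (\<Sum>a\<in>{\<one>}. \<Sum>b\<in>{\<one>}. 1 * cnj 1 * \<phi> (inv b \<otimes> a))"
    using assms unfolding positive_definite_def
    by (elim conjE allE[of _ "{\<one>}"] allE[of _ "\<lambda>_. 1"]) auto
  ultimately show ?thesis using assms False by (simp add: positive_definite_def)
qed

lemma positive_definite_one:
  assumes "positive_definite \<phi>"
  shows "\<phi> \<one> = of_real (Re (\<phi> \<one>))"
proof -
  have "\<phi> (inv \<one>) = cnj (\<phi> \<one>)" using assms unfolding positive_definite_def by blast
  then show ?thesis by (simp add: complex_eq_iff)
qed

lemma closed_positive_definite: "closed {\<phi>. positive_definite \<phi>}"
proof -
  have "{\<phi>. positive_definite \<phi>} = (\<Inter>g\<in>- carrier G. {\<phi>. \<phi> g = 0})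
      \<inter> (\<Inter>g\<in>carrier G. {\<phi>. \<phi> (inv g) = cnj (\<phi> g)})
      \<inter> (\<Inter>A\<in>{A. finite A \<and> A \<subseteq> carrier G}. \<Inter>c.
          {\<phi>. 0 \<le> Re (\<Sum>a\<in>A. \<Sum>b\<in>A. c a * cnj (c b) * \<phi> (inv b \<otimes> a))})"
    by (auto simp: positive_definite_def)
  also have "closed \<dots>"
    by (intro closed_Int closed_INT ballI closed_Collect_eq closed_Collect_le
        continuous_on_Re continuous_on_cnj continuous_on_sum continuous_on_mult
        continuous_on_const continuous_on_product_coordinates)
  finally show ?thesis .
qed

lemma positive_definite_combination:
  assumes "positive_definite \<phi>" "positive_definite \<psi>" "0 \<le> r" "0 \<le> s"
  shows "positive_definite (\<lambda>g. of_real r * \<phi> g + of_real s * \<psi> g)"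
  unfolding positive_definite_def
proof (intro conjI allI impI ballI)
  fix A c assume A: "finite A \<and> A \<subseteq> carrier G"
  define S where "S \<phi> = (\<Sum>a\<in>A. \<Sum>b\<in>A. c a * cnj (c b) * \<phi> (inv b \<otimes> a))" for \<phi>
  have "S (\<lambda>g. of_real r * \<phi> g + of_real s * \<psi> g) = of_real r * S \<phi> + of_real s * S \<psi>"
    unfolding S_def sum_distrib_left sum.distrib[symmetric] by (simp add: algebra_simps)
  moreover have "0 \<le> Re (S \<phi>)" "0 \<le> Re (S \<psi>)"
    using assms(1,2) A unfolding S_def positive_definite_def by blast+
  ultimately show "0 \<le> Re (\<Sum>a\<in>A. \<Sum>b\<in>A. c a * cnj (c b) *
      (of_real r * \<phi> (inv b \<otimes> a) + of_real s * \<psi> (inv b \<otimes> a)))"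
    using assms(3,4) unfolding S_def by simp
qed (use assms in \<open>simp_all add: positive_definite_def\<close>)

lemma pd_cone_combination:
  assumes "\<phi> \<in> pd_cone" "\<psi> \<in> pd_cone" "0 \<le> r" "0 \<le> s"
  shows "(\<lambda>g. of_real r * \<phi> g + of_real s * \<psi> g) \<in> pd_cone"
proof -
  have "{g. of_real r * \<phi> g + of_real s * \<psi> g \<noteq> 0} \<subseteq> {g. \<phi> g \<noteq> 0} \<union> {g. \<psi> g \<noteq> 0}" by auto
  moreover have "finite ({g. \<phi> g \<noteq> 0} \<union> {g. \<psi> g \<noteq> 0})" using assms by (simp add: pd_cone_def)
  ultimately have "finite {g. of_real r * \<phi> g + of_real s * \<psi> g \<noteq> 0}" by (rule finite_subset)
  moreover have "positive_definite (\<lambda>g. of_real r * \<phi> g + of_real s * \<psi> g)"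
    using assms by (intro positive_definite_combination) (simp_all add: pd_cone_def)
  ultimately show ?thesis by (simp add: pd_cone_def)
qed

lemma closure_pd_cone_combination:
  assumes "\<phi> \<in> closure pd_cone" "\<psi> \<in> closure pd_cone" "0 \<le> r" "0 \<le> s"
  shows "(\<lambda>g. of_real r * \<phi> g + of_real s * \<psi> g) \<in> closure pd_cone"
proof -
  let ?f = "\<lambda>(u :: ('a \<Rightarrow> complex) \<times> ('a \<Rightarrow> complex)) g. of_real r * fst u g + of_real s * snd u g :: complex"
  have "continuous_on UNIV ?f"
  proof (rule continuous_on_coordinatewise_then_product)
    fix g
    have "continuous_on UNIV (\<lambda>u :: ('a \<Rightarrow> complex) \<times> ('a \<Rightarrow> complex). fst u g)"
      "continuous_on UNIV (\<lambda>u :: ('a \<Rightarrow> complex) \<times> ('a \<Rightarrow> complex). snd u g)"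
      by (rule continuous_on_product_then_coordinatewise, intro continuous_intros)+
    then show "continuous_on UNIV (\<lambda>u. of_real r * fst u g + of_real s * snd u g :: complex)"
      by (intro continuous_intros)
  qed
  then have "?f ` closure (pd_cone \<times> pd_cone) \<subseteq> closure pd_cone"
  proof (intro image_closure_subset)
    show "?f ` (pd_cone \<times> pd_cone) \<subseteq> closure pd_cone"
    proof (intro image_subsetI subsetD[OF closure_subset])
      fix u assume "u \<in> pd_cone \<times> pd_cone"
      then show "?f u \<in> pd_cone" using assms(3,4) by (auto intro!: pd_cone_combination)
    qed
  qed (auto intro: continuous_on_subset)
  moreover have "(\<phi>, \<psi>) \<in> closure (pd_cone \<times> pd_cone)" using assms by (simp add: closure_Times)
  ultimately have "?f (\<phi>, \<psi>) \<in> closure pd_cone" by blast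
  then show ?thesis by simp
qed

lemma closure_pd_cone_scale:
  assumes "\<phi> \<in> closure pd_cone" "0 \<le> r"
  shows "(\<lambda>g. of_real r * \<phi> g) \<in> closure pd_cone"
  using closure_pd_cone_combination[OF assms(1,1,2), of 0] by simp

lemma closure_pd_cone_positive_definite: "\<phi> \<in> closure pd_cone \<Longrightarrow> positive_definite \<phi>"
  using closure_minimal[OF _ closed_positive_definite, of pd_cone] by (auto simp: pd_cone_def)

section \<open>Normalized functions: compactness and density of finite support\<close>

lemma states_positive_definite: "\<phi> \<in> states \<Longrightarrow> positive_definite \<phi>"
  using closure_pd_cone_positive_definite by (simp add: states_def)

lemma mix_closed_states: "mix_closed states"
  unfolding mix_closed_def mix_def states_def
  by (auto intro: closure_pd_cone_combination simp del: of_real_diff) simp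

text \<open>All values are bounded by the value 1 at the identity, so this is a closed subset of a
  product of unit discs, compact by Tychonoff.\<close>

lemma compact_states: "compact states"
proof -
  have "closed (closure pd_cone \<inter> {\<phi>. \<phi> \<one> = 1})"
    by (intro closed_Int closed_closure closed_Collect_eq continuous_on_product_coordinates
        continuous_on_const)
  moreover have "compact (\<Pi>\<^sub>E g\<in>UNIV. cball 0 1 :: complex set)"
    using compactin_PiE[of "\<lambda>_. euclidean" UNIV "\<lambda>_. cball 0 1 :: complex set"]
    by (simp add: euclidean_product_topology)
  ultimately have "compact ((\<Pi>\<^sub>E g\<in>UNIV. cball 0 1) \<inter> (closure pd_cone \<inter> {\<phi>. \<phi> \<one> = 1}))"
    by (intro compact_Int_closed)
  moreover have "(\<Pi>\<^sub>E g\<in>UNIV. cball 0 1) \<inter> (closure pd_cone \<inter> {\<phi>. \<phi> \<one> = 1}) = states"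
  proof -
    have "cmod (\<phi> g) \<le> 1" if "\<phi> \<in> states" for \<phi> g
      using positive_definite_cmod_le[OF states_positive_definite[OF that], of g] that
      by (simp add: states_def)
    then have "states \<subseteq> (\<Pi>\<^sub>E g\<in>UNIV. cball 0 1)" by auto
    then show ?thesis by (auto simp: states_def)
  qed
  ultimately show ?thesis by simp
qed

lemma states_nonempty: "states \<noteq> {}"
proof -
  define \<delta> where "\<delta> = (\<lambda>g. if g = \<one> then 1 else 0 :: complex)"
  have "positive_definite \<delta>"
    unfolding positive_definite_def
  proof (intro conjI allI impI ballI)
    show "\<delta> (inv g) = cnj (\<delta> g)" if "g \<in> carrier G" for g using that by (simp add: \<delta>_def)
    fix A and c :: "'a \<Rightarrow> complex" assume A: "finite A \<and> A \<subseteq> carrier G"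
    have "(\<Sum>a\<in>A. \<Sum>b\<in>A. c a * cnj (c b) * \<delta> (inv b \<otimes> a))
        = (\<Sum>a\<in>A. \<Sum>b\<in>A. if b = a then c a * cnj (c b) else 0)"
    proof (intro sum.cong refl)
      fix a b assume "a \<in> A" "b \<in> A"
      then have "inv b \<otimes> a = \<one> \<longleftrightarrow> b = a"
        using A by (metis inv_comm inv_equality inv_inv inv_closed l_inv subsetD)
      then show "c a * cnj (c b) * \<delta> (inv b \<otimes> a) = (if b = a then c a * cnj (c b) else 0)"
        by (simp add: \<delta>_def)
    qed
    also have "\<dots> = (\<Sum>a\<in>A. c a * cnj (c a))" using A by simp
    also have "\<dots> = of_real (\<Sum>a\<in>A. (cmod (c a))\<^sup>2)"
      unfolding of_real_sum by (intro sum.cong refl) (rule complex_norm_square[symmetric])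
    finally show "0 \<le> Re (\<Sum>a\<in>A. \<Sum>b\<in>A. c a * cnj (c b) * \<delta> (inv b \<otimes> a))"
      by (simp add: sum_nonneg)
  qed (auto simp: \<delta>_def)
  then have "\<delta> \<in> pd_cone" by (auto simp: pd_cone_def \<delta>_def)
  then have "\<delta> \<in> states" using closure_subset by (auto simp: states_def \<delta>_def)
  then show ?thesis by blast
qed

lemma states_dense:
  assumes f: "f \<in> functionals" and x: "x \<in> states" "c < f x"
  shows "\<exists>p\<in>states \<inter> pd_cone. c < f p"
proof -
  \<comment> \<open>An approximant from the cone need not be normalized, so the inequality
    \<open>c < f y\<close> is made homogeneous; dividing \<open>y\<close> by its positive value at
    \<open>\<one>\<close> restores it.\<close>
  define U where "U = {y :: 'a \<Rightarrow> complex. c * Re (y \<one>) < f y} \<inter> {y. 0 < Re (y \<one>)}"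
  have "open U" unfolding U_def
    by (intro open_Int open_Collect_less functionals_continuous[OF f] continuous_intros
        continuous_on_product_coordinates)
  moreover have "x \<in> U \<inter> closure pd_cone" using x by (simp add: U_def states_def)
  ultimately obtain y where y: "y \<in> U" "y \<in> pd_cone" using open_Int_closure_eq_empty by blast
  define r where "r = Re (y \<one>)"
  have r: "0 < r" "y \<one> = of_real r" "c * r < f y"
    using y positive_definite_one[of y] by (auto simp: U_def r_def pd_cone_def)
  define p where "p = (\<lambda>g. of_real (1 / r) * y g)"
  have "p \<in> pd_cone" using pd_cone_combination[OF y(2,2), of "1 / r" 0] r by (simp add: p_def)
  moreover have "p \<one> = 1" using r by (simp add: p_def)
  moreover have "f p = 1 / r * f y" using f unfolding functionals_def p_def by blast
  then have "r * c < r * f p" using r by (simp add: mult.commute)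
  then have "c < f p" using r(1) by simp
  ultimately show ?thesis using closure_subset by (auto simp: states_def)
qed

text \<open>
  If \<open>p = t \<psi> + (1 - t) \<psi>'\<close> with \<open>\<psi> = 1\<close> on \<open>N\<close>, then for every finite \<open>A \<subseteq> N\<close> the sum of
  \<open>p (b\<^sup>-\<^sup>1 a)\<close> over \<open>a, b \<in> A\<close> is at least \<open>t |A|\<^sup>2\<close>, and at most \<open>|A|\<close> times the size of the support.
\<close>

lemma finite_support_not_dominating:
  assumes N: "subgroup N G" "infinite N"
    and p: "p \<in> pd_cone" "p \<in> states" and \<psi>: "\<And>h. h \<in> N \<Longrightarrow> \<psi> h = 1"
    and \<psi>': "\<psi>' \<in> states" and t: "0 < t" "t \<le> 1"
  shows "p \<noteq> mix t \<psi> \<psi>'"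
proof
  assume mix: "p = mix t \<psi> \<psi>'"
  define s where "s = card {g. p g \<noteq> 0}"
  \<comment> \<open>This makes the lower bound \<open>t n\<^sup>2\<close> exceed the upper bound
    \<open>n s\<close>.\<close>
  obtain n :: nat where n: "real s / t < real n" using reals_Archimedean2 by blast
  obtain A where A: "A \<subseteq> N" "finite A" "card A = n"
    using infinite_arbitrarily_large[OF N(2)] by blast
  have Nc: "N \<subseteq> carrier G" using N(1) by (rule subgroup.subset)
  define S where "S \<phi> = (\<Sum>a\<in>A. \<Sum>b\<in>A. 1 * cnj 1 * \<phi> (inv b \<otimes> a))" for \<phi> :: "'a \<Rightarrow> complex"
  have "S \<psi> = of_nat (n * n)"
  proof -
    have "\<psi> (inv b \<otimes> a) = 1" if "a \<in> A" "b \<in> A" for a b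
      using that A N(1) by (intro \<psi>) (meson subgroup.m_closed subgroup.m_inv_closed subsetD)
    then show ?thesis using A by (simp add: S_def)
  qed
  moreover have "0 \<le> Re (S \<psi>')"
    unfolding S_def
    by (rule positive_kernel.positive[OF positive_kernel_group[OF states_positive_definite[OF \<psi>']]])
      (use A Nc in auto)
  moreover have "S p = of_real t * S \<psi> + of_real (1 - t) * S \<psi>'"
    unfolding mix mix_def S_def sum_distrib_left sum.distrib[symmetric] by simp
  ultimately have "t * (real n * real n) \<le> Re (S p)" using t by simp
  also have "\<dots> \<le> cmod (S p)" by (rule complex_Re_le_cmod)
  also have "\<dots> \<le> (\<Sum>a\<in>A. real s)"
    unfolding S_def
  proof (rule order_trans[OF norm_sum], rule sum_mono)
    fix a assume a: "a \<in> A"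
    \<comment> \<open>For fixed \<open>a\<close> the elements \<open>inv b \<otimes> a\<close> are
      distinct, so at most \<open>s\<close> of them meet the support, each with a value of modulus
      at most 1.\<close>
    have inj: "inj_on (\<lambda>b. inv b \<otimes> a) A"
    proof (rule inj_onI)
      fix b b' assume b: "b \<in> A" "b' \<in> A" and eq: "inv b \<otimes> a = inv b' \<otimes> a"
      have c: "a \<in> carrier G" "b \<in> carrier G" "b' \<in> carrier G" using a b A Nc by auto
      then have "inv b = inv b'" using eq right_cancel by blast
      then show "b = b'" using c inv_inv by metis
    qed
    have fin: "finite {g. p g \<noteq> 0}" using p(1) by (simp add: pd_cone_def)
    have le1: "cmod (p g) \<le> 1" for g
      using positive_definite_cmod_le[OF states_positive_definite[OF p(2)], of g] p(2)
      by (simp add: states_def)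
    have "cmod (\<Sum>b\<in>A. 1 * cnj 1 * p (inv b \<otimes> a)) \<le> (\<Sum>b\<in>A. cmod (p (inv b \<otimes> a)))"
      using norm_sum by simp
    also have "\<dots> = (\<Sum>g\<in>(\<lambda>b. inv b \<otimes> a) ` A. cmod (p g))" using inj by (simp add: sum.reindex)
    also have "\<dots> = (\<Sum>g\<in>(\<lambda>b. inv b \<otimes> a) ` A \<inter> {g. p g \<noteq> 0}. cmod (p g))"
      using A by (intro sum.mono_neutral_right) auto
    also have "\<dots> \<le> (\<Sum>g | p g \<noteq> 0. cmod (p g))" using fin by (intro sum_mono2) auto
    also have "\<dots> \<le> (\<Sum>g | p g \<noteq> 0. 1)" by (intro sum_mono le1)
    finally show "cmod (\<Sum>b\<in>A. 1 * cnj 1 * p (inv b \<otimes> a)) \<le> real s" by (simp add: s_def)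
  qed
  also have "\<dots> = real n * real s" by (simp add: A)
  finally have le: "real n * (t * real n) \<le> real n * real s" by (simp add: ac_simps)
  have "0 \<le> real s / t" using t by simp
  then have "0 < real n" using n by linarith
  then have "t * real n \<le> real s" using le by simp
  then show False using n t by (simp add: field_simps)
qed

section \<open>Normal closures and an extreme point outside all of their sets\<close>

definition normal_closure :: "'a \<Rightarrow> 'a set"
  where "normal_closure x = \<Inter>{N. N \<lhd> G \<and> x \<in> N}"

lemma normal_closure_normal:
  assumes "x \<in> carrier G"
  shows "normal_closure x \<lhd> G"
proof -
  have "carrier G \<in> {N. N \<lhd> G \<and> x \<in> N}"
    using assms by (simp add: normal_inv_iff subgroup_self)
  then have "subgroup (normal_closure x) G"
    unfolding normal_closure_def by (intro subgroups_Inter) (auto simp: normal_imp_subgroup)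
  then show ?thesis by (auto simp: normal_inv_iff normal_closure_def)
qed

theorem extreme_state_exists:
  assumes cnt: "countable (carrier G)"
    and inf: "\<And>N. \<lbrakk>N \<lhd> G; N \<noteq> {\<one>}\<rbrakk> \<Longrightarrow> infinite N"
  obtains \<phi> where "\<phi> \<in> states"
    "\<And>x y t. \<lbrakk>x \<in> states; y \<in> states; 0 < t; t < 1; \<phi> = mix t x y\<rbrakk> \<Longrightarrow> x = \<phi>"
    "\<And>N. \<lbrakk>N \<lhd> G; N \<noteq> {\<one>}\<rbrakk> \<Longrightarrow> \<exists>h\<in>N. \<phi> h \<noteq> 1"
proof -
  define F where "F x = {\<phi> \<in> states. \<forall>h\<in>normal_closure x. \<phi> h = 1}" for x
  have x_in: "x \<in> normal_closure x" for x by (auto simp: normal_closure_def)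
  have F: "closed (F x) \<and> mix_closed (F x) \<and> F x \<subseteq> states" for x
  proof (intro conjI)
    have "closed (states \<inter> (\<Inter>h\<in>normal_closure x. {\<phi>. \<phi> h = 1}))"
      by (intro closed_Int closed_INT ballI closed_Collect_eq continuous_on_product_coordinates
          continuous_on_const compact_fun_imp_closed compact_states)
    moreover have "states \<inter> (\<Inter>h\<in>normal_closure x. {\<phi>. \<phi> h = 1}) = F x" by (auto simp: F_def)
    ultimately show "closed (F x)" by simp
    show "mix_closed (F x)"
      using mix_closed_states by (auto simp: mix_closed_def F_def mix_def)
  qed (auto simp: F_def)
  obtain \<phi> where \<phi>: "\<phi> \<in> states" "\<phi> \<notin> \<Union>(F ` (carrier G - {\<one>}))"
    "\<And>x y t. \<lbrakk>x \<in> states; y \<in> states; 0 < t; t < 1; \<phi> = mix t x y\<rbrakk> \<Longrightarrow> x = \<phi>"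
  proof (rule extreme_point_avoiding[OF compact_states mix_closed_states states_nonempty cnt])
    show "\<phi> a = 0" if "\<phi> \<in> states" "a \<notin> carrier G" for \<phi> a
      using states_positive_definite[OF that(1)] that(2) by (simp add: positive_definite_def)
    show "countable (F ` (carrier G - {\<one>}))" using cnt by (intro countable_image) auto
    show "closed E \<and> mix_closed E \<and> E \<subseteq> states" if "E \<in> F ` (carrier G - {\<one>})" for E
      using that F by auto
    fix f c x E assume f: "f \<in> functionals" "x \<in> states" "c < f x" "E \<in> F ` (carrier G - {\<one>})"
    obtain p where p: "p \<in> states" "p \<in> pd_cone" "c < f p" using states_dense[OF f(1-3)] by blast
    obtain g where g: "g \<in> carrier G" "g \<noteq> \<one>" "E = F g" using f(4) by auto
    note nc = normal_closure_normal[OF g(1)]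
    have "infinite (normal_closure g)" using g(2) x_in[of g] by (intro inf nc) auto
    then have "p \<noteq> mix t \<psi> \<psi>'" if "0 < t" "t \<le> 1" "\<psi> \<in> E" "\<psi>' \<in> states" for t \<psi> \<psi>'
      using that g(3) p
      by (intro finite_support_not_dominating[OF normal_imp_subgroup[OF nc]]) (auto simp: F_def)
    then show "\<exists>p\<in>states. c < f p \<and> (\<forall>t x y. 0 < t \<and> t \<le> 1 \<and> x \<in> E \<and> y \<in> states \<longrightarrow> p \<noteq> mix t x y)"
      using p by blast
  qed blast
  have "\<exists>h\<in>N. \<phi> h \<noteq> 1" if N: "N \<lhd> G" "N \<noteq> {\<one>}" for N
  proof -
    note sub = normal_imp_subgroup[OF N(1)]
    obtain x where x: "x \<in> N" "x \<noteq> \<one>" using N sub subgroup.one_closed by blast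
    have "x \<in> carrier G" using x sub subgroup.mem_carrier by metis
    then have "\<phi> \<notin> F x" using \<phi>(2) x by blast
    then obtain h where "h \<in> normal_closure x" "\<phi> h \<noteq> 1" using \<phi>(1) by (auto simp: F_def)
    then show ?thesis using N(1) x by (auto simp: normal_closure_def)
  qed
  then show thesis using that \<phi> by blast
qed

end


section \<open>The representation of a positive definite function\<close>

context group
begin

lemma inv_mult_cancel: "\<lbrakk>g \<in> carrier G; a \<in> carrier G\<rbrakk> \<Longrightarrow> inv g \<otimes> (g \<otimes> a) = a"
  by (simp add: m_assoc[symmetric])

lemma mult_inv_cancel: "\<lbrakk>g \<in> carrier G; a \<in> carrier G\<rbrakk> \<Longrightarrow> g \<otimes> (inv g \<otimes> a) = a"
  by (simp add: m_assoc[symmetric])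

text \<open>
  For \<open>\<phi> g = \<langle>\<pi> g \<xi>, \<xi>\<rangle>\<close> this is the diagonal coefficient of the vector \<open>\<Sum>a. c a \<cdot> \<pi> a \<xi>\<close>.
\<close>

definition coefficient :: "('a \<Rightarrow> complex) \<Rightarrow> ('a \<Rightarrow> complex) \<Rightarrow> 'a \<Rightarrow> complex"
  where "coefficient c \<phi> = (\<lambda>g. if g \<in> carrier G
    then \<Sum>a | c a \<noteq> 0. \<Sum>b | c b \<noteq> 0. c a * cnj (c b) * \<phi> (inv b \<otimes> (g \<otimes> a)) else 0)"

text \<open>The sum over \<open>x, y\<close> with weights \<open>d\<close> becomes the sum for
  \<open>\<phi>\<close> over pairs \<open>(x, a)\<close> with weights \<open>d x * c a\<close> at
  the points \<open>x \<otimes> a\<close>. These points can coincide, so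
  \<open>positive_family\<close> is the form of positivity that applies.\<close>

lemma positive_definite_coefficient:
  assumes \<phi>: "positive_definite \<phi>" and c: "finite {a. c a \<noteq> 0}" "{a. c a \<noteq> 0} \<subseteq> carrier G"
  shows "positive_definite (coefficient c \<phi>)"
  unfolding positive_definite_def
proof (intro conjI allI impI ballI)
  interpret positive_kernel "carrier G" "\<lambda>a b. \<phi> (inv b \<otimes> a)"
    by (rule positive_kernel_group[OF \<phi>])
  let ?S = "{a. c a \<noteq> 0}"
  show "coefficient c \<phi> g = 0" if "g \<notin> carrier G" for g using that by (simp add: coefficient_def)
  show "coefficient c \<phi> (inv g) = cnj (coefficient c \<phi> g)" if g: "g \<in> carrier G" for g
  proof -
    have "(\<Sum>a\<in>?S. \<Sum>b\<in>?S. c a * cnj (c b) * \<phi> (inv b \<otimes> (inv g \<otimes> a)))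
        = (\<Sum>a\<in>?S. \<Sum>b\<in>?S. cnj (c b * cnj (c a) * \<phi> (inv a \<otimes> (g \<otimes> b))))"
    proof (intro sum.cong refl)
      fix a b assume "a \<in> ?S" "b \<in> ?S"
      then have ab: "a \<in> carrier G" "b \<in> carrier G" using c by auto
      then have "inv b \<otimes> (inv g \<otimes> a) = inv (inv a \<otimes> (g \<otimes> b))" "inv a \<otimes> (g \<otimes> b) \<in> carrier G"
        using g by (simp_all add: inv_mult_group m_assoc)
      then have "\<phi> (inv b \<otimes> (inv g \<otimes> a)) = cnj (\<phi> (inv a \<otimes> (g \<otimes> b)))"
        using \<phi> unfolding positive_definite_def by metis
      then show "c a * cnj (c b) * \<phi> (inv b \<otimes> (inv g \<otimes> a)) = cnj (c b * cnj (c a) * \<phi> (inv a \<otimes> (g \<otimes> b)))"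
        by simp
    qed
    also have "\<dots> = cnj (\<Sum>b\<in>?S. \<Sum>a\<in>?S. c b * cnj (c a) * \<phi> (inv a \<otimes> (g \<otimes> b)))"
      unfolding cnj_sum by (rule sum.swap)
    finally show ?thesis using g by (simp add: coefficient_def)
  qed
  fix A d assume A: "finite A \<and> A \<subseteq> carrier G"
  define w where "w i = d (fst i) * c (snd i)" for i :: "'a \<times> 'a"
  define p where "p i = fst i \<otimes> snd i" for i :: "'a \<times> 'a"
  have "(\<Sum>x\<in>A. \<Sum>y\<in>A. d x * cnj (d y) * coefficient c \<phi> (inv y \<otimes> x))
      = (\<Sum>x\<in>A. \<Sum>y\<in>A. \<Sum>a\<in>?S. \<Sum>b\<in>?S. w (x, a) * cnj (w (y, b)) * \<phi> (inv (p (y, b)) \<otimes> p (x, a)))"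
  proof (intro sum.cong refl)
    fix x y assume "x \<in> A" "y \<in> A"
    then have xy: "x \<in> carrier G" "y \<in> carrier G" using A by auto
    then have "d x * cnj (d y) * coefficient c \<phi> (inv y \<otimes> x)
        = (\<Sum>a\<in>?S. \<Sum>b\<in>?S. d x * cnj (d y) * (c a * cnj (c b) * \<phi> (inv b \<otimes> (inv y \<otimes> x \<otimes> a))))"
      by (simp add: coefficient_def sum_distrib_left)
    also have "\<dots> = (\<Sum>a\<in>?S. \<Sum>b\<in>?S. w (x, a) * cnj (w (y, b)) * \<phi> (inv (p (y, b)) \<otimes> p (x, a)))"
    proof (intro sum.cong refl)
      fix a b assume "a \<in> ?S" "b \<in> ?S"
      then have "a \<in> carrier G" "b \<in> carrier G" using c by auto
      then show "d x * cnj (d y) * (c a * cnj (c b) * \<phi> (inv b \<otimes> (inv y \<otimes> x \<otimes> a)))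
          = w (x, a) * cnj (w (y, b)) * \<phi> (inv (p (y, b)) \<otimes> p (x, a))"
        using xy by (simp add: w_def p_def inv_mult_group m_assoc)
    qed
    finally show "d x * cnj (d y) * coefficient c \<phi> (inv y \<otimes> x)
        = (\<Sum>a\<in>?S. \<Sum>b\<in>?S. w (x, a) * cnj (w (y, b)) * \<phi> (inv (p (y, b)) \<otimes> p (x, a)))" .
  qed
  also have "\<dots> = (\<Sum>x\<in>A. \<Sum>a\<in>?S. \<Sum>y\<in>A. \<Sum>b\<in>?S. w (x, a) * cnj (w (y, b)) * \<phi> (inv (p (y, b)) \<otimes> p (x, a)))"
    by (rule sum.cong[OF refl sum.swap])
  also have "\<dots> = (\<Sum>i\<in>A \<times> ?S. \<Sum>j\<in>A \<times> ?S. w i * cnj (w j) * \<phi> (inv (p j) \<otimes> p i))"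
    by (simp add: sum.cartesian_product')
  also have "0 \<le> Re \<dots>"
    using A c by (intro positive_family) (auto simp: p_def subset_iff)
  finally show "0 \<le> Re (\<Sum>x\<in>A. \<Sum>y\<in>A. d x * cnj (d y) * coefficient c \<phi> (inv y \<otimes> x))" .
qed

text \<open>A nonzero value at \<open>g\<close> puts \<open>inv b \<otimes> (g \<otimes> a)\<close>
  into the support of \<open>\<phi>\<close> for some \<open>a, b\<close> in the support of
  \<open>c\<close>, which leaves finitely many \<open>g\<close>.\<close>

lemma pd_cone_coefficient:
  assumes \<phi>: "\<phi> \<in> pd_cone" and c: "finite {a. c a \<noteq> 0}" "{a. c a \<noteq> 0} \<subseteq> carrier G"
  shows "coefficient c \<phi> \<in> pd_cone"
proof -
  let ?S = "{a. c a \<noteq> 0}" and ?T = "{g. \<phi> g \<noteq> 0}"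
  have "{g. coefficient c \<phi> g \<noteq> 0} \<subseteq> (\<lambda>(b, h, a). b \<otimes> h \<otimes> inv a) ` (?S \<times> ?T \<times> ?S)"
  proof
    fix g assume "g \<in> {g. coefficient c \<phi> g \<noteq> 0}"
    then have g: "g \<in> carrier G"
      and "(\<Sum>a\<in>?S. \<Sum>b\<in>?S. c a * cnj (c b) * \<phi> (inv b \<otimes> (g \<otimes> a))) \<noteq> 0"
      by (auto simp: coefficient_def split: if_splits)
    then obtain a where a: "a \<in> ?S" "(\<Sum>b\<in>?S. c a * cnj (c b) * \<phi> (inv b \<otimes> (g \<otimes> a))) \<noteq> 0"
      by (meson sum.neutral)
    then obtain b where b: "b \<in> ?S" "c a * cnj (c b) * \<phi> (inv b \<otimes> (g \<otimes> a)) \<noteq> 0"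
      by (meson sum.neutral)
    have "a \<in> carrier G" "b \<in> carrier G" using a b c by auto
    then have "g = b \<otimes> (inv b \<otimes> (g \<otimes> a)) \<otimes> inv a"
      using g by (simp add: mult_inv_cancel) (simp add: m_assoc)
    then show "g \<in> (\<lambda>(b, h, a). b \<otimes> h \<otimes> inv a) ` (?S \<times> ?T \<times> ?S)"
      using a b by (intro image_eqI[of _ _ "(b, inv b \<otimes> (g \<otimes> a), a)"]) auto
  qed
  moreover have "finite (?S \<times> ?T \<times> ?S)" using \<phi> c by (simp add: pd_cone_def)
  ultimately have "finite {g. coefficient c \<phi> g \<noteq> 0}" by (rule finite_surj[rotated])
  then show ?thesis using positive_definite_coefficient[OF _ c] \<phi> by (simp add: pd_cone_def)
qed

lemma closure_pd_cone_coefficient: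
  assumes \<phi>: "\<phi> \<in> closure pd_cone" and c: "finite {a. c a \<noteq> 0}" "{a. c a \<noteq> 0} \<subseteq> carrier G"
  shows "coefficient c \<phi> \<in> closure pd_cone"
proof -
  have "continuous_on (closure pd_cone) (coefficient c)"
  proof (rule continuous_on_coordinatewise_then_product)
    fix g show "continuous_on (closure pd_cone) (\<lambda>\<phi>. coefficient c \<phi> g)"
      unfolding coefficient_def
      by (cases "g \<in> carrier G") (auto intro!: continuous_on_sum continuous_on_mult continuous_on_const
          continuous_on_subset[OF continuous_on_product_coordinates])
  qed
  then have "coefficient c ` closure pd_cone \<subseteq> closure pd_cone"
    using pd_cone_coefficient[OF _ c] closure_subset by (intro image_closure_subset) auto
  then show ?thesis using \<phi> by blast
qed

end

locale group_positive_definite = group G for G (structure) +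
  fixes \<phi>
  assumes pd: "positive_definite \<phi>"

sublocale group_positive_definite \<subseteq> positive_kernel "carrier G" "\<lambda>a b. \<phi> (inv b \<otimes> a)"
  by (rule positive_kernel_group[OF pd])

context group_positive_definite
begin

text \<open>Used on two levels: on coefficients it moves the mass at \<open>a\<close> to
  \<open>g \<otimes> a\<close>, on the functions of the Hilbert space it is left translation;
  \<open>kernel_sum_translate\<close> matches the two.\<close>

definition translate :: "'a \<Rightarrow> ('a \<Rightarrow> complex) \<Rightarrow> 'a \<Rightarrow> complex"
  where "translate g f = (\<lambda>a. if a \<in> carrier G then f (inv g \<otimes> a) else 0)"

lemma translate_supp:
  assumes "g \<in> carrier G"
  shows "{a. translate g c a \<noteq> 0} \<subseteq> (\<lambda>a. g \<otimes> a) ` {a. c a \<noteq> 0}"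
proof
  fix a assume "a \<in> {a. translate g c a \<noteq> 0}"
  then have "a \<in> carrier G" "c (inv g \<otimes> a) \<noteq> 0" by (auto simp: translate_def split: if_splits)
  then show "a \<in> (\<lambda>a. g \<otimes> a) ` {a. c a \<noteq> 0}"
    using assms by (intro image_eqI[of _ _ "inv g \<otimes> a"]) (auto simp: mult_inv_cancel)
qed

lemma translate_finsupp:
  assumes "g \<in> carrier G" "c \<in> finsupp"
  shows "translate g c \<in> finsupp"
proof -
  have "finite {a. translate g c a \<noteq> 0}"
    using finite_subset[OF translate_supp[OF assms(1)]] assms(2) by (auto simp: finsupp_def)
  then show ?thesis by (auto simp: finsupp_def translate_def split: if_splits)
qed

lemma translate_shift: "\<lbrakk>g \<in> carrier G; a \<in> carrier G\<rbrakk> \<Longrightarrow> translate g c (g \<otimes> a) = c a"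
  by (simp add: translate_def inv_mult_cancel)

lemma form_translate_left:
  assumes g: "g \<in> carrier G" and c: "c \<in> finsupp" and d: "d \<in> finsupp"
  shows "form (translate g c) d = (\<Sum>a | c a \<noteq> 0. \<Sum>b | d b \<noteq> 0. c a * cnj (d b) * \<phi> (inv b \<otimes> (g \<otimes> a)))"
proof -
  have fin: "finite {a. c a \<noteq> 0}" "{a. c a \<noteq> 0} \<subseteq> carrier G" "finite {b. d b \<noteq> 0}"
    using c d by (auto simp: finsupp_def)
  have inj: "inj_on (\<lambda>a. g \<otimes> a) {a. c a \<noteq> 0}"
    using fin(2) g by (intro inj_onI) (metis inv_mult_cancel subsetD)
  have "form (translate g c) d
      = (\<Sum>a\<in>(\<lambda>a. g \<otimes> a) ` {a. c a \<noteq> 0}. \<Sum>b | d b \<noteq> 0. translate g c a * cnj (d b) * \<phi> (inv b \<otimes> a))"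
    using fin translate_supp[OF g] by (intro form_eq) auto
  also have "\<dots> = (\<Sum>a | c a \<noteq> 0. \<Sum>b | d b \<noteq> 0. translate g c (g \<otimes> a) * cnj (d b) * \<phi> (inv b \<otimes> (g \<otimes> a)))"
    using inj by (simp add: sum.reindex)
  also have "\<dots> = (\<Sum>a | c a \<noteq> 0. \<Sum>b | d b \<noteq> 0. c a * cnj (d b) * \<phi> (inv b \<otimes> (g \<otimes> a)))"
    using fin(2) by (intro sum.cong refl) (auto simp: translate_shift[OF g])
  finally show ?thesis .
qed

lemma kernel_sum_translate:
  assumes g: "g \<in> carrier G" and c: "c \<in> finsupp"
  shows "kernel_sum (translate g c) = translate g (kernel_sum c)"
proof
  fix b
  show "kernel_sum (translate g c) b = translate g (kernel_sum c) b"
  proof (cases "b \<in> carrier G")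
    case True
    have Sc: "{a. c a \<noteq> 0} \<subseteq> carrier G" using c by (simp add: finsupp_def)
    have "kernel_sum (translate g c) b = form (translate g c) (point b)"
      using True g c by (simp add: form_point translate_finsupp)
    also have "\<dots> = (\<Sum>a | c a \<noteq> 0. c a * \<phi> (inv b \<otimes> (g \<otimes> a)))"
      using True by (simp add: form_translate_left[OF g c finsupp_point]) (simp add: point_def)
    also have "\<dots> = (\<Sum>a | c a \<noteq> 0. c a * \<phi> (inv (inv g \<otimes> b) \<otimes> a))"
      using Sc g True by (intro sum.cong refl) (auto simp: inv_mult_group m_assoc)
    finally show ?thesis using True g by (simp add: translate_def kernel_sum_def)
  qed (simp add: kernel_sum_def translate_def)
qed

lemma translate_mult:
  assumes "g \<in> carrier G" "h \<in> carrier G"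
  shows "translate (g \<otimes> h) f = translate g (translate h f)"
  using assms by (auto simp: translate_def inv_mult_group m_assoc)

lemma translate_add: "translate g (\<lambda>a. c a + d a) = (\<lambda>a. translate g c a + translate g d a)"
  by (auto simp: translate_def)

lemma translate_diff: "translate g (\<lambda>a. c a - d a) = (\<lambda>a. translate g c a - translate g d a)"
  by (auto simp: translate_def)

lemma translate_scale: "translate g (\<lambda>a. r * c a) = (\<lambda>a. r * translate g c a)"
  by (auto simp: translate_def)

lemma translate_one: "f \<in> rkhs_carrier \<Longrightarrow> translate \<one> f = f"
  by (auto simp: translate_def rkhs_vanish)

lemma form_translate:
  assumes g: "g \<in> carrier G" and c: "c \<in> finsupp" and d: "d \<in> finsupp"
  shows "form (translate g c) (translate g d) = form c d"
proof -
  have fin: "finite {b. d b \<noteq> 0}" "{b. d b \<noteq> 0} \<subseteq> carrier G"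
    using d by (auto simp: finsupp_def)
  have inj: "inj_on (\<lambda>b. g \<otimes> b) {b. d b \<noteq> 0}"
    using fin(2) g by (intro inj_onI) (metis inv_mult_cancel subsetD)
  have "form (translate g c) (translate g d)
      = (\<Sum>b | translate g d b \<noteq> 0. cnj (translate g d b) * translate g (kernel_sum c) b)"
    using g c d by (simp add: form_kernel_sum translate_finsupp kernel_sum_translate)
  also have "\<dots> = (\<Sum>b\<in>(\<lambda>b. g \<otimes> b) ` {b. d b \<noteq> 0}. cnj (translate g d b) * translate g (kernel_sum c) b)"
    using fin translate_supp[OF g] by (intro sum.mono_neutral_left) auto
  also have "\<dots> = (\<Sum>b | d b \<noteq> 0. cnj (d b) * kernel_sum c b)"
    unfolding sum.reindex[OF inj] o_def
    using fin(2) by (intro sum.cong refl) (auto simp: translate_shift[OF g])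
  also have "\<dots> = form c d" by (simp add: form_kernel_sum c d)
  finally show ?thesis .
qed

lemma represents_translate:
  assumes g: "g \<in> carrier G" and s: "represents s f"
  shows "represents (\<lambda>n. translate g (s n)) (translate g f)"
proof -
  note V = represents_finsupp[OF s]
  have "snorm (\<lambda>a. translate g (s m) a - translate g (s n) a) = snorm (\<lambda>a. s m a - s n a)" for m n
    using g V by (simp add: snorm_def form_translate finsupp_diff flip: translate_diff)
  then have "cauchy (\<lambda>n. translate g (s n))"
    using represents_cauchy[OF s] V g by (simp add: cauchy_def translate_finsupp)
  moreover have "(\<lambda>n. kernel_sum (translate g (s n)) b) \<longlonglongrightarrow> translate g f b" for b
    using s g V by (simp add: kernel_sum_translate represents_def) (simp add: translate_def)
  ultimately show ?thesis by (simp add: represents_def)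
qed

lemma translate_rkhs_carrier:
  "\<lbrakk>g \<in> carrier G; f \<in> rkhs_carrier\<rbrakk> \<Longrightarrow> translate g f \<in> rkhs_carrier"
  using represents_translate by (auto simp: rkhs_carrier_def)

lemma translate_inner:
  assumes g: "g \<in> carrier G" and f: "f \<in> rkhs_carrier" and f': "f' \<in> rkhs_carrier"
  shows "rkhs_inner (translate g f) (translate g f') = rkhs_inner f f'"
proof -
  obtain s t where s: "represents s f" and t: "represents t f'" using f f' by (auto simp: rkhs_carrier_def)
  have "(\<lambda>n. form (s n) (t n)) \<longlonglongrightarrow> rkhs_inner (translate g f) (translate g f')"
    using represents_inner[OF represents_translate[OF g s] represents_translate[OF g t]]
    by (simp add: form_translate g represents_finsupp[OF s] represents_finsupp[OF t])
  then show ?thesis using represents_inner[OF s t] LIMSEQ_unique by blast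
qed

lemma translate_inverse:
  assumes "g \<in> carrier G" "f \<in> rkhs_carrier"
  shows "translate (inv g) (translate g f) = f" "translate g (translate (inv g) f) = f"
  using assms by (simp_all flip: translate_mult add: translate_one)

lemma translate_inner_left:
  assumes "g \<in> carrier G" "f \<in> rkhs_carrier" "f' \<in> rkhs_carrier"
  shows "rkhs_inner (translate g f) f' = rkhs_inner f (translate (inv g) f')"
  using translate_inner[of g f "translate (inv g) f'"] assms
  by (simp add: translate_inverse translate_rkhs_carrier)

text \<open>Elements of \<open>BijGroup\<close> are extensional, hence the restriction.\<close>

definition rep :: "'a \<Rightarrow> ('a \<Rightarrow> complex) \<Rightarrow> 'a \<Rightarrow> complex"
  where "rep g = restrict (translate g) rkhs_carrier"

lemma group_action_rep: "group_action G rkhs_carrier rep"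
proof -
  have bij: "rep g \<in> Bij rkhs_carrier" if g: "g \<in> carrier G" for g
  proof -
    have "bij_betw (rep g) rkhs_carrier rkhs_carrier"
      by (rule bij_betw_byWitness[where f'="rep (inv g)"])
        (auto simp: rep_def g translate_rkhs_carrier translate_inverse)
    then show ?thesis by (simp add: Bij_def rep_def)
  qed
  have "rep (g \<otimes> h) = compose rkhs_carrier (rep g) (rep h)"
    if "g \<in> carrier G" "h \<in> carrier G" for g h
    using that by (auto simp: rep_def compose_def translate_mult translate_rkhs_carrier)
  then show ?thesis
    unfolding group_action_def group_hom_def group_hom_axioms_def
    using bij group_BijGroup by (auto intro!: homI group_axioms simp: BijGroup_def)
qed

lemma unitary_representation_rep: "unitary_representation G rkhs rep"
proof -
  have "group_action G (carrier rkhs) rep" using group_action_rep by simp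
  then show ?thesis
    by (intro unitary_representation.intro hilbert_space_rkhs unitary_representation_axioms.intro)
      (auto simp: rep_def rkhs_carrier_add rkhs_carrier_scale translate_add translate_scale translate_inner)
qed

text \<open>On the group this is the function sending \<open>b\<close> to
  \<open>\<phi> (inv b)\<close>. Pairing \<open>f\<close> with its translate by \<open>g\<close>
  gives \<open>f g\<close>, so only the zero vector is orthogonal to all translates: this is
  cyclicity.\<close>

definition cyclic_vector :: "'a \<Rightarrow> complex"
  where "cyclic_vector = kernel_sum (point \<one>)"

lemma cyclic_vector_carrier: "cyclic_vector \<in> rkhs_carrier"
  by (simp add: cyclic_vector_def kernel_sum_rkhs_carrier finsupp_point)

lemma translate_cyclic_vector:
  assumes "g \<in> carrier G"
  shows "translate g cyclic_vector = kernel_sum (point g)"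
proof -
  have "translate g (point \<one>) = point g"
  proof
    fix a
    have "inv g \<otimes> a = \<one> \<longleftrightarrow> a = g" if "a \<in> carrier G"
      using assms that by (metis inv_mult_cancel mult_inv_cancel r_one inv_closed l_inv)
    then show "translate g (point \<one>) a = point g a" using assms by (auto simp: translate_def point_def)
  qed
  then show ?thesis using assms by (simp add: cyclic_vector_def flip: kernel_sum_translate add: finsupp_point)
qed

lemma inner_translate_cyclic_vector:
  "\<lbrakk>f \<in> rkhs_carrier; g \<in> carrier G\<rbrakk> \<Longrightarrow> rkhs_inner f (translate g cyclic_vector) = f g"
  by (simp add: translate_cyclic_vector rkhs_reproducing)

lemma inner_cyclic_vector:
  assumes "g \<in> carrier G"
  shows "rkhs_inner (translate g cyclic_vector) cyclic_vector = \<phi> g"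
proof -
  have "rkhs_inner (translate g cyclic_vector) (translate \<one> cyclic_vector) = translate g cyclic_vector \<one>"
    using assms by (intro inner_translate_cyclic_vector translate_rkhs_carrier cyclic_vector_carrier) auto
  also have "\<dots> = \<phi> g"
    using assms by (simp add: translate_cyclic_vector kernel_sum_eq[of "{g}"] point_def)
  finally show ?thesis by (simp add: translate_one cyclic_vector_carrier)
qed

text \<open>A projection of the cyclic vector is in general only a limit of finite combinations; the
  coefficients of the approximants lie in the closed cone and converge pointwise.\<close>

lemma coefficient_closure_pd_cone:
  assumes \<phi>: "\<phi> \<in> closure pd_cone" and f: "f \<in> rkhs_carrier"
  shows "(\<lambda>g. if g \<in> carrier G then rkhs_inner (translate g f) f else 0) \<in> closure pd_cone"
proof -
  obtain s where s: "represents s f" using f by (auto simp: rkhs_carrier_def)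
  note V = represents_finsupp[OF s]
  have "coefficient (s n) \<phi> \<in> closure pd_cone" for n
    using V[of n] by (intro closure_pd_cone_coefficient[OF \<phi>]) (auto simp: finsupp_def)
  moreover have "(\<lambda>n. coefficient (s n) \<phi>) \<longlonglongrightarrow> (\<lambda>g. if g \<in> carrier G then rkhs_inner (translate g f) f else 0)"
  proof (rule tendsto_fun)
    fix g
    show "(\<lambda>n. coefficient (s n) \<phi> g) \<longlonglongrightarrow> (if g \<in> carrier G then rkhs_inner (translate g f) f else 0)"
    proof (cases "g \<in> carrier G")
      case True
      then show ?thesis using represents_inner[OF represents_translate[OF True s] s]
        by (simp add: coefficient_def form_translate_left V)
    qed (simp add: coefficient_def)
  qed
  ultimately show ?thesis by (intro Lim_in_closed_set[OF closed_closure]) auto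
qed

text \<open>
  Projecting the cyclic vector to an invariant subspace and to its complement would write an extreme
  \<open>\<phi>\<close> as a proper convex combination of two coefficients of the same representation.
\<close>

theorem irreducible_rep:
  assumes \<phi>: "\<phi> \<in> states"
    and extreme: "\<And>x y t. \<lbrakk>x \<in> states; y \<in> states; 0 < t; t < 1; \<phi> = mix t x y\<rbrakk> \<Longrightarrow> x = \<phi>"
  shows "irreducible_unitary_representation G rkhs rep"
proof (rule irreducible_unitary_representation.intro[OF unitary_representation_rep], unfold_locales)
  interpret U: unitary_representation G rkhs rep by (rule unitary_representation_rep)
  have \<phi>1: "\<phi> \<one> = 1" and \<phi>c: "\<phi> \<in> closure pd_cone" using \<phi> by (simp_all add: states_def)
  let ?\<xi> = cyclic_vector
  note \<xi> = cyclic_vector_carrier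
  have \<xi>\<xi>: "rkhs_inner ?\<xi> ?\<xi> = 1"
    using inner_cyclic_vector[OF one_closed] \<phi>1 by (simp add: translate_one \<xi>)
  have vanish: "f = (\<lambda>_. 0)" if "f \<in> rkhs_carrier" "\<And>g. g \<in> carrier G \<Longrightarrow> f g = 0" for f
    using that rkhs_vanish by blast
  have diff: "(\<lambda>b. f b - g b) \<in> rkhs_carrier" if "f \<in> rkhs_carrier" "g \<in> rkhs_carrier" for f g
    using U.M.minus_closed[of f g] that by (simp add: rkhs_minus)
  have inner_diff: "rkhs_inner (\<lambda>b. f b - g b) h = rkhs_inner f h - rkhs_inner g h"
    if "f \<in> rkhs_carrier" "g \<in> rkhs_carrier" "h \<in> rkhs_carrier" for f g h
    using U.inner_minus_left[of f g h] that by (simp add: rkhs_minus)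
  have inner_diff': "rkhs_inner h (\<lambda>b. f b - g b) = rkhs_inner h f - rkhs_inner h g"
    if "f \<in> rkhs_carrier" "g \<in> rkhs_carrier" "h \<in> rkhs_carrier" for f g h
    using U.inner_minus_right[of h f g] that by (simp add: rkhs_minus)
  have commute: "rkhs_inner g f = cnj (rkhs_inner f g)"
    if "f \<in> rkhs_carrier" "g \<in> rkhs_carrier" for f g
    using U.inner_commute[of f g] that by simp
  show "carrier rkhs \<noteq> {\<zero>\<^bsub>rkhs\<^esub>}"
  proof
    assume "carrier rkhs = {\<zero>\<^bsub>rkhs\<^esub>}"
    then have "?\<xi> = (\<lambda>_. 0)" using \<xi> by simp
    then have "rkhs_inner ?\<xi> ?\<xi> = 0" using U.inner_zero_left[of ?\<xi>] \<xi> by simp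
    then show False using \<xi>\<xi> by simp
  qed
  fix W assume W: "closed_subspace W rkhs" and inv: "\<And>g x. \<lbrakk>g \<in> carrier G; x \<in> W\<rbrakk> \<Longrightarrow> rep g x \<in> W"
  have sub: "submodule W complex_ring rkhs" using W by (simp add: closed_subspace_def)
  note WE = U.submoduleE[OF sub]
  have Wc: "f \<in> rkhs_carrier" if "f \<in> W" for f using that WE(1) by auto
  have Wtr: "translate g f \<in> W" if "g \<in> carrier G" "f \<in> W" for g f
    using inv[OF that] Wc[OF that(2)] by (simp add: rep_def)
  have Wscale: "(\<lambda>b. r * f b) \<in> W" if "f \<in> W" for f r
    using WE(4)[of r f] that by (simp add: complex_ring_def)
  \<comment> \<open>A vector and its projection to \<open>W\<close> have the same pairings with the
    translates of the cyclic vector, that is, the same values.\<close>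
  have full: "W = rkhs_carrier" if \<xi>W: "?\<xi> \<in> W"
  proof
    show "W \<subseteq> rkhs_carrier" using Wc by blast
    show "rkhs_carrier \<subseteq> W"
    proof
      fix f assume f: "f \<in> rkhs_carrier"
      obtain v where v: "v \<in> W" "\<And>h. h \<in> W \<Longrightarrow> rkhs_inner f h = rkhs_inner v h"
        using U.orthogonal_projection[OF W, of f] f by auto
      have "f g = v g" if "g \<in> carrier G" for g
        using v(2)[OF Wtr[OF that \<xi>W]] inner_translate_cyclic_vector f Wc[OF v(1)] that by simp
      then have "f = v" using rkhs_vanish f Wc[OF v(1)] by (metis ext)
      then show "f \<in> W" using v by simp
    qed
  qed
  obtain w where w: "w \<in> W" "\<And>h. h \<in> W \<Longrightarrow> rkhs_inner ?\<xi> h = rkhs_inner w h"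
    using U.orthogonal_projection[OF W, of ?\<xi>] \<xi> by auto
  note wc = Wc[OF w(1)]
  define u where "u = (\<lambda>b. ?\<xi> b - w b)"
  have uc: "u \<in> rkhs_carrier" unfolding u_def by (intro diff \<xi> wc)
  have uW: "rkhs_inner u h = 0" if "h \<in> W" for h
    using w(2)[OF that] Wc[OF that] \<xi> wc by (simp add: u_def inner_diff)
  have Wu: "rkhs_inner h u = 0" if "h \<in> W" for h
    using commute[OF uc Wc[OF that]] uW[OF that] by simp
  define t where "t = Re (rkhs_inner w w)"
  have ww: "rkhs_inner w w = of_real t" using U.inner_self[of w] wc by (simp add: t_def)
  have uu: "rkhs_inner u u = of_real (1 - t)"
  proof -
    have "rkhs_inner u ?\<xi> = 1 - t"
      using w(2)[OF w(1)] commute[OF \<xi> wc] ww \<xi>\<xi> \<xi> wc by (simp add: u_def inner_diff)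
    moreover have "rkhs_inner u u = rkhs_inner u ?\<xi> - rkhs_inner u w"
      using inner_diff'[OF \<xi> wc uc] by (simp add: u_def)
    ultimately show ?thesis using uW[OF w(1)] by simp
  qed
  have "0 \<le> t" using U.inner_nonneg[of w] wc by (simp add: t_def)
  moreover have "0 \<le> 1 - t" using U.inner_nonneg[of u] uc uu by simp
  \<comment> \<open>\<open>t\<close> is the squared length of the projection \<open>w\<close>, and
    \<open>1 - t\<close> that of \<open>u\<close>. For \<open>t = 0\<close> all translates of the
    cyclic vector are orthogonal to \<open>W\<close>, so \<open>W\<close> is zero; for
    \<open>t = 1\<close> the cyclic vector lies in \<open>W\<close>.\<close>
  ultimately consider "t = 0" | "t = 1" | "0 < t" "t < 1" by linarith
  then show "W = {\<zero>\<^bsub>rkhs\<^esub>} \<or> W = carrier rkhs"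
  proof cases
    case 1
    then have w0: "w = (\<lambda>_. 0)" using U.inner_eq_zeroD[of w] wc ww by simp
    have "f = (\<lambda>_. 0)" if f: "f \<in> W" for f
    proof (rule vanish[OF Wc[OF f]])
      fix g assume g: "g \<in> carrier G"
      have "f g = cnj (rkhs_inner (translate g ?\<xi>) f)"
        using inner_translate_cyclic_vector[OF Wc[OF f] g]
          commute[OF translate_rkhs_carrier[OF g \<xi>] Wc[OF f]] by simp
      also have "rkhs_inner (translate g ?\<xi>) f = rkhs_inner ?\<xi> (translate (inv g) f)"
        by (rule translate_inner_left[OF g \<xi> Wc[OF f]])
      also have "\<dots> = 0"
        using w(2)[OF Wtr[OF inv_closed[OF g] f]] U.inner_zero_left[of "translate (inv g) f"]
          translate_rkhs_carrier[OF inv_closed[OF g] Wc[OF f]] by (simp add: w0)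
      finally show "f g = 0" by simp
    qed
    then have "W = {\<lambda>_. 0}" using w(1) w0 by blast
    then show ?thesis by simp
  next
    case 2
    then have "u = (\<lambda>_. 0)" using U.inner_eq_zeroD[of u] uc uu by simp
    then have "?\<xi> = w" unfolding u_def by (metis eq_iff_diff_eq_0 ext)
    then show ?thesis using full w(1) by simp
  next
    case 3
    define A where "A f = (\<lambda>g. if g \<in> carrier G then rkhs_inner (translate g f) f else 0)" for f
    define x where "x = (\<lambda>g. of_real (1 / t) * A w g)"
    define y where "y = (\<lambda>g. of_real (1 / (1 - t)) * A u g)"
    have "x \<in> states"
    proof -
      have "A w \<in> closure pd_cone"
        using coefficient_closure_pd_cone[OF \<phi>c wc] by (simp add: A_def)
      then have "x \<in> closure pd_cone" unfolding x_def using 3 by (intro closure_pd_cone_scale) auto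
      moreover have "complex_of_real (1 / t) * complex_of_real (t) = 1"
        unfolding of_real_mult[symmetric] using 3 by simp
      then have "x \<one> = 1" by (simp only: x_def A_def translate_one[OF wc] ww one_closed if_True)
      ultimately show ?thesis by (simp add: states_def)
    qed
    moreover have "y \<in> states"
    proof -
      have "A u \<in> closure pd_cone"
        using coefficient_closure_pd_cone[OF \<phi>c uc] by (simp add: A_def)
      then have "y \<in> closure pd_cone" unfolding y_def using 3 by (intro closure_pd_cone_scale) auto
      moreover have "complex_of_real (1 / (1 - t)) * complex_of_real (1 - t) = 1"
        unfolding of_real_mult[symmetric] using 3 by simp
      then have "y \<one> = 1" by (simp only: y_def A_def translate_one[OF uc] uu one_closed if_True)
      ultimately show ?thesis by (simp add: states_def)
    qed
    \<comment> \<open>The cross terms between \<open>w\<close> and \<open>u\<close> vanish because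
      every translate of \<open>w\<close> stays in \<open>W\<close>, to which \<open>u\<close> is
      orthogonal.\<close>
    moreover have split: "rkhs_inner (translate g w) ?\<xi> = A w g" "\<phi> g = A w g + A u g"
      if g: "g \<in> carrier G" for g
    proof -
      note tc = translate_rkhs_carrier[OF g wc] translate_rkhs_carrier[OF g uc]
        translate_rkhs_carrier[OF g \<xi>]
      have right: "rkhs_inner f ?\<xi> = rkhs_inner f u + rkhs_inner f w" if "f \<in> rkhs_carrier" for f
        using inner_diff'[OF \<xi> wc that] by (simp add: u_def)
      show "rkhs_inner (translate g w) ?\<xi> = A w g"
        using right[OF tc(1)] Wu[OF Wtr[OF g w(1)]] g by (simp add: A_def)
      moreover have "rkhs_inner (translate g u) ?\<xi> = A u g"
        using right[OF tc(2)] translate_inner_left[OF g uc wc] uW[OF Wtr[OF inv_closed[OF g] w(1)]] g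
        by (simp add: A_def)
      moreover have "rkhs_inner (translate g u) ?\<xi>
          = rkhs_inner (translate g ?\<xi>) ?\<xi> - rkhs_inner (translate g w) ?\<xi>"
        using inner_diff[OF tc(3,1) \<xi>] by (simp add: u_def translate_diff)
      ultimately show "\<phi> g = A w g + A u g" using inner_cyclic_vector[OF g] by (simp add: algebra_simps)
    qed
    moreover have "\<phi> = mix t x y"
    proof
      fix g
      show "\<phi> g = mix t x y g"
      proof (cases "g \<in> carrier G")
        case True
        have "complex_of_real t \<noteq> 0" "complex_of_real (1 - t) \<noteq> 0"
          unfolding of_real_eq_0_iff using 3 by auto
        then show ?thesis using split(2)[OF True] by (simp add: mix_def x_def y_def del: of_real_diff)
      next
        case False
        then show ?thesis using pd by (simp add: mix_def x_def y_def A_def positive_definite_def)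
      qed
    qed
    ultimately have x\<phi>: "x = \<phi>" using extreme 3 by blast
    \<comment> \<open>Extremality makes the coefficient of \<open>w\<close> equal to
      \<open>t \<phi>\<close>, so \<open>w\<close> and \<open>t\<close> times the cyclic vector pair
      equally with all translates of the latter. Hence the cyclic vector is a multiple of
      \<open>w\<close> and lies in \<open>W\<close>.\<close>
    have "w g = of_real t * ?\<xi> g" if g: "g \<in> carrier G" for g
    proof -
      note ig = inv_closed[OF g]
      have "w g = rkhs_inner w (translate (inv (inv g)) ?\<xi>)"
        using inner_translate_cyclic_vector[OF wc g] g by simp
      also have "\<dots> = rkhs_inner (translate (inv g) w) ?\<xi>"
        by (rule translate_inner_left[OF ig wc \<xi>, symmetric])
      also have "\<dots> = of_real t * \<phi> (inv g)"
        using split(1)[OF ig] fun_cong[OF x\<phi>, of "inv g"] 3 by (simp add: x_def field_simps)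
      also have "\<phi> (inv g) = rkhs_inner ?\<xi> (translate (inv (inv g)) ?\<xi>)"
        using inner_cyclic_vector[OF ig] translate_inner_left[OF ig \<xi> \<xi>] by simp
      also have "\<dots> = ?\<xi> g" using inner_translate_cyclic_vector[OF \<xi> g] g by simp
      finally show ?thesis .
    qed
    then have "?\<xi> b = of_real (1 / t) * w b" for b
      using 3 rkhs_vanish[OF wc, of b] rkhs_vanish[OF \<xi>, of b] by (cases "b \<in> carrier G") auto
    then have "?\<xi> = (\<lambda>b. of_real (1 / t) * w b)" ..
    then have "?\<xi> \<in> W" using Wscale[OF w(1), of "of_real (1 / t)"] by simp
    then show ?thesis using full by simp
  qed
qed

lemma faithful_rep:
  assumes ker: "\<And>N. \<lbrakk>N \<lhd> G; N \<noteq> {\<one>}\<rbrakk> \<Longrightarrow> \<exists>h\<in>N. \<phi> h \<noteq> 1" and \<phi>1: "\<phi> \<one> = 1"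
  shows "faithful_action G (carrier rkhs) rep"
proof -
  have act: "group_hom G (BijGroup rkhs_carrier) rep"
    using group_action_rep by (simp add: group_action_def)
  note \<xi>\<xi> = inner_cyclic_vector[OF one_closed]
  interpret group_hom G "BijGroup rkhs_carrier" rep by (rule act)
  define N where "N = kernel G (BijGroup rkhs_carrier) rep"
  have "\<phi> h = 1" if h: "h \<in> N" for h
  proof -
    have hc: "h \<in> carrier G" and "rep h = \<one>\<^bsub>BijGroup rkhs_carrier\<^esub>"
      using h by (auto simp: N_def kernel_def)
    then have "rep h cyclic_vector = cyclic_vector" by (simp add: BijGroup_def cyclic_vector_carrier)
    then have "translate h cyclic_vector = translate \<one> cyclic_vector"
      by (simp add: rep_def cyclic_vector_carrier translate_one)
    then show ?thesis using inner_cyclic_vector[OF hc] \<xi>\<xi> \<phi>1 by simp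
  qed
  then have "N = {\<one>}" using ker[of N] normal_kernel by (auto simp: N_def)
  then have "inj_on rep (carrier G)" unfolding N_def by (simp add: inj_iff_trivial_ker)
  then show ?thesis using group_action_rep by (simp add: faithful_action_def faithful_action_axioms_def)
qed

end


section \<open>Groups without finite normal subgroups\<close>

text \<open>In a finite subgroup two powers of a nontrivial element coincide, and their quotient
  exhibits torsion.\<close>

lemma torsionfree_infinite_subgroup:
  fixes G (structure)
  assumes G: "group G" and tf: "torsionfree G" and N: "subgroup N G" "N \<noteq> {\<one>}"
  shows "infinite N"
proof
  interpret group G by fact
  assume fin: "finite N"
  obtain x where x: "x \<in> N" "x \<noteq> \<one>" using N subgroup.one_closed by blast
  have xc: "x \<in> carrier G" using x N subgroup.mem_carrier by metis
  have "x [^] (n::nat) \<in> N" for n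
    using x N by (induction n) (auto simp: subgroup.one_closed subgroup.m_closed)
  then have "\<not> inj (\<lambda>n::nat. x [^] n)"
    using fin finite_imageD[of "\<lambda>n::nat. x [^] n" UNIV] finite_subset[of "range (\<lambda>n::nat. x [^] n)" N]
    by auto
  then obtain m n :: nat where mn: "x [^] m = x [^] n" "m < n"
    unfolding inj_def by (metis linorder_neqE_nat)
  have "x [^] m \<otimes> x [^] (n - m) = x [^] m"
    using mn xc nat_pow_mult[of x m "n - m"] by simp
  then have "x [^] (n - m) = \<one>" using xc by (simp add: l_cancel_one)
  then show False using tf x xc mn unfolding torsionfree_def by (metis zero_less_diff)
qed

text \<open>A normal subgroup contains the conjugacy class of each of its elements.\<close>

lemma icc_infinite_normal:
  fixes G (structure)
  assumes G: "group G" and icc: "icc G" and N: "N \<lhd> G" "N \<noteq> {\<one>}"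
  shows "infinite N"
proof -
  interpret group G by fact
  note sub = normal_imp_subgroup[OF N(1)]
  obtain x where x: "x \<in> N" "x \<noteq> \<one>" using N sub subgroup.one_closed by blast
  have xc: "x \<in> carrier G" using x sub subgroup.mem_carrier by metis
  have "x \<in> conjugacy_class G x" using xc by (auto simp: conjugacy_class_def intro!: exI[of _ \<one>])
  then have "infinite (conjugacy_class G x)" using icc x xc unfolding icc_def by blast
  moreover have "conjugacy_class G x \<subseteq> N"
    using x N(1) by (auto simp: conjugacy_class_def normal_inv_iff)
  ultimately show ?thesis using finite_subset by blast
qed

text \<open>
  The orbit relation of a normal subgroup is invariant, so in a primitive action a nontrivial normal
  subgroup is transitive.
\<close>

lemma primitive_infinite_normal:
  fixes G (structure)
  assumes prim: "primitive_action G E \<phi>" and faith: "faithful_action G E \<phi>" and E: "infinite E"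
    and N: "N \<lhd> G" "N \<noteq> {\<one>}"
  shows "infinite N"
proof
  assume fin: "finite N"
  interpret primitive_action G E \<phi> by fact
  interpret F: faithful_action G E \<phi> by fact
  interpret group G using group_hom by (simp add: group_hom_def)
  note sub = normal_imp_subgroup[OF N(1)]
  have Nc: "h \<in> carrier G" if "h \<in> N" for h using that sub subgroup.mem_carrier by metis
  define r where "r = {(x, y). x \<in> E \<and> (\<exists>h\<in>N. y = \<phi> h x)}"
  have "equiv E r"
  proof (rule equivI)
    show "r \<subseteq> E \<times> E" using element_image Nc by (auto simp: r_def)
    have "\<phi> \<one> x = x" if "x \<in> E" for x using that id_eq_one by (metis restrict_apply')
    then show "refl_on E r"
      using sub by (auto simp: refl_on_def r_def subgroup.one_closed intro!: bexI[of _ \<one>])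
    show "sym r"
    proof (rule symI)
      fix x y assume "(x, y) \<in> r"
      then obtain h where h: "x \<in> E" "h \<in> N" "y = \<phi> h x" by (auto simp: r_def)
      then have "\<phi> (inv h) y = x" "y \<in> E" "inv h \<in> N"
        using orbit_sym_aux Nc element_image sub subgroup.m_inv_closed by metis+
      then show "(y, x) \<in> r" by (force simp: r_def)
    qed
    show "trans r"
    proof (rule transI)
      fix x y z assume "(x, y) \<in> r" "(y, z) \<in> r"
      then obtain h h' where h: "x \<in> E" "h \<in> N" "y = \<phi> h x" "h' \<in> N" "z = \<phi> h' y"
        by (auto simp: r_def)
      then have "z = \<phi> (h' \<otimes> h) x" using composition_rule Nc by metis
      moreover have "h' \<otimes> h \<in> N" using h sub subgroup.m_closed by metis
      ultimately show "(x, z) \<in> r" using h(1) unfolding r_def by blast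
    qed
  qed
  moreover have "(\<phi> g x, \<phi> g y) \<in> r" if g: "g \<in> carrier G" and xy: "(x, y) \<in> r" for g x y
  proof -
    obtain h where h: "x \<in> E" "h \<in> N" "y = \<phi> h x" using xy by (auto simp: r_def)
    have "\<phi> (g \<otimes> h \<otimes> inv g) (\<phi> g x) = \<phi> (g \<otimes> h \<otimes> inv g \<otimes> g) x"
      using g h Nc by (subst composition_rule) auto
    also have "g \<otimes> h \<otimes> inv g \<otimes> g = g \<otimes> h" using g h Nc by (simp add: m_assoc)
    also have "\<phi> (g \<otimes> h) x = \<phi> g y" using g h Nc by (simp add: composition_rule)
    finally have "\<phi> g y = \<phi> (g \<otimes> h \<otimes> inv g) (\<phi> g x)" ..
    moreover have "g \<otimes> h \<otimes> inv g \<in> N" using N(1) g h by (simp add: normal_inv_iff)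
    ultimately show ?thesis using g h(1) element_image unfolding r_def by blast
  qed
  ultimately have "r = Id_on E \<or> r = E \<times> E" by (rule invariant_equiv_trivial)
  then show False
  proof
    \<comment> \<open>All orbits of \<open>N\<close> are single points, so \<open>N\<close> acts
      trivially, against faithfulness.\<close>
    assume r: "r = Id_on E"
    have "h = \<one>" if h: "h \<in> N" for h
    proof -
      have "\<phi> h x = x" if "x \<in> E" for x
      proof -
        have "(x, \<phi> h x) \<in> r" using h that by (auto simp: r_def)
        then show ?thesis unfolding r by auto
      qed
      moreover have "\<phi> h \<in> extensional E" using bij_prop0[OF Nc[OF h]] by (simp add: Bij_def)
      ultimately have "\<phi> h = \<phi> \<one>"
        unfolding id_eq_one[symmetric] by (intro extensionalityI[of _ E]) auto
      then show ?thesis using F.faithful Nc[OF h] by (auto dest: inj_onD)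
    qed
    then show False using N(2) sub subgroup.one_closed by blast
  next
    \<comment> \<open>Now \<open>E\<close> is a single orbit of the finite group \<open>N\<close>,
      hence finite.\<close>
    assume r: "r = E \<times> E"
    obtain x where x: "x \<in> E" using E by (metis finite.emptyI equals0I)
    have "E \<subseteq> (\<lambda>h. \<phi> h x) ` N"
    proof
      fix y assume "y \<in> E"
      then have "(x, y) \<in> r" using x r by simp
      then show "y \<in> (\<lambda>h. \<phi> h x) ` N" by (auto simp: r_def)
    qed
    then show False using E fin finite_surj by blast
  qed
qed

theorem (in group) irreducibly_represented_if_no_finite_normal:
  assumes "countable (carrier G)"
    and "\<And>N. \<lbrakk>N \<lhd> G; N \<noteq> {\<one>}\<rbrakk> \<Longrightarrow> infinite N"
  shows "irreducibly_represented G"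
proof -
  obtain \<phi> where \<phi>: "\<phi> \<in> states"
    "\<And>x y t. \<lbrakk>x \<in> states; y \<in> states; 0 < t; t < 1; \<phi> = mix t x y\<rbrakk> \<Longrightarrow> x = \<phi>"
    "\<And>N. \<lbrakk>N \<lhd> G; N \<noteq> {\<one>}\<rbrakk> \<Longrightarrow> \<exists>h\<in>N. \<phi> h \<noteq> 1"
    using extreme_state_exists[OF assms] by blast
  interpret group_positive_definite G \<phi>
    by unfold_locales (rule states_positive_definite[OF \<phi>(1)])
  have "\<phi> \<one> = 1" using \<phi>(1) by (simp add: states_def)
  with \<phi>(3) have "faithful_action G (carrier rkhs) rep" by (rule faithful_rep)
  moreover have "irreducible_unitary_representation G rkhs rep"
    using \<phi>(1,2) by (rule irreducible_rep)
  ultimately show ?thesis by (intro irreducibly_representedI)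
qed

theorem corollary3:
  fixes G :: "('g, 'z) monoid_scheme"
  assumes "group G"
    and "countable (carrier G)"
    and "torsionfree G \<or> icc G \<or>
      (\<exists>(E :: 'x set) \<phi>. infinite E \<and> primitive_action G E \<phi> \<and> faithful_action G E \<phi>)"
  shows "irreducibly_represented G"
proof (rule group.irreducibly_represented_if_no_finite_normal[OF assms(1,2)])
  fix N assume N: "N \<lhd> G" "N \<noteq> {\<one>\<^bsub>G\<^esub>}"
  from assms(3) show "infinite N"
    using torsionfree_infinite_subgroup[OF assms(1) _ normal_imp_subgroup[OF N(1)] N(2)]
      icc_infinite_normal[OF assms(1) _ N] primitive_infinite_normal[OF _ _ _ N] by blast
qed

end
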